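(* For every $\alpha>0$ the relaxed problem $(\mathcal P^\alpha)$ has at least one optimal solution, denoted $(y_\alpha,v_\alpha,\xi_\alpha)$. Moreover, when $\alpha\to 0$, up to a subsequence, $y_\alpha$ converges strongly to some $\tilde y$ in $H_0^1(\Omega)$, $v_\alpha$ converges strongly to some $\tilde v$ in $L^2(\Omega)$, and $\xi_\alpha$ converges weakly to some $\tilde\xi$ in $L^2(\Omega)$, where $(\tilde y,\tilde v,\tilde\xi)$ is a solution of $(\mathcal P)$.
   Context: Setting. $\Omega\subset\mathbb R^n$ is open and bounded with smooth boundary. $\langle\cdot,\cdot\rangle$ denotes the $L^2(\Omega)$ scalar product and also the duality product between $H^{-1}(\Omega)$ and $H_0^1(\Omega)$. On $H_0^1(\Omega)\times H_0^1(\Omega)$ let $$a(y,z)=\sum_{i,j=1}^n\int_\Omega a_{ij}\frac{\partial y}{\partial x_i}\frac{\partial z}{\partial x_j}\,dx+\sum_{i=1}^n\int_\Omega b_i\frac{\partial y}{\partial x_i}z\,dx+\int_\Omega c\,yz\,dx,$$ with $a_{ij},b_i,c\in L^\infty(\Omega)$, $a_{ij}\in\mathcal C^{0,1}(\bar\Omega)$, $c\ge 0$; $a$ is assumed continuous ($a(y,z)\le M\|y\|_{H_0^1}\|z\|_{H_0^1}$ for some $M>0$) and coercive ($a(y,y)\ge\delta\|y\|_{H_0^1}^2$ for some $\delta>0$). $A:H_0^1(\Omega)\to H^{-1}(\Omega)$ is defined by $\langle Ay,z\rangle=a(y,z)$. The function $g:\mathbb R\to\mathbb R$ is nondecreasing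 and $C^1$, with $g'$ bounded and locally Lipschitz continuous, and there are $\gamma\in\mathbb R$, $\beta\ge 0$ with $|g(t)|\le\gamma+\beta|t|$ for all $t\in\mathbb R$; $g$ also denotes the superposition operator $g(y)(x)=g(y(x))$. $f,z_d,v_d\in L^2(\Omega)$, $\nu>0$, and $U_{ad}$ is a nonempty, closed, convex subset of $L^2(\Omega)$. The obstacle is normalized to $0$. Inequalities between functions hold a.e. in $\Omega$. Put $J(y,v)=\frac12\int_\Omega(y-z_d)^2dx+\frac\nu2\int_\Omega(v-v_d)^2dx$. Problem $(\mathcal P)$: minimize $J(y,v)$ subject to $Ay+g(y)=f+v+\xi$ in $\Omega$, $y=0$ on $\partial\Omega$, and $(y,v,\xi)\in\mathcal D$, where $$\mathcal D=\{(y,v,\xi)\in H_0^1(\Omega)\times L^2(\Omega)\times L^2(\Omega): v\in U_{ad},\ y\ge0,\ \xi\ge0,\ \langle y,\xi\rangle=0\}.$$ The feasible set of $(\mathcal P)$ is assumed nonempty; then $(\mathcal P)$ has a solution, and $(\bar y,\bar v,\bar\xi)$ denotes a fixed one. A constant $R>0$ with $R\ge\|\bar\xi\|_{L^2(\Omega)}$ is fixed. For $\alpha>0$, $$\mathcal D_\alpha=\Big\{(y,v,\xi)\in H_0^1(\Omega)\times L^2(\Omega)\times L^2(\Omega): v\in U_{ad},\ y\ge0,\ \xi\ge0,\ \frac{y}{y+\alpha}+\frac{\xi}{\xi+\alpha}\le1\text{ a.e. in }\Omega,\ \|\xi\|_{L^2(\Omega)}\le R\Big\}.$$ Problem $(\mathcal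 P^\alpha)$: minimize $J(y,v)$ subject to $Ay+g(y)=f+v+\xi$ in $\Omega$, $y\in H_0^1(\Omega)$, $(y,v,\xi)\in\mathcal D_\alpha$. *)

theory Defs
  imports "HOL-Analysis.Analysis"
begin

definition partial_d :: "'n \<Rightarrow> (real ^ 'n \<Rightarrow> real) \<Rightarrow> real ^ 'n \<Rightarrow> real" where
  "partial_d i \<phi> x = frechet_derivative \<phi> (at x) (axis i 1)"

primrec C_k :: "nat \<Rightarrow> (real ^ 'n \<Rightarrow> real) \<Rightarrow> bool" where
  "C_k 0 \<phi> \<longleftrightarrow> continuous_on UNIV \<phi>"
| "C_k (Suc k) \<phi> \<longleftrightarrow> (\<forall>x. \<phi> differentiable (at x)) \<and> (\<forall>i. C_k k (partial_d i \<phi>))"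

definition C_infinity :: "(real ^ 'n \<Rightarrow> real) \<Rightarrow> bool" where
  "C_infinity \<phi> \<longleftrightarrow> (\<forall>k. C_k k \<phi>)"

text \<open>Locally, \<open>\<Omega>\<close> lies strictly on one side of the graph of a smooth function over the
  hyperplane orthogonal to a unit vector \<open>e\<close>. The point \<open>x - (x \<bullet> e) *\<^sub>R e\<close> is the
  projection of \<open>x\<close> onto that hyperplane; only the values of \<open>h\<close> on the hyperplane matter.\<close>

definition smooth_boundary :: "(real ^ 'n) set \<Rightarrow> bool" where
  "smooth_boundary \<Omega> \<longleftrightarrow>
     (\<forall>p \<in> frontier \<Omega>. \<exists>r > 0. \<exists>e h. norm e = 1 \<and> C_infinity h \<and>
        \<Omega> \<inter> ball p r = {x \<in> ball p r. h (x - (x \<bullet> e) *\<^sub>R e) < x \<bullet> e})"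

definition test_functions :: "(real ^ 'n) set \<Rightarrow> (real ^ 'n \<Rightarrow> real) set" where
  "test_functions \<Omega> =
     {\<phi>. C_infinity \<phi> \<and> compact (closure {x. \<phi> x \<noteq> 0}) \<and> closure {x. \<phi> x \<noteq> 0} \<subseteq> \<Omega>}"

text \<open>Elements of \<open>L\<^sup>2\<close>, \<open>L\<^sup>\<infinity>\<close> and the Sobolev spaces are represented by functions; two
  functions that agree almost everywhere represent the same element. The values outside \<open>\<Omega>\<close>
  are irrelevant, since all integrals are taken over \<open>lebesgue_on \<Omega>\<close>.\<close>

definition L2 :: "(real ^ 'n) set \<Rightarrow> (real ^ 'n \<Rightarrow> real) set" where
  "L2 \<Omega> = {u \<in> borel_measurable (lebesgue_on \<Omega>). integrable (lebesgue_on \<Omega>) (\<lambda>x. (u x)\<^sup>2)}"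

definition L2_inner :: "(real ^ 'n) set \<Rightarrow> (real ^ 'n \<Rightarrow> real) \<Rightarrow> (real ^ 'n \<Rightarrow> real) \<Rightarrow> real" where
  "L2_inner \<Omega> u v = (LINT x|lebesgue_on \<Omega>. u x * v x)"

definition L2_norm :: "(real ^ 'n) set \<Rightarrow> (real ^ 'n \<Rightarrow> real) \<Rightarrow> real" where
  "L2_norm \<Omega> u = sqrt (L2_inner \<Omega> u u)"

definition L_infinity :: "(real ^ 'n) set \<Rightarrow> (real ^ 'n \<Rightarrow> real) set" where
  "L_infinity \<Omega> = {u \<in> borel_measurable (lebesgue_on \<Omega>). \<exists>C. AE x in lebesgue_on \<Omega>. \<bar>u x\<bar> \<le> C}"

definition L2_tendsto ::
  "(real ^ 'n) set \<Rightarrow> (nat \<Rightarrow> real ^ 'n \<Rightarrow> real) \<Rightarrow> (real ^ 'n \<Rightarrow> real) \<Rightarrow> bool" where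
  "L2_tendsto \<Omega> u w \<longleftrightarrow> (\<lambda>k. L2_norm \<Omega> (\<lambda>x. u k x - w x)) \<longlonglongrightarrow> 0"

definition L2_weakly_tendsto ::
  "(real ^ 'n) set \<Rightarrow> (nat \<Rightarrow> real ^ 'n \<Rightarrow> real) \<Rightarrow> (real ^ 'n \<Rightarrow> real) \<Rightarrow> bool" where
  "L2_weakly_tendsto \<Omega> u w \<longleftrightarrow> (\<forall>h \<in> L2 \<Omega>. (\<lambda>k. L2_inner \<Omega> (u k) h) \<longlonglongrightarrow> L2_inner \<Omega> w h)"

text \<open>Closedness forces a set of representatives to be invariant under changes on null sets
  (consider constant sequences).\<close>

definition L2_closed :: "(real ^ 'n) set \<Rightarrow> (real ^ 'n \<Rightarrow> real) set \<Rightarrow> bool" where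
  "L2_closed \<Omega> U \<longleftrightarrow> (\<forall>u w. (\<forall>k. u k \<in> U) \<and> w \<in> L2 \<Omega> \<and> L2_tendsto \<Omega> u w \<longrightarrow> w \<in> U)"

definition convex_functions :: "('x \<Rightarrow> real) set \<Rightarrow> bool" where
  "convex_functions U \<longleftrightarrow>
     (\<forall>u \<in> U. \<forall>v \<in> U. \<forall>t \<in> {0..1}. (\<lambda>x. (1 - t) * u x + t * v x) \<in> U)"

definition has_weak_pd ::
  "(real ^ 'n) set \<Rightarrow> 'n \<Rightarrow> (real ^ 'n \<Rightarrow> real) \<Rightarrow> (real ^ 'n \<Rightarrow> real) \<Rightarrow> bool" where
  "has_weak_pd \<Omega> i u w \<longleftrightarrow> u \<in> L2 \<Omega> \<and> w \<in> L2 \<Omega> \<and>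
     (\<forall>\<phi> \<in> test_functions \<Omega>. L2_inner \<Omega> u (partial_d i \<phi>) = - L2_inner \<Omega> w \<phi>)"

text \<open>A representative of the weak partial derivative, which is unique up to null sets.\<close>

definition weak_pd :: "(real ^ 'n) set \<Rightarrow> 'n \<Rightarrow> (real ^ 'n \<Rightarrow> real) \<Rightarrow> real ^ 'n \<Rightarrow> real" where
  "weak_pd \<Omega> i u = (SOME w. has_weak_pd \<Omega> i u w)"

definition H1 :: "(real ^ 'n) set \<Rightarrow> (real ^ 'n \<Rightarrow> real) set" where
  "H1 \<Omega> = {u \<in> L2 \<Omega>. \<forall>i. \<exists>w. has_weak_pd \<Omega> i u w}"

definition H1_norm :: "(real ^ 'n) set \<Rightarrow> (real ^ 'n \<Rightarrow> real) \<Rightarrow> real" where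
  "H1_norm \<Omega> u = sqrt ((L2_norm \<Omega> u)\<^sup>2 + (\<Sum>i\<in>UNIV. (L2_norm \<Omega> (weak_pd \<Omega> i u))\<^sup>2))"

definition H1_tendsto ::
  "(real ^ 'n) set \<Rightarrow> (nat \<Rightarrow> real ^ 'n \<Rightarrow> real) \<Rightarrow> (real ^ 'n \<Rightarrow> real) \<Rightarrow> bool" where
  "H1_tendsto \<Omega> u w \<longleftrightarrow> (\<lambda>k. H1_norm \<Omega> (\<lambda>x. u k x - w x)) \<longlonglongrightarrow> 0"

text \<open>The closure of the test functions in \<open>H\<^sup>1\<close>, normed by \<open>H1_norm\<close>. Membership encodes the
  homogeneous Dirichlet condition on the boundary.\<close>

definition H10 :: "(real ^ 'n) set \<Rightarrow> (real ^ 'n \<Rightarrow> real) set" where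
  "H10 \<Omega> = {u \<in> H1 \<Omega>. \<exists>\<phi>. (\<forall>k. \<phi> k \<in> test_functions \<Omega>) \<and> H1_tendsto \<Omega> \<phi> u}"

definition bilinear_form ::
  "(real ^ 'n) set \<Rightarrow> ('n \<Rightarrow> 'n \<Rightarrow> real ^ 'n \<Rightarrow> real) \<Rightarrow> ('n \<Rightarrow> real ^ 'n \<Rightarrow> real) \<Rightarrow>
     (real ^ 'n \<Rightarrow> real) \<Rightarrow> (real ^ 'n \<Rightarrow> real) \<Rightarrow> (real ^ 'n \<Rightarrow> real) \<Rightarrow> real" where
  "bilinear_form \<Omega> a b c y z =
     (\<Sum>i\<in>UNIV. \<Sum>j\<in>UNIV. LINT x|lebesgue_on \<Omega>. a i j x * weak_pd \<Omega> i y x * weak_pd \<Omega> j z x)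
     + (\<Sum>i\<in>UNIV. LINT x|lebesgue_on \<Omega>. b i x * weak_pd \<Omega> i y x * z x)
     + (LINT x|lebesgue_on \<Omega>. c x * y x * z x)"

text \<open>Elements of \<open>H\<^sup>-\<^sup>1\<close> are represented by functionals, of which only the values on \<open>H10 \<Omega>\<close>
  matter; \<open>h \<in> L2 \<Omega>\<close> is identified with the functional \<open>L2_inner \<Omega> h\<close>.\<close>

definition operator_A ::
  "(real ^ 'n) set \<Rightarrow> ('n \<Rightarrow> 'n \<Rightarrow> real ^ 'n \<Rightarrow> real) \<Rightarrow> ('n \<Rightarrow> real ^ 'n \<Rightarrow> real) \<Rightarrow>
     (real ^ 'n \<Rightarrow> real) \<Rightarrow> (real ^ 'n \<Rightarrow> real) \<Rightarrow> ((real ^ 'n \<Rightarrow> real) \<Rightarrow> real)" where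
  "operator_A \<Omega> a b c y = (\<lambda>z. bilinear_form \<Omega> a b c y z)"

definition state_equation ::
  "(real ^ 'n) set \<Rightarrow> ('n \<Rightarrow> 'n \<Rightarrow> real ^ 'n \<Rightarrow> real) \<Rightarrow> ('n \<Rightarrow> real ^ 'n \<Rightarrow> real) \<Rightarrow>
     (real ^ 'n \<Rightarrow> real) \<Rightarrow> (real \<Rightarrow> real) \<Rightarrow> (real ^ 'n \<Rightarrow> real) \<Rightarrow>
     (real ^ 'n \<Rightarrow> real) \<Rightarrow> (real ^ 'n \<Rightarrow> real) \<Rightarrow> (real ^ 'n \<Rightarrow> real) \<Rightarrow> bool" where
  "state_equation \<Omega> a b c g f y v \<xi> \<longleftrightarrow> y \<in> H10 \<Omega> \<and>
     (\<forall>z \<in> H10 \<Omega>. operator_A \<Omega> a b c y z + L2_inner \<Omega> (\<lambda>x. g (y x)) z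
                   = L2_inner \<Omega> (\<lambda>x. f x + v x + \<xi> x) z)"

definition locally_lipschitz :: "(real \<Rightarrow> real) \<Rightarrow> bool" where
  "locally_lipschitz h \<longleftrightarrow> (\<forall>t. \<exists>r > 0. \<exists>L. L-lipschitz_on (ball t r) h)"

type_synonym 'n triple = "(real ^ 'n \<Rightarrow> real) \<times> (real ^ 'n \<Rightarrow> real) \<times> (real ^ 'n \<Rightarrow> real)"

definition cost ::
  "(real ^ 'n) set \<Rightarrow> (real ^ 'n \<Rightarrow> real) \<Rightarrow> (real ^ 'n \<Rightarrow> real) \<Rightarrow> real \<Rightarrow>
     (real ^ 'n \<Rightarrow> real) \<Rightarrow> (real ^ 'n \<Rightarrow> real) \<Rightarrow> real" where
  "cost \<Omega> z\<^sub>d v\<^sub>d \<nu> y v =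
     1 / 2 * (LINT x|lebesgue_on \<Omega>. (y x - z\<^sub>d x)\<^sup>2)
     + \<nu> / 2 * (LINT x|lebesgue_on \<Omega>. (v x - v\<^sub>d x)\<^sup>2)"

definition constraint_set ::
  "(real ^ 'n) set \<Rightarrow> (real ^ 'n \<Rightarrow> real) set \<Rightarrow> 'n triple set" where
  "constraint_set \<Omega> U =
     {(y, v, \<xi>). y \<in> H10 \<Omega> \<and> v \<in> L2 \<Omega> \<and> \<xi> \<in> L2 \<Omega> \<and> v \<in> U \<and>
        (AE x in lebesgue_on \<Omega>. 0 \<le> y x) \<and> (AE x in lebesgue_on \<Omega>. 0 \<le> \<xi> x) \<and>
        L2_inner \<Omega> y \<xi> = 0}"

definition relaxed_constraint_set ::
  "(real ^ 'n) set \<Rightarrow> (real ^ 'n \<Rightarrow> real) set \<Rightarrow> real \<Rightarrow> real \<Rightarrow> 'n triple set" where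
  "relaxed_constraint_set \<Omega> U R \<alpha> =
     {(y, v, \<xi>). y \<in> H10 \<Omega> \<and> v \<in> L2 \<Omega> \<and> \<xi> \<in> L2 \<Omega> \<and> v \<in> U \<and>
        (AE x in lebesgue_on \<Omega>. 0 \<le> y x) \<and> (AE x in lebesgue_on \<Omega>. 0 \<le> \<xi> x) \<and>
        (AE x in lebesgue_on \<Omega>. y x / (y x + \<alpha>) + \<xi> x / (\<xi> x + \<alpha>) \<le> 1) \<and>
        L2_norm \<Omega> \<xi> \<le> R}"

definition feasible ::
  "(real ^ 'n) set \<Rightarrow> ('n \<Rightarrow> 'n \<Rightarrow> real ^ 'n \<Rightarrow> real) \<Rightarrow> ('n \<Rightarrow> real ^ 'n \<Rightarrow> real) \<Rightarrow>
     (real ^ 'n \<Rightarrow> real) \<Rightarrow> (real \<Rightarrow> real) \<Rightarrow> (real ^ 'n \<Rightarrow> real) \<Rightarrow> 'n triple set \<Rightarrow>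
     'n triple set" where
  "feasible \<Omega> a b c g f D = {(y, v, \<xi>) \<in> D. state_equation \<Omega> a b c g f y v \<xi>}"

definition optimal_solution ::
  "((real ^ 'n \<Rightarrow> real) \<Rightarrow> (real ^ 'n \<Rightarrow> real) \<Rightarrow> real) \<Rightarrow> 'n triple set \<Rightarrow> 'n triple \<Rightarrow> bool" where
  "optimal_solution J F p \<longleftrightarrow> is_arg_min (\<lambda>(y, v, \<xi>). J y v) (\<lambda>q. q \<in> F) p"

end

theory Submission
  imports Defs "HOL-Complex_Analysis.Great_Picard"
begin

text \<open>
  For nonnegative functions the relaxed constraint says exactly that the product of state and multiplier
  is at most \<open>\<alpha>\<^sup>2\<close> almost everywhere (\<open>relaxed_complementarity_iff\<close>). In this form it survives limits in
  which the states converge strongly and the multipliers weakly in \<open>L\<^sup>2\<close>, also if \<open>\<alpha>\<close> varies and tends to zero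
  (\<open>limit_product_le\<close>); in the limit \<open>\<alpha> = 0\<close> it is the complementarity condition.

  Both claims thus rest on one compactness statement, \<open>relaxed_feasible_limit\<close>. Controls are bounded by the
  cost, multipliers by \<open>R\<close>, so both converge weakly along a subsequence. Coercivity and the monotonicity
  of \<open>g\<close> bound the states in \<open>H\<^sup>1\<close>, and Rellich's theorem makes them Cauchy in \<open>L\<^sup>2\<close>. Subtracting two state equations and
  testing with the difference of the states then bounds the square of its \<open>H\<^sup>1\<close> norm by a multiple
  of its \<open>L\<^sup>2\<close> norm (\<open>state_difference\<close>), so that the states converge strongly in \<open>H\<^sup>1\<close> and the equation passes to the limit.

  For fixed \<open>\<alpha>\<close> this is applied to a minimizing sequence (\<open>relaxed_solution_exists\<close>). For \<open>\<alpha>\<close> tending to zero it is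
  applied to the relaxed solutions: the given solution of the original problem competes in every relaxed
  problem, so the limit, which is feasible for the original problem, is optimal and the costs converge; this
  upgrades the weak convergence of the controls to strong convergence (\<open>relaxed_solutions_converge\<close>).

  The functional analysis is built from the definitions. Classes of square-integrable functions form a
  Hilbert space, in which weak sequential compactness and Mazur's theorem follow from points of least
  norm in closed convex sets. Weak derivatives are unique by the fundamental lemma of the calculus of
  variations. Rellich's theorem compares a function with its averages over small balls: the difference is
  controlled by the gradient (\<open>ball_average_estimate\<close>), and averaging turns weak into strong convergence.\<close>

section \<open>Weak compactness in Hilbert spaces\<close>

lemma parallelogram_midpoint:
  fixes x y :: "'h::real_inner"
  shows "(norm (x - y))\<^sup>2 = 2 * (norm x)\<^sup>2 + 2 * (norm y)\<^sup>2 - 4 * (norm ((1/2) *\<^sub>R x + (1/2) *\<^sub>R y))\<^sup>2"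
  by (simp add: power2_norm_eq_inner algebra_simps inner_commute)

lemma convex_midpoint_mem:
  assumes "convex C" "x \<in> C" "y \<in> C"
  shows "(1/2) *\<^sub>R x + (1/2) *\<^sub>R (y::'h::real_vector) \<in> C"
  using assms by (auto simp: convex_def)

text \<open>A minimizing sequence is Cauchy: the midpoints of its members stay in \<open>C\<close>, so their norms
  are bounded below by the infimum, and the parallelogram law bounds the distances.\<close>

lemma min_norm_point:
  fixes C :: "'h::{real_inner,complete_space} set"
  assumes "closed C" "convex C" "C \<noteq> {}"
  obtains p where "p \<in> C" "\<And>x. x \<in> C \<Longrightarrow> norm p \<le> norm x"
proof -
  define d where "d = Inf (norm ` C)"
  have bdd: "bdd_below (norm ` C)" by (rule bdd_belowI2[of _ 0]) simp
  have d_le: "d \<le> norm x" if "x \<in> C" for x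
    unfolding d_def using bdd that by (simp add: cINF_lower)
  have "d \<ge> 0" unfolding d_def using assms(3) by (intro cINF_greatest) auto
  have "\<exists>x\<in>C. norm x < d + 1 / real (Suc n)" for n
    using cINF_less_iff[OF assms(3) bdd, of "d + 1 / real (Suc n)"] unfolding d_def by auto
  then obtain x where xC: "x n \<in> C" and xd: "norm (x n) < d + 1 / real (Suc n)" for n by metis
  have lim: "(\<lambda>n. norm (x n)) \<longlonglongrightarrow> d"
  proof (rule real_tendsto_sandwich)
    show "\<forall>\<^sub>F n in sequentially. d \<le> norm (x n)"
      "\<forall>\<^sub>F n in sequentially. norm (x n) \<le> d + 1 / real (Suc n)"
      by (intro always_eventually allI d_le xC less_imp_le[OF xd])+
    show "(\<lambda>n. d + 1 / real (Suc n)) \<longlonglongrightarrow> d"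
      using tendsto_add[OF tendsto_const LIMSEQ_inverse_real_of_nat, of d] by (simp only: inverse_eq_divide add_0_right)
  qed (rule tendsto_const)
  have "Cauchy x"
  proof (rule metric_CauchyI)
    fix e :: real assume "e > 0"
    have "(\<lambda>n. (norm (x n))\<^sup>2) \<longlonglongrightarrow> d\<^sup>2" by (intro tendsto_intros lim)
    then have "\<forall>\<^sub>F n in sequentially. (norm (x n))\<^sup>2 < d\<^sup>2 + e\<^sup>2 / 4"
      by (rule order_tendstoD) (use \<open>e > 0\<close> in simp)
    then obtain N where N: "\<And>n. n \<ge> N \<Longrightarrow> (norm (x n))\<^sup>2 < d\<^sup>2 + e\<^sup>2 / 4"
      by (auto simp: eventually_sequentially)
    have "dist (x m) (x n) < e" if "m \<ge> N" "n \<ge> N" for m n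
    proof -
      have "d\<^sup>2 \<le> (norm ((1/2) *\<^sub>R x m + (1/2) *\<^sub>R x n))\<^sup>2"
        by (intro power_mono d_le convex_midpoint_mem assms(2) xC \<open>d \<ge> 0\<close>)
      then have "(norm (x m - x n))\<^sup>2 < e\<^sup>2"
        using N[OF that(1)] N[OF that(2)] by (simp add: parallelogram_midpoint)
      then show ?thesis using \<open>e > 0\<close> by (simp add: dist_norm power_less_imp_less_base)
    qed
    then show "\<exists>M. \<forall>m\<ge>M. \<forall>n\<ge>M. dist (x m) (x n) < e" by blast
  qed
  then obtain p where p: "x \<longlonglongrightarrow> p" using Cauchy_convergent_iff convergent_def by blast
  have "p \<in> C" using closed_sequentially[OF assms(1) _ p] xC by blast
  moreover have "norm p = d" using LIMSEQ_unique[OF tendsto_norm[OF p] lim] .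
  ultimately show ?thesis using d_le that by auto
qed

text \<open>Mazur's theorem. After translating \<open>p\<close> to the origin, the point \<open>q\<close> of least norm satisfies the
  variational inequality \<open>inner q q \<le> inner x q\<close> on the translated set; along the sequence the right-hand side
  tends to \<open>0\<close>, whence \<open>q = 0\<close>.\<close>

lemma weak_limit_in_closed_convex:
  fixes u :: "nat \<Rightarrow> 'h::{real_inner,complete_space}"
  assumes "closed C" "convex C" "\<And>k. u k \<in> C"
    and lim: "\<And>h. (\<lambda>k. inner (u k) h) \<longlonglongrightarrow> inner p h"
  shows "p \<in> C"
proof -
  define D where "D = (\<lambda>x. - p + x) ` C"
  have uD: "u k - p \<in> D" for k unfolding D_def using assms(3) by force
  then have D: "closed D" "convex D" "D \<noteq> {}"
    unfolding D_def
    by (blast intro: closed_translation[OF assms(1)] convex_translation[OF assms(2)])+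
  obtain q where q: "q \<in> D" "\<And>x. x \<in> D \<Longrightarrow> norm q \<le> norm x" using min_norm_point[OF D] by metis
  have "0 \<ge> inner q q"
  proof -
    have ge: "inner (u k - p) q \<ge> inner q q" for k
    proof (rule ccontr)
      let ?x = "u k - p"
      define s where "s = inner q q - inner ?x q"
      assume "\<not> ?thesis"
      then have s: "s > 0" by (simp add: s_def)
      define w where "w = (norm (?x - q))\<^sup>2"
      \<comment> \<open>Otherwise a short step from \<open>q\<close> towards \<open>u k - p\<close> would decrease the norm.\<close>
      have exp: "(norm (q + t *\<^sub>R (?x - q)))\<^sup>2 = (norm q)\<^sup>2 - 2 * t * s + t\<^sup>2 * w" for t
        unfolding w_def s_def power2_norm_eq_inner
        by (simp add: algebra_simps inner_commute power2_eq_square)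
      define t where "t = min 1 (s / (w + 1))"
      have w: "w \<ge> 0" by (simp add: w_def)
      have t: "0 < t" "t \<le> 1" using s w by (auto simp: t_def)
      have "t \<le> s / (w + 1)" by (simp add: t_def)
      then have t3: "t * (w + 1) \<le> s" using w by (simp add: pos_le_divide_eq)
      have "q + t *\<^sub>R (?x - q) = (1 - t) *\<^sub>R q + t *\<^sub>R ?x" by (simp add: algebra_simps)
      also have "\<dots> \<in> D" using t by (intro convexD[OF D(2) q(1) uD]) auto
      finally have "(norm q)\<^sup>2 \<le> (norm (q + t *\<^sub>R (?x - q)))\<^sup>2" by (intro power_mono q(2)) auto
      then have "t * (2 * s) \<le> t * (t * w)" unfolding exp by (simp add: algebra_simps power2_eq_square)
      then have "2 * s \<le> t * w" using t by simp
      moreover have "t * w \<le> s" using t t3 by (simp add: algebra_simps)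
      ultimately show False using s by simp
    qed
    have "(\<lambda>k. inner (u k - p) q) \<longlonglongrightarrow> inner p q - inner p q"
      unfolding inner_diff_left by (intro tendsto_intros lim)
    from tendsto_lowerbound[OF this always_eventually[OF allI[OF ge]] trivial_limit_sequentially]
    show ?thesis by simp
  qed
  then have "q = 0" by (metis inner_gt_zero_iff not_le)
  with q(1) show ?thesis unfolding D_def by (auto simp: algebra_simps)
qed

text \<open>The points of least norm in the closed convex hulls of the tails have increasing norms,
  so the parallelogram law makes them a Cauchy sequence.\<close>

lemma closed_convex_tails_intersect:
  fixes u :: "nat \<Rightarrow> 'h::{real_inner,complete_space}"
  assumes "bounded (range u)"
  obtains p where "\<And>n. p \<in> closure (convex hull (u ` {n..}))"
proof -
  define K where "K n = closure (convex hull (u ` {n..}))" for n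
  have K: "closed (K n)" "convex (K n)" "K n \<noteq> {}" for n
    unfolding K_def by (auto simp: convex_closure)
  have uK: "u k \<in> K n" if "k \<ge> n" for k n
    unfolding K_def using that by (intro subsetD[OF closure_subset] hull_inc) auto
  have mono: "K m \<subseteq> K n" if "n \<le> m" for n m
    unfolding K_def using that by (intro closure_mono hull_mono image_mono) auto
  have "\<exists>p. p \<in> K n \<and> (\<forall>x\<in>K n. norm p \<le> norm x)" for n
    using min_norm_point[OF K] by metis
  then obtain p where p: "p n \<in> K n" and pmin: "\<And>x. x \<in> K n \<Longrightarrow> norm (p n) \<le> norm x" for n
    by metis
  obtain B where B: "\<And>k. norm (u k) \<le> B" using assms by (auto simp: bounded_iff)
  have inc: "incseq (\<lambda>n. (norm (p n))\<^sup>2)"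
    unfolding incseq_def by (intro allI impI power_mono pmin subsetD[OF mono p]) auto
  have "(norm (p n))\<^sup>2 \<le> B\<^sup>2" for n
    by (intro power_mono order_trans[OF pmin[OF uK[OF order_refl]] B]) simp
  then obtain l where l: "(\<lambda>n. (norm (p n))\<^sup>2) \<longlonglongrightarrow> l" "\<And>n. (norm (p n))\<^sup>2 \<le> l"
    using incseq_convergent[OF inc] by blast
  have "Cauchy p"
  proof (rule metric_CauchyI)
    fix e :: real assume "e > 0"
    have "\<forall>\<^sub>F n in sequentially. (norm (p n))\<^sup>2 > l - e\<^sup>2 / 4"
      by (rule order_tendstoD[OF l(1)]) (use \<open>e > 0\<close> in simp)
    then obtain N where N: "\<And>n. n \<ge> N \<Longrightarrow> (norm (p n))\<^sup>2 > l - e\<^sup>2 / 4"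
      by (auto simp: eventually_sequentially)
    have "dist (p m) (p n) < e" if "m \<ge> N" "n \<ge> N" for m n
    proof -
      have "(norm (p N))\<^sup>2 \<le> (norm ((1/2) *\<^sub>R p m + (1/2) *\<^sub>R p n))\<^sup>2"
        by (intro power_mono pmin convex_midpoint_mem K(2) subsetD[OF mono p] that) simp
      then have "(norm (p m - p n))\<^sup>2 < e\<^sup>2"
        unfolding parallelogram_midpoint using N[OF order_refl] l(2)[of m] l(2)[of n] by linarith
      then show ?thesis using \<open>e > 0\<close> by (simp add: dist_norm power_less_imp_less_base)
    qed
    then show "\<exists>M. \<forall>m\<ge>M. \<forall>n\<ge>M. dist (p m) (p n) < e" by blast
  qed
  then obtain q where q: "p \<longlonglongrightarrow> q" using Cauchy_convergent_iff convergent_def by blast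
  have "q \<in> K n" for n
  proof (rule closed_sequentially[OF K(1) _ LIMSEQ_ignore_initial_segment[OF q, of n]])
    show "p (k + n) \<in> K n" for k using subsetD[OF mono p] by simp
  qed
  with that show ?thesis unfolding K_def by blast
qed

text \<open>Every slab around \<open>{x. inner x h = c}\<close> is closed and convex and contains a tail of the sequence.\<close>

lemma inner_eq_limit_of_tails:
  fixes u :: "nat \<Rightarrow> 'h::real_inner"
  assumes p: "\<And>n. p \<in> closure (convex hull (u ` {n..}))"
    and lim: "(\<lambda>k. inner (u k) h) \<longlonglongrightarrow> c"
  shows "inner p h = c"
proof -
  have le: "\<bar>inner p h - c\<bar> \<le> e" if "e > 0" for e
  proof -
    obtain n where n: "\<And>k. k \<ge> n \<Longrightarrow> \<bar>inner (u k) h - c\<bar> < e"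
      using LIMSEQ_D[OF lim \<open>e > 0\<close>] by auto
    have eq: "{x. \<bar>inner x h - c\<bar> \<le> e} = {x. inner h x \<le> c + e} \<inter> {x. inner h x \<ge> c - e}"
      by (auto simp: inner_commute abs_le_iff)
    have "closed {x. \<bar>inner x h - c\<bar> \<le> e}"
      by (intro closed_Collect_le continuous_intros)
    moreover have "convex {x. \<bar>inner x h - c\<bar> \<le> e}"
      unfolding eq by (intro convex_Int convex_halfspace_le convex_halfspace_ge)
    moreover have "u ` {n..} \<subseteq> {x. \<bar>inner x h - c\<bar> \<le> e}" using n by (auto intro: less_imp_le)
    ultimately have "closure (convex hull (u ` {n..})) \<subseteq> {x. \<bar>inner x h - c\<bar> \<le> e}"
      by (intro closure_minimal hull_minimal) auto
    then show ?thesis using p by blast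
  qed
  have "\<bar>inner p h - c\<bar> \<le> 0" by (rule field_le_epsilon) (simp add: le)
  then show ?thesis by simp
qed

text \<open>A diagonal subsequence makes the products with all members of the sequence converge. If the
  products with some \<open>h\<close> did not tend to \<open>inner p h\<close>, a further subsequence would produce a second
  point \<open>p'\<close> with a different product; but \<open>p - p'\<close> is orthogonal to the whole sequence and lies
  in its closed span, so that it vanishes.\<close>

theorem bounded_weakly_convergent_subseq:
  fixes u :: "nat \<Rightarrow> 'h::{real_inner,complete_space}"
  assumes bdd: "bounded (range u)"
  obtains s p where "strict_mono (s::nat \<Rightarrow> nat)" "\<And>h. (\<lambda>k. inner (u (s k)) h) \<longlonglongrightarrow> inner p h"
proof -
  obtain B where B: "\<And>k. norm (u k) \<le> B" using bdd by (auto simp: bounded_iff)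
  have "countable (range u)" by simp
  moreover have "norm (inner (u n) x) \<le> B * B" if "x \<in> range u" for n x
  proof -
    have "norm (inner (u n) x) \<le> norm (u n) * norm x" by (simp add: Cauchy_Schwarz_ineq2)
    also have "\<dots> \<le> B * B" using that B[of 0] norm_ge_zero[of "u 0"] by (intro mult_mono) (auto intro: B order_trans[OF norm_ge_zero B])
    finally show ?thesis .
  qed
  ultimately obtain s where s: "strict_mono (s::nat\<Rightarrow>nat)"
    and conv: "\<And>x. x \<in> range u \<Longrightarrow> \<exists>l. (\<lambda>n. inner (u (s n)) x) \<longlonglongrightarrow> l"
    using function_convergent_subsequence[of "range u" "\<lambda>n x. inner (u n) x" "B * B"] by blast
  define w where "w = u \<circ> s"
  have wb: "bounded (range (w \<circ> r))" for r :: "nat \<Rightarrow> nat"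
    by (rule bounded_subset[OF bdd]) (auto simp: w_def)
  obtain p where p: "\<And>n. p \<in> closure (convex hull (w ` {n..}))"
    using closed_convex_tails_intersect[OF wb[of id]] by auto
  have "(\<lambda>k. inner (w k) h) \<longlonglongrightarrow> inner p h" for h
  proof (rule ccontr)
    assume "\<not> ?thesis"
    then obtain e where e: "e > 0"
      and "\<exists>\<^sub>F k in sequentially. \<bar>inner (w k) h - inner p h\<bar> \<ge> e"
      unfolding tendsto_iff dist_real_def frequently_def not_le by blast
    then have "infinite {k. \<bar>inner (w k) h - inner p h\<bar> \<ge> e}"
      by (simp add: frequently_cofinite cofinite_eq_sequentially[symmetric] del: not_le)
    from infinite_enumerate[OF this] obtain r
      where r: "strict_mono (r::nat\<Rightarrow>nat)" "\<And>n. \<bar>inner (w (r n)) h - inner p h\<bar> \<ge> e"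
      by auto
    have "bounded (range (\<lambda>n. inner (w (r n)) h))"
    proof (rule boundedI)
      fix x assume "x \<in> range (\<lambda>n. inner (w (r n)) h)"
      then show "norm x \<le> B * norm h"
        using B by (auto simp: w_def intro!: order_trans[OF Cauchy_Schwarz_ineq2] mult_right_mono)
    qed
    then obtain c q where q: "strict_mono (q::nat\<Rightarrow>nat)" "((\<lambda>n. inner (w (r n)) h) \<circ> q) \<longlonglongrightarrow> c"
      using bounded_imp_convergent_subsequence by blast
    define v where "v = w \<circ> r \<circ> q"
    have vb: "bounded (range v)" using wb[of "r \<circ> q"] by (simp add: v_def comp_assoc)
    obtain p' where p': "\<And>n. p' \<in> closure (convex hull (v ` {n..}))"
      using closed_convex_tails_intersect[OF vb] by auto
    have orth: "inner (p - p') x = 0" if x: "x \<in> range u" for x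
    proof -
      obtain l where l: "(\<lambda>n. inner (w n) x) \<longlonglongrightarrow> l" using conv[OF x] by (auto simp: w_def)
      have "(\<lambda>n. inner (v n) x) \<longlonglongrightarrow> l"
        using LIMSEQ_subseq_LIMSEQ[OF l strict_mono_o[OF r(1) q(1)]] by (simp add: v_def o_def)
      then show ?thesis
        using inner_eq_limit_of_tails[OF p l] inner_eq_limit_of_tails[OF p'] by (simp add: inner_diff_left)
    qed
    have hyp: "closure (convex hull (range u)) \<subseteq> {x. inner (p - p') x = 0}"
      by (intro closure_minimal hull_minimal closed_Collect_eq continuous_intros convex_hyperplane)
         (use orth in auto)
    have "convex hull (w ` {0..}) \<subseteq> convex hull (range u)" "convex hull (v ` {0..}) \<subseteq> convex hull (range u)"
      by (intro hull_mono; auto simp: w_def v_def)+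
    then have "p \<in> closure (convex hull (range u))" "p' \<in> closure (convex hull (range u))"
      using p[of 0] p'[of 0] by (meson closure_mono subsetD)+
    then have "inner (p - p') (p - p') = 0" using hyp by (simp add: inner_diff_right subset_iff)
    then have "p = p'" by (simp add: inner_eq_zero_iff)
    have "inner p' h = c" by (rule inner_eq_limit_of_tails[OF p']) (use q(2) in \<open>simp add: v_def o_def\<close>)
    moreover have "\<bar>c - inner p h\<bar> \<ge> e"
    proof (rule tendsto_lowerbound[OF _ _ trivial_limit_sequentially])
      show "(\<lambda>n. \<bar>inner (w (r (q n))) h - inner p h\<bar>) \<longlonglongrightarrow> \<bar>c - inner p h\<bar>"
        using q(2) by (intro tendsto_intros) (simp add: o_def)
    qed (use r(2) in simp)
    ultimately show False using \<open>p = p'\<close> e by simp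
  qed
  then show ?thesis by (intro that[OF s]) (simp add: w_def)
qed

section \<open>The Hilbert space of square-integrable functions\<close>

definition square_integrable :: "('a::euclidean_space \<Rightarrow> real) \<Rightarrow> bool" where
  "square_integrable f \<longleftrightarrow> f \<in> borel_measurable lebesgue \<and> integrable lebesgue (\<lambda>x. (f x)\<^sup>2)"

lemma square_integrable_measurable:
  "square_integrable f \<Longrightarrow> f \<in> borel_measurable lebesgue"
  by (simp add: square_integrable_def)

lemma square_integrable_zero [simp]: "square_integrable (\<lambda>x. 0)"
  by (simp add: square_integrable_def)

lemma square_integrable_mult_integrable:
  assumes "square_integrable f" "square_integrable g"
  shows "integrable lebesgue (\<lambda>x. f x * g x)"
proof (rule Bochner_Integration.integrable_bound)
  show "integrable lebesgue (\<lambda>x. (f x)\<^sup>2 + (g x)\<^sup>2)"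
    using assms by (simp add: square_integrable_def)
  show "(\<lambda>x. f x * g x) \<in> borel_measurable lebesgue"
    by (intro borel_measurable_times square_integrable_measurable assms)
  have "\<bar>f x * g x\<bar> \<le> (f x)\<^sup>2 + (g x)\<^sup>2" for x
  proof -
    have "0 \<le> \<bar>f x\<bar> * \<bar>g x\<bar>" by simp
    then show ?thesis
      using sum_squares_bound[of "\<bar>f x\<bar>" "\<bar>g x\<bar>"] unfolding abs_mult power2_abs by linarith
  qed
  then show "AE x in lebesgue. norm (f x * g x) \<le> norm ((f x)\<^sup>2 + (g x)\<^sup>2)" by (simp add: add_nonneg_nonneg)
qed

lemma square_integrable_scaleR:
  "square_integrable f \<Longrightarrow> square_integrable (\<lambda>x. r * f x)"
  unfolding square_integrable_def by (auto simp: power_mult_distrib intro: borel_measurable_times)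

lemma square_integrable_add:
  assumes "square_integrable f" "square_integrable g"
  shows "square_integrable (\<lambda>x. f x + g x)"
  using assms square_integrable_mult_integrable[OF assms]
  by (auto simp: square_integrable_def power2_sum mult.assoc intro: borel_measurable_add)

lemma square_integrable_diff:
  assumes "square_integrable f" "square_integrable g"
  shows "square_integrable (\<lambda>x. f x - g x)"
  using square_integrable_add[OF assms(1) square_integrable_scaleR[OF assms(2), of "- 1"]] by simp

lemma square_integrable_uminus:
  "square_integrable f \<Longrightarrow> square_integrable (\<lambda>x. - f x)"
  by (simp add: square_integrable_def)

lemma square_integrable_bound:
  assumes "square_integrable g" "f \<in> borel_measurable lebesgue" "AE x in lebesgue. \<bar>f x\<bar> \<le> \<bar>g x\<bar>"
  shows "square_integrable f"
proof -
  have "integrable lebesgue (\<lambda>x. (f x)\<^sup>2)"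
  proof (rule Bochner_Integration.integrable_bound)
    show "integrable lebesgue (\<lambda>x. (g x)\<^sup>2)" using assms(1) by (simp add: square_integrable_def)
    show "AE x in lebesgue. norm ((f x)\<^sup>2) \<le> norm ((g x)\<^sup>2)"
      using assms(3) by eventually_elim (simp add: abs_le_square_iff)
  qed (use assms(2) in measurable)
  with assms(2) show ?thesis by (simp add: square_integrable_def)
qed

text \<open>Square-integrable functions up to null sets. Functions on a domain enter through extension by
  zero, so that one type serves all domains and the results on complete inner product spaces apply to it.\<close>

quotient_type (overloaded) 'a l2 = "'a::euclidean_space \<Rightarrow> real" / partial:
  "\<lambda>f g. square_integrable f \<and> square_integrable g \<and> (AE x in lebesgue. f x = g x)"
  morphisms rep_l2 abs_l2
proof (intro part_equivpI exI[of _ "\<lambda>x. 0"] sympI transpI)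
  fix f g h :: "'a \<Rightarrow> real"
  show "square_integrable g \<and> square_integrable f \<and> (AE x in lebesgue. g x = f x)"
    if "square_integrable f \<and> square_integrable g \<and> (AE x in lebesgue. f x = g x)"
    using that by (auto elim: eventually_mono)
  show "square_integrable f \<and> square_integrable h \<and> (AE x in lebesgue. f x = h x)"
    if "square_integrable f \<and> square_integrable g \<and> (AE x in lebesgue. f x = g x)"
      "square_integrable g \<and> square_integrable h \<and> (AE x in lebesgue. g x = h x)"
    using that by (auto elim: eventually_elim2)
qed simp

instantiation l2 :: (euclidean_space) real_vector
begin

lift_definition zero_l2 :: "'a l2" is "\<lambda>x. 0" by simp

lift_definition plus_l2 :: "'a l2 \<Rightarrow> 'a l2 \<Rightarrow> 'a l2" is "\<lambda>f g x. f x + g x"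
  by (auto intro: square_integrable_add elim: eventually_elim2)

lift_definition minus_l2 :: "'a l2 \<Rightarrow> 'a l2 \<Rightarrow> 'a l2" is "\<lambda>f g x. f x - g x"
  by (auto intro: square_integrable_diff elim: eventually_elim2)

lift_definition uminus_l2 :: "'a l2 \<Rightarrow> 'a l2" is "\<lambda>f x. - f x"
  by (auto intro: square_integrable_uminus elim: eventually_mono)

lift_definition scaleR_l2 :: "real \<Rightarrow> 'a l2 \<Rightarrow> 'a l2" is "\<lambda>r f x. r * f x"
  by (auto intro: square_integrable_scaleR elim: eventually_mono)

instance
proof
  fix u v w :: "'a l2" and r s :: real
  show "u + v + w = u + (v + w)"
    by transfer (simp add: square_integrable_add add.assoc)
  show "u + v = v + u"
    by transfer (simp add: square_integrable_add add.commute)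
  show "0 + u = u" by transfer simp
  show "- u + u = 0" by transfer simp
  show "u - v = u + - v" by transfer (simp add: square_integrable_diff)
  show "r *\<^sub>R (u + v) = r *\<^sub>R u + r *\<^sub>R v"
    by transfer (simp add: square_integrable_add square_integrable_scaleR distrib_left)
  show "(r + s) *\<^sub>R u = r *\<^sub>R u + s *\<^sub>R u"
    by transfer (simp add: square_integrable_add square_integrable_scaleR distrib_right)
  show "r *\<^sub>R s *\<^sub>R u = (r * s) *\<^sub>R u"
    by transfer (simp add: square_integrable_scaleR mult.assoc)
  show "1 *\<^sub>R u = u" by transfer simp
qed

end

instantiation l2 :: (euclidean_space) real_inner
begin

lift_definition inner_l2 :: "'a l2 \<Rightarrow> 'a l2 \<Rightarrow> real" is "\<lambda>f g. LINT x|lebesgue. f x * g x"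
  by (intro integral_cong_AE borel_measurable_times)
     (auto elim: eventually_elim2 intro: square_integrable_measurable)

definition norm_l2 :: "'a l2 \<Rightarrow> real" where "norm_l2 u = sqrt (inner u u)"
definition sgn_l2 :: "'a l2 \<Rightarrow> 'a l2" where "sgn_l2 u = scaleR (inverse (norm u)) u"
definition dist_l2 :: "'a l2 \<Rightarrow> 'a l2 \<Rightarrow> real" where "dist_l2 u v = norm (u - v)"
definition uniformity_l2 :: "('a l2 \<times> 'a l2) filter" where
  "uniformity_l2 = (INF e\<in>{0<..}. principal {(x, y). dist x y < e})"
definition open_l2 :: "'a l2 set \<Rightarrow> bool" where
  "open_l2 U \<longleftrightarrow> (\<forall>x\<in>U. eventually (\<lambda>(x', y). x' = x \<longrightarrow> y \<in> U) uniformity)"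

instance
proof
  fix u v w :: "'a l2" and r :: real and U :: "'a l2 set"
  show "sgn u = u /\<^sub>R norm u" by (rule sgn_l2_def)
  show "dist u v = norm (u - v)" by (rule dist_l2_def)
  show "uniformity = (INF e\<in>{0<..}. principal {(x, y :: 'a l2). dist x y < e})"
    by (rule uniformity_l2_def)
  show "open U \<longleftrightarrow> (\<forall>x\<in>U. \<forall>\<^sub>F (x', y) in uniformity. x' = x \<longrightarrow> y \<in> U)" by (rule open_l2_def)
  show "inner u v = inner v u" by transfer (simp add: mult.commute)
  show "inner (u + v) w = inner u w + inner v w"
    by transfer (simp add: distrib_right square_integrable_mult_integrable)
  show "inner (r *\<^sub>R u) v = r * inner u v"
    by transfer (simp add: mult.assoc)
  show "0 \<le> inner u u" by transfer simp
  show "inner u u = 0 \<longleftrightarrow> u = 0"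
  proof transfer
    fix f :: "'a \<Rightarrow> real"
    assume "square_integrable f \<and> square_integrable f \<and> (AE x in lebesgue. f x = f x)"
    then have f: "square_integrable f" by simp
    have "(LINT x|lebesgue. f x * f x) = 0 \<longleftrightarrow> (AE x in lebesgue. f x * f x = 0)"
      by (rule integral_nonneg_eq_0_iff_AE) (use f in \<open>auto intro: square_integrable_mult_integrable\<close>)
    then show "((LINT x|lebesgue. f x * f x) = 0) =
      (square_integrable f \<and> square_integrable (\<lambda>x. 0) \<and> (AE x in lebesgue. f x = 0))"
      using f by simp
  qed
  show "norm u = sqrt (inner u u)" by (rule norm_l2_def)
qed

end

lemma square_integrable_rep [simp]: "square_integrable (rep_l2 u)"
  using Quotient_rep_reflp[OF Quotient_l2] by blast

lemma abs_rep_l2 [simp]: "abs_l2 (rep_l2 u) = u"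
  by (rule Quotient_abs_rep[OF Quotient_l2])

lemma abs_l2_eq_iff:
  assumes "square_integrable f" "square_integrable g"
  shows "abs_l2 f = abs_l2 g \<longleftrightarrow> (AE x in lebesgue. f x = g x)"
  using Quotient_rel[OF Quotient_l2, of f g] assms by auto

lemma inner_abs_l2:
  assumes "square_integrable f" "square_integrable g"
  shows "inner (abs_l2 f) (abs_l2 g) = (LINT x|lebesgue. f x * g x)"
  using assms by (simp add: inner_l2.abs_eq)

lemma norm_abs_l2:
  assumes "square_integrable f"
  shows "(norm (abs_l2 f))\<^sup>2 = (LINT x|lebesgue. (f x)\<^sup>2)"
  unfolding power2_norm_eq_inner inner_abs_l2[OF assms assms] by (simp add: power2_eq_square)

lemma abs_l2_diff:
  assumes "square_integrable f" "square_integrable g"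
  shows "abs_l2 (\<lambda>x. f x - g x) = abs_l2 f - abs_l2 g"
  using assms by (simp add: minus_l2.abs_eq)

lemma abs_l2_add:
  assumes "square_integrable f" "square_integrable g"
  shows "abs_l2 (\<lambda>x. f x + g x) = abs_l2 f + abs_l2 g"
  using assms by (simp add: plus_l2.abs_eq)

lemma nn_integral_square_abs_l2:
  assumes "square_integrable f"
  shows "(\<integral>\<^sup>+x. ennreal ((f x)\<^sup>2) \<partial>lebesgue) = ennreal ((norm (abs_l2 f))\<^sup>2)"
  unfolding norm_abs_l2[OF assms]
  by (rule nn_integral_eq_integral) (use assms in \<open>auto simp: square_integrable_def\<close>)


lemma norm_abs_l2_abs:
  assumes "square_integrable f"
  shows "square_integrable (\<lambda>x. \<bar>f x\<bar>)" "norm (abs_l2 (\<lambda>x. \<bar>f x\<bar>)) = norm (abs_l2 f)"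
proof -
  show *: "square_integrable (\<lambda>x. \<bar>f x\<bar>)"
    by (rule square_integrable_bound[OF assms])
       (simp_all add: borel_measurable_abs square_integrable_measurable assms)
  have "(norm (abs_l2 (\<lambda>x. \<bar>f x\<bar>)))\<^sup>2 = (norm (abs_l2 f))\<^sup>2"
    unfolding norm_abs_l2[OF assms] norm_abs_l2[OF *] by simp
  then show "norm (abs_l2 (\<lambda>x. \<bar>f x\<bar>)) = norm (abs_l2 f)" by simp
qed

lemma abs_l2_sum:
  fixes f :: "'i \<Rightarrow> 'a::euclidean_space \<Rightarrow> real"
  assumes "\<And>k. square_integrable (f k)"
  shows "square_integrable (\<lambda>x. \<Sum>k\<in>I. f k x) \<and> abs_l2 (\<lambda>x. \<Sum>k\<in>I. f k x) = (\<Sum>k\<in>I. abs_l2 (f k))"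
proof (induction I rule: infinite_finite_induct)
  case (insert i I)
  then show ?case by (simp add: square_integrable_add assms abs_l2_add)
qed (simp_all add: zero_l2.abs_eq)

text \<open>Riesz--Fischer: along a fast subsequence the increments are summable almost everywhere by
  monotone convergence, and Fatou's lemma turns the pointwise limit into a limit in norm.\<close>

instance l2 :: (euclidean_space) complete_space
proof
  fix X :: "nat \<Rightarrow> 'a l2" assume C: "Cauchy X"
  have "\<exists>N. \<forall>m\<ge>N. \<forall>n\<ge>N. norm (X m - X n) < (1/2)^i" for i
    using metric_CauchyD[OF C, of "(1/2)^i"] by (simp add: dist_norm)
  then obtain N where N: "\<And>i m n. m \<ge> N i \<Longrightarrow> n \<ge> N i \<Longrightarrow> norm (X m - X n) < (1/2)^i"
    by metis
  have "\<exists>r. \<forall>n. N n \<le> r n \<and> r n < r (Suc n)"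
  proof (rule dependent_nat_choice)
    show "\<exists>y. N (Suc n) \<le> y \<and> x < y" for x n
      by (intro exI[of _ "max (N (Suc n)) (Suc x)"]) auto
  qed auto
  then obtain r where r: "\<And>n. N n \<le> r n" "\<And>n. r n < r (Suc n)" by auto
  then have sm: "strict_mono r" by (simp add: strict_mono_Suc_iff)
  define F where "F k = rep_l2 (X (r k))" for k
  have F: "square_integrable (F k)" "abs_l2 (F k) = X (r k)" for k
    by (simp_all add: F_def)
  have Fm: "F k \<in> borel_measurable lebesgue" for k
    by (intro square_integrable_measurable F)
  define d where "d k x = \<bar>F (Suc k) x - F k x\<bar>" for k x
  have dF: "square_integrable (\<lambda>x. F (Suc k) x - F k x)" for k
    by (intro square_integrable_diff F)
  have d: "square_integrable (d k)" for k
    using norm_abs_l2_abs(1)[OF dF] by (simp add: d_def[abs_def])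
  have dn: "norm (abs_l2 (d k)) \<le> (1/2)^k" for k
  proof -
    have "norm (abs_l2 (d k)) = norm (X (r (Suc k)) - X (r k))"
      using norm_abs_l2_abs(2)[OF dF, of k] by (simp add: d_def[abs_def] abs_l2_diff F)
    also have "\<dots> \<le> (1/2)^k"
      using N[of k "r (Suc k)" "r k"] r(1)[of k] r(2)[of k] by simp
    finally show ?thesis .
  qed
  define S where "S n x = (\<Sum>k<n. d k x)" for n x
  have S: "square_integrable (S n)" "abs_l2 (S n) = (\<Sum>k<n. abs_l2 (d k))" for n
    using abs_l2_sum[OF d, where I = "{..<n}"] by (simp_all add: S_def[abs_def])
  have d0: "0 \<le> d k x" for k x by (simp add: d_def)
  have S0: "0 \<le> S n x" for n x by (simp add: S_def d0 sum_nonneg)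
  have Smono: "S n x \<le> S m x" if "n \<le> m" for n m x
    unfolding S_def by (rule sum_mono2) (use that d0 in auto)
  have Sn: "norm (abs_l2 (S n)) \<le> 2" for n
  proof -
    have "norm (abs_l2 (S n)) \<le> (\<Sum>k<n. (1/2::real)^k)"
      unfolding S(2) by (intro sum_norm_le dn)
    also have "\<dots> \<le> (\<Sum>k. (1/2::real)^k)" by (intro sum_le_suminf) (auto intro: summable_geometric)
    also have "\<dots> = 2" by (subst suminf_geometric) auto
    finally show ?thesis .
  qed
  have "(\<integral>\<^sup>+x. (SUP n. ennreal ((S n x)\<^sup>2)) \<partial>lebesgue) = (SUP n. \<integral>\<^sup>+x. ennreal ((S n x)\<^sup>2) \<partial>lebesgue)"
  proof (rule nn_integral_monotone_convergence_SUP)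
    show "incseq (\<lambda>n x. ennreal ((S n x)\<^sup>2))"
      by (auto simp: incseq_def le_fun_def intro!: ennreal_leI power_mono Smono S0)
    show "(\<lambda>x. ennreal ((S n x)\<^sup>2)) \<in> borel_measurable lebesgue" for n
      using square_integrable_measurable[OF S(1)] by measurable
  qed
  also have "\<dots> \<le> ennreal 4"
  proof (rule SUP_least)
    fix n
    have "(norm (abs_l2 (S n)))\<^sup>2 \<le> 2\<^sup>2" by (intro power_mono Sn) simp
    then show "(\<integral>\<^sup>+x. ennreal ((S n x)\<^sup>2) \<partial>lebesgue) \<le> ennreal 4"
      unfolding nn_integral_square_abs_l2[OF S(1)] by (intro ennreal_leI) simp
  qed
  finally have "(\<integral>\<^sup>+x. (SUP n. ennreal ((S n x)\<^sup>2)) \<partial>lebesgue) \<noteq> \<infinity>"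
    by (auto simp: top_unique)
  then have ae: "AE x in lebesgue. (SUP n. ennreal ((S n x)\<^sup>2)) \<noteq> \<infinity>"
    by (intro nn_integral_noteq_infinite borel_measurable_SUP)
       (use square_integrable_measurable[OF S(1)] in \<open>auto intro: measurable_compose\<close>)
  define f where "f x = lim (\<lambda>k. F k x)" for x
  have fm: "f \<in> borel_measurable lebesgue"
    unfolding f_def[abs_def] by (intro borel_measurable_lim_metric Fm)
  have conv: "AE x in lebesgue. (\<lambda>k. F k x) \<longlonglongrightarrow> f x"
    using ae
  proof eventually_elim
    case (elim x)
    define B where "B = (SUP n. ennreal ((S n x)\<^sup>2))"
    have "ennreal ((S n x)\<^sup>2) \<le> B" for n unfolding B_def by (rule SUP_upper) simp
    then have "(S n x)\<^sup>2 \<le> enn2real B" for n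
      using elim by (metis B_def enn2real_ennreal enn2real_mono infinity_ennreal_def less_top zero_le_power2)
    then have "S n x \<le> sqrt (enn2real B)" for n using real_le_rsqrt by blast
    then have "summable (\<lambda>k. d k x)"
      by (intro summableI_nonneg_bounded[of _ "sqrt (enn2real B)"]) (simp_all add: d0 S_def)
    then have "summable (\<lambda>k. F (Suc k) x - F k x)"
      unfolding d_def by (rule summable_rabs_cancel)
    then have "convergent (\<lambda>n. F 0 x + (\<Sum>k<n. F (Suc k) x - F k x))"
      by (auto simp: summable_iff_convergent intro!: convergent_add convergent_const)
    moreover have "F 0 x + (\<Sum>k<n. F (Suc k) x - F k x) = F n x" for n
      by (induction n) simp_all
    ultimately show ?case by (simp add: f_def convergent_LIMSEQ_iff)
  qed
  have fatou: "(\<integral>\<^sup>+x. ennreal ((F k x - f x)\<^sup>2) \<partial>lebesgue) \<le> ennreal (((1/2)^k)\<^sup>2)" for k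
  proof -
    have "(\<integral>\<^sup>+x. ennreal ((F k x - f x)\<^sup>2) \<partial>lebesgue)
        = (\<integral>\<^sup>+x. liminf (\<lambda>m. ennreal ((F k x - F m x)\<^sup>2)) \<partial>lebesgue)"
    proof (rule nn_integral_cong_AE)
      show "AE x in lebesgue. ennreal ((F k x - f x)\<^sup>2) = liminf (\<lambda>m. ennreal ((F k x - F m x)\<^sup>2))"
        using conv
      proof eventually_elim
        case (elim x)
        have "(\<lambda>m. ennreal ((F k x - F m x)\<^sup>2)) \<longlonglongrightarrow> ennreal ((F k x - f x)\<^sup>2)"
          by (intro tendsto_ennrealI tendsto_intros elim)
        from lim_imp_Liminf[OF trivial_limit_sequentially this] show ?case by simp
      qed
    qed
    also have "\<dots> \<le> liminf (\<lambda>m. \<integral>\<^sup>+x. ennreal ((F k x - F m x)\<^sup>2) \<partial>lebesgue)"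
      by (rule nn_integral_liminf) (use Fm in measurable)
    also have "\<dots> \<le> ennreal (((1/2)^k)\<^sup>2)"
    proof (rule Liminf_le)
      show "\<forall>\<^sub>F m in sequentially. (\<integral>\<^sup>+x. ennreal ((F k x - F m x)\<^sup>2) \<partial>lebesgue) \<le> ennreal (((1/2)^k)\<^sup>2)"
        using eventually_ge_at_top[of k]
      proof eventually_elim
        case (elim m)
        have "N k \<le> r m" using r(1)[of k] strict_mono_leD[OF sm elim] by simp
        then have "norm (X (r k) - X (r m)) \<le> (1/2)^k"
          using N[of k "r k" "r m"] r(1)[of k] by simp
        then have "(norm (X (r k) - X (r m)))\<^sup>2 \<le> ((1/2)^k)\<^sup>2" by (intro power_mono) auto
        then show ?case
          by (simp add: nn_integral_square_abs_l2 square_integrable_diff F abs_l2_diff ennreal_leI)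
      qed
    qed simp
    finally show ?thesis .
  qed
  have Ff: "square_integrable (\<lambda>x. F k x - f x)" for k
  proof -
    have m: "(\<lambda>x. F k x - f x) \<in> borel_measurable lebesgue" using Fm fm by measurable
    have "integrable lebesgue (\<lambda>x. (F k x - f x)\<^sup>2)"
      by (rule integrableI_nonneg) (use m fatou[of k] in \<open>auto simp: less_top[symmetric] top_unique\<close>)
    with m show ?thesis by (simp add: square_integrable_def)
  qed
  have f: "square_integrable f"
    using square_integrable_diff[OF F(1)[of 0] Ff[of 0]] by simp
  have le: "norm (X (r k) - abs_l2 f) \<le> (1/2)^k" for k
  proof -
    have "(norm (X (r k) - abs_l2 f))\<^sup>2 \<le> ((1/2)^k)\<^sup>2"
      using fatou[of k] by (simp add: nn_integral_square_abs_l2 Ff F f abs_l2_diff)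
    then show ?thesis by (rule power2_le_imp_le) simp
  qed
  have "(\<lambda>k. norm (X (r k) - abs_l2 f)) \<longlonglongrightarrow> 0"
    by (rule tendsto_sandwich[OF _ _ tendsto_const LIMSEQ_realpow_zero[of "1/2"]])
       (auto intro!: always_eventually le)
  then have "(X \<circ> r) \<longlonglongrightarrow> abs_l2 f"
    unfolding o_def by (simp add: LIM_zero_iff tendsto_norm_zero_iff)
  then show "convergent X"
    using Cauchy_converges_subseq[OF C sm] by (auto simp: convergent_def)
qed

lemma l2_dominated_convergence:
  fixes f :: "nat \<Rightarrow> 'a::euclidean_space \<Rightarrow> real"
  assumes g: "square_integrable g"
    and s: "\<And>n. f n \<in> borel_measurable lebesgue" "f' \<in> borel_measurable lebesgue"
    and lim: "AE x in lebesgue. (\<lambda>n. f n x) \<longlonglongrightarrow> f' x"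
    and bound: "\<And>n. AE x in lebesgue. \<bar>f n x\<bar> \<le> g x"
  shows "square_integrable (f n)" "square_integrable f'"
    "(\<lambda>n. abs_l2 (f n)) \<longlonglongrightarrow> abs_l2 f'"
proof -
  have fn: "square_integrable (f n)" for n
    by (rule square_integrable_bound[OF g s(1)]) (use bound[of n] in eventually_elim, simp)
  then show "square_integrable (f n)" .
  have "AE x in lebesgue. \<forall>n. \<bar>f n x\<bar> \<le> g x" using bound by (simp add: AE_all_countable)
  then have bd: "AE x in lebesgue. \<bar>f' x\<bar> \<le> g x"
    using lim
  proof eventually_elim
    case (elim x)
    show ?case by (rule LIMSEQ_le_const2[OF tendsto_rabs[OF elim(2)]]) (use elim(1) in auto)
  qed
  show f': "square_integrable f'"
    by (rule square_integrable_bound[OF g s(2)]) (use bd in eventually_elim, simp)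
  have "(\<lambda>n. LINT x|lebesgue. (f n x - f' x)\<^sup>2) \<longlonglongrightarrow> (LINT x::'a|lebesgue. 0)"
  proof (rule integral_dominated_convergence[where w = "\<lambda>x. 4 * (g x)\<^sup>2"])
    show "integrable lebesgue (\<lambda>x. 4 * (g x)\<^sup>2)" using g by (simp add: square_integrable_def)
    show "(\<lambda>x. (f n x - f' x)\<^sup>2) \<in> borel_measurable lebesgue" for n using s by measurable
    show "AE x in lebesgue. (\<lambda>n. (f n x - f' x)\<^sup>2) \<longlonglongrightarrow> 0"
      using lim
    proof eventually_elim
      case (elim x)
      have "(\<lambda>n. (f n x - f' x)\<^sup>2) \<longlonglongrightarrow> (f' x - f' x)\<^sup>2" by (intro tendsto_intros elim)
      then show ?case by simp
    qed
    show "AE x in lebesgue. norm ((f n x - f' x)\<^sup>2) \<le> 4 * (g x)\<^sup>2" for n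
      using bound[of n] bd
    proof eventually_elim
      case (elim x)
      have "\<bar>f n x - f' x\<bar> \<le> 2 * g x" using elim by linarith
      then have "\<bar>f n x - f' x\<bar>\<^sup>2 \<le> (2 * g x)\<^sup>2" by (intro power_mono) auto
      then show ?case by simp
    qed
  qed simp
  then have "(\<lambda>n. (norm (abs_l2 (f n) - abs_l2 f'))\<^sup>2) \<longlonglongrightarrow> 0"
    by (simp add: norm_abs_l2 square_integrable_diff fn f' flip: abs_l2_diff)
  then have "(\<lambda>n. sqrt ((norm (abs_l2 (f n) - abs_l2 f'))\<^sup>2)) \<longlonglongrightarrow> sqrt 0" by (rule tendsto_real_sqrt)
  then show "(\<lambda>n. abs_l2 (f n)) \<longlonglongrightarrow> abs_l2 f'"
    by (simp add: LIM_zero_iff tendsto_norm_zero_iff)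
qed

section \<open>Smooth functions\<close>

lemma partial_d_eqI:
  "(\<phi> has_derivative D) (at x) \<Longrightarrow> partial_d i \<phi> x = D (axis i 1)"
  unfolding partial_d_def using frechet_derivative_at[of \<phi> D x] by simp

lemma has_derivative_partial_d:
  fixes \<phi> :: "real ^ 'n \<Rightarrow> real"
  assumes "\<phi> differentiable (at x)"
  shows "(\<phi> has_derivative (\<lambda>h. \<Sum>i\<in>UNIV. h $ i * partial_d i \<phi> x)) (at x)"
proof -
  let ?D = "frechet_derivative \<phi> (at x)"
  have D: "(\<phi> has_derivative ?D) (at x)" using assms frechet_derivative_works by blast
  then have lin: "linear ?D" by (rule has_derivative_linear)
  have "?D h = (\<Sum>i\<in>UNIV. h $ i * partial_d i \<phi> x)" for h
  proof -
    have "?D h = ?D (\<Sum>i\<in>UNIV. h $ i *s axis i 1)" by (simp add: basis_expansion)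
    also have "\<dots> = (\<Sum>i\<in>UNIV. h $ i * ?D (axis i 1))"
      by (simp add: linear_sum[OF lin] linear_cmul[OF lin] scalar_mult_eq_scaleR)
    finally show ?thesis by (simp add: partial_d_def)
  qed
  then have "?D = (\<lambda>h. \<Sum>i\<in>UNIV. h $ i * partial_d i \<phi> x)" by blast
  with D show ?thesis by simp
qed

lemma C_k_Suc_imp_C_k: "C_k (Suc k) \<phi> \<Longrightarrow> C_k k \<phi>"
proof (induction k arbitrary: \<phi>)
  case 0
  then show ?case
    by (auto intro!: continuous_at_imp_continuous_on differentiable_imp_continuous_within)
next
  case (Suc k)
  then show ?case by (metis C_k.simps(2))
qed

lemma C_infinity_iff:
  "C_infinity \<phi> \<longleftrightarrow> (\<forall>x. \<phi> differentiable (at x)) \<and> (\<forall>i. C_infinity (partial_d i \<phi>))"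
proof -
  have "C_infinity \<phi> \<longleftrightarrow> (\<forall>k. C_k (Suc k) \<phi>)"
    unfolding C_infinity_def by (intro iffI allI; drule spec, (assumption | erule C_k_Suc_imp_C_k))
  also have "\<dots> \<longleftrightarrow> (\<forall>x. \<phi> differentiable (at x)) \<and> (\<forall>i. C_infinity (partial_d i \<phi>))"
    unfolding C_infinity_def C_k.simps(2) by blast
  finally show ?thesis .
qed

lemma C_infinity_differentiable: "C_infinity \<phi> \<Longrightarrow> \<phi> differentiable (at x)"
  using C_infinity_iff[of \<phi>] by blast

lemma C_infinity_partial_d: "C_infinity \<phi> \<Longrightarrow> C_infinity (partial_d i \<phi>)"
  using C_infinity_iff[of \<phi>] by blast

lemma C_infinity_continuous_on: "C_infinity \<phi> \<Longrightarrow> continuous_on S \<phi>"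
  unfolding C_infinity_def by (metis C_k.simps(1) continuous_on_subset subset_UNIV)

lemma C_infinity_has_derivative:
  fixes \<phi> :: "real ^ 'n \<Rightarrow> real"
  assumes "C_infinity \<phi>"
  shows "(\<phi> has_derivative (\<lambda>h. \<Sum>i\<in>UNIV. h $ i * partial_d i \<phi> x)) (at x)"
  by (intro has_derivative_partial_d C_infinity_differentiable assms)

lemma partial_d_add:
  fixes \<phi> \<psi> :: "real ^ 'n \<Rightarrow> real"
  assumes "\<And>x. \<phi> differentiable (at x)" "\<And>x. \<psi> differentiable (at x)"
  shows "partial_d i (\<lambda>x. \<phi> x + \<psi> x) = (\<lambda>x. partial_d i \<phi> x + partial_d i \<psi> x)"
proof
  fix x
  have "((\<lambda>x. \<phi> x + \<psi> x) has_derivative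
      (\<lambda>h. frechet_derivative \<phi> (at x) h + frechet_derivative \<psi> (at x) h)) (at x)"
    using assms frechet_derivative_works by (intro has_derivative_add) blast+
  from partial_d_eqI[OF this] show "partial_d i (\<lambda>x. \<phi> x + \<psi> x) x = partial_d i \<phi> x + partial_d i \<psi> x"
    by (simp add: partial_d_def)
qed

lemma partial_d_mult:
  fixes \<phi> \<psi> :: "real ^ 'n \<Rightarrow> real"
  assumes "\<And>x. \<phi> differentiable (at x)" "\<And>x. \<psi> differentiable (at x)"
  shows "partial_d i (\<lambda>x. \<phi> x * \<psi> x) = (\<lambda>x. \<phi> x * partial_d i \<psi> x + partial_d i \<phi> x * \<psi> x)"
proof
  fix x
  have "((\<lambda>x. \<phi> x * \<psi> x) has_derivative
      (\<lambda>h. \<phi> x * frechet_derivative \<psi> (at x) h + frechet_derivative \<phi> (at x) h * \<psi> x)) (at x)"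
    using assms frechet_derivative_works by (intro has_derivative_mult) blast+
  from partial_d_eqI[OF this] show "partial_d i (\<lambda>x. \<phi> x * \<psi> x) x = \<phi> x * partial_d i \<psi> x + partial_d i \<phi> x * \<psi> x"
    by (simp add: partial_d_def)
qed

lemma partial_d_const [simp]: "partial_d i (\<lambda>x. c) = (\<lambda>x. 0)"
  by (rule ext) (simp add: partial_d_eqI[OF has_derivative_const])

lemma C_k_add:
  fixes \<phi> \<psi> :: "real ^ 'n \<Rightarrow> real"
  shows "C_k k \<phi> \<Longrightarrow> C_k k \<psi> \<Longrightarrow> C_k k (\<lambda>x. \<phi> x + \<psi> x)"
  by (induction k arbitrary: \<phi> \<psi>)
     (auto simp: partial_d_add intro: continuous_on_add differentiable_add)

lemma C_k_mult:
  fixes \<phi> \<psi> :: "real ^ 'n \<Rightarrow> real"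
  shows "C_k k \<phi> \<Longrightarrow> C_k k \<psi> \<Longrightarrow> C_k k (\<lambda>x. \<phi> x * \<psi> x)"
proof (induction k arbitrary: \<phi> \<psi>)
  case 0
  then show ?case by (simp add: continuous_on_mult)
next
  case (Suc k)
  have "C_k k \<phi>" "C_k k \<psi>" using Suc.prems by (auto intro: C_k_Suc_imp_C_k simp del: C_k.simps)
  with Suc show ?case by (auto simp: partial_d_mult intro!: C_k_add differentiable_mult)
qed

lemma C_k_const: "C_k k (\<lambda>x. c)"
  by (induction k arbitrary: c) auto

lemma C_infinity_add:
  "C_infinity \<phi> \<Longrightarrow> C_infinity \<psi> \<Longrightarrow> C_infinity (\<lambda>x. \<phi> x + \<psi> x)"
  by (simp add: C_infinity_def C_k_add)

lemma C_infinity_mult: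
  "C_infinity \<phi> \<Longrightarrow> C_infinity \<psi> \<Longrightarrow> C_infinity (\<lambda>x. \<phi> x * \<psi> x)"
  by (simp add: C_infinity_def C_k_mult)

lemma C_infinity_const: "C_infinity (\<lambda>x. c)"
  by (simp add: C_infinity_def C_k_const)

lemma C_infinity_diff:
  assumes "C_infinity \<phi>" "C_infinity \<psi>"
  shows "C_infinity (\<lambda>x. \<phi> x - \<psi> x)"
  using C_infinity_add[OF assms(1) C_infinity_mult[OF C_infinity_const[of "-1"] assms(2)]] by simp

lemma C_infinity_prod:
  "(\<And>i. i \<in> I \<Longrightarrow> C_infinity (\<phi> i)) \<Longrightarrow> C_infinity (\<lambda>x. \<Prod>i\<in>I. \<phi> i x)"
  by (induction I rule: infinite_finite_induct) (simp_all add: C_infinity_const C_infinity_mult)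

lemma test_functionI:
  assumes "C_infinity \<phi>" "compact K" "K \<subseteq> \<Omega>" "\<And>x. \<phi> x \<noteq> 0 \<Longrightarrow> x \<in> K"
  shows "\<phi> \<in> test_functions \<Omega>"
proof -
  have cl: "closure {x. \<phi> x \<noteq> 0} \<subseteq> K"
    by (rule closure_minimal) (use assms(2,4) compact_imp_closed in auto)
  have "compact (closure {x. \<phi> x \<noteq> 0})"
    using compact_imp_bounded[OF assms(2)] bounded_subset[OF _ cl] by (simp add: compact_eq_bounded_closed)
  with cl assms(1,3) show ?thesis by (auto simp: test_functions_def)
qed

subsection \<open>Smooth cutoff functions\<close>

text \<open>The functions \<open>t\<^sup>-\<^sup>m exp (- 1 / t)\<close>, continued by \<open>0\<close> to \<open>t \<le> 0\<close>. The derivative of each is a linear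
  combination of two others, also at \<open>0\<close>, where the exponential beats all powers; hence all of them
  are smooth.\<close>

definition flat :: "nat \<Rightarrow> real \<Rightarrow> real" where
  "flat m t = (if t \<le> 0 then 0 else (inverse t) ^ m * exp (- inverse t))"

lemma flat_tendsto_0: "((\<lambda>t. flat m t) \<longlongrightarrow> 0) (at 0)"
proof (rule filterlim_split_at)
  have "((\<lambda>t. (inverse t) ^ m / exp (inverse t)) \<longlongrightarrow> 0) (at_right (0::real))"
    by (rule filterlim_compose[OF tendsto_power_div_exp_0 filterlim_inverse_at_top_right])
  then show "((\<lambda>t. flat m t) \<longlongrightarrow> 0) (at_right 0)"
  proof (rule Lim_transform_eventually)
    show "\<forall>\<^sub>F t in at_right 0. (inverse t) ^ m / exp (inverse t) = flat m t"
      using eventually_at_right_less[of 0]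
      by eventually_elim (simp add: flat_def exp_minus divide_inverse)
  qed
  have "\<forall>\<^sub>F t in at_left 0. (0::real) = flat m t"
    by (auto simp: flat_def eventually_at_filter)
  then show "((\<lambda>t. flat m t) \<longlongrightarrow> 0) (at_left 0)"
    by (rule Lim_transform_eventually[OF tendsto_const])
qed

lemma DERIV_flat: "(flat m has_real_derivative (flat (m + 2) t - m * flat (m + 1) t)) (at t)"
proof -
  consider "t < 0" | "t = 0" | "t > 0" by linarith
  then show ?thesis
  proof cases
    case 1
    have "((\<lambda>t. 0) has_real_derivative 0) (at t)" by simp
    then have "(flat m has_real_derivative 0) (at t)"
      by (rule has_field_derivative_transform_within_open[where S = "{..<0}"])
         (use 1 in \<open>auto simp: flat_def\<close>)
    with 1 show ?thesis by (simp add: flat_def)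
  next
    case 2
    \<comment> \<open>The difference quotient at \<open>0\<close> is again a member of the family.\<close>
    have "((\<lambda>h. (flat m (0 + h) - flat m 0) / h) \<longlongrightarrow> 0) (at 0)"
    proof (rule Lim_transform_eventually[OF flat_tendsto_0[of "Suc m"]])
      show "\<forall>\<^sub>F h in at 0. flat (Suc m) h = (flat m (0 + h) - flat m 0) / h"
        by (auto simp: eventually_at_filter flat_def divide_inverse)
    qed
    then show ?thesis using 2 by (simp add: DERIV_def flat_def)
  next
    case 3
    have "((\<lambda>t. (inverse t) ^ m * exp (- inverse t)) has_real_derivative
        (inverse t) ^ m * (exp (- inverse t) * (inverse t ^ 2)) -
        m * (inverse t) ^ (m - 1) * (inverse t ^ 2) * exp (- inverse t)) (at t)"
      using 3 by (auto intro!: derivative_eq_intros simp: power2_eq_square)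
    also have "(inverse t) ^ m * (exp (- inverse t) * (inverse t ^ 2)) -
        m * (inverse t) ^ (m - 1) * (inverse t ^ 2) * exp (- inverse t)
        = flat (m + 2) t - m * flat (m + 1) t"
      using 3 by (cases m) (simp_all add: flat_def power_add power2_eq_square)
    finally show ?thesis
      by (rule has_field_derivative_transform_within_open[where S = "{0<..}"])
         (use 3 in \<open>auto simp: flat_def\<close>)
  qed
qed

lemma C_infinity_flat: "C_infinity (\<lambda>x::real ^ 'n. flat m (s * x $ j + c))"
proof -
  have der: "((\<lambda>x::real ^ 'n. flat m (s * x $ j + c)) has_derivative
      (\<lambda>h. (s * h $ j) * (flat (m + 2) (s * x $ j + c) - m * flat (m + 1) (s * x $ j + c)))) (at x)" for m x
  proof -
    have "((\<lambda>x::real ^ 'n. s * x $ j + c) has_derivative (\<lambda>h. s * h $ j)) (at x)"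
      using has_derivative_add[OF has_derivative_mult_right[OF
        bounded_linear_imp_has_derivative[OF bounded_linear_vec_nth]] has_derivative_const] by simp
    from has_derivative_compose[OF this, of "flat m", OF DERIV_flat[unfolded has_field_derivative_def]]
    show ?thesis by (simp add: mult.commute)
  qed
  have diff: "(\<lambda>x::real ^ 'n. flat m (s * x $ j + c)) differentiable (at x)" for m x
    using der differentiable_def by blast
  have pd: "partial_d i (\<lambda>x::real ^ 'n. flat m (s * x $ j + c)) =
      (\<lambda>x. (s * axis i 1 $ j) * (flat (m + 2) (s * x $ j + c) + (- m) * flat (m + 1) (s * x $ j + c)))" for i m
    by (rule ext) (simp add: partial_d_eqI[OF der])
  have "C_k k (\<lambda>x::real ^ 'n. flat m (s * x $ j + c))" for k
  proof (induction k arbitrary: m)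
    case 0
    then show ?case
      using diff by (auto intro!: continuous_at_imp_continuous_on differentiable_imp_continuous_within)
  next
    case (Suc k)
    have "C_k k (partial_d i (\<lambda>x::real ^ 'n. flat m (s * x $ j + c)))" for i
      unfolding pd by (intro C_k_mult C_k_add C_k_const Suc)
    then show ?case using diff by simp
  qed
  then show ?thesis by (simp add: C_infinity_def)
qed

lemma flat_0_bounds: "0 \<le> flat 0 t" "flat 0 t \<le> 1"
  by (simp_all add: flat_def)

lemma flat_0_pos_iff: "flat 0 t \<noteq> 0 \<longleftrightarrow> t > 0"
  by (simp add: flat_def)

text \<open>For \<open>s > 0\<close> this is a smooth function that is positive exactly on the open box; letting \<open>s\<close> grow
  steepens it towards the indicator function of the box.\<close>

definition box_bump :: "real ^ 'n \<Rightarrow> real ^ 'n \<Rightarrow> real \<Rightarrow> real ^ 'n \<Rightarrow> real" where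
  "box_bump a b s x = (\<Prod>i\<in>UNIV. flat 0 (s * x $ i + - s * a $ i) * flat 0 (- s * x $ i + s * b $ i))"

lemma box_bump_bounds: "0 \<le> box_bump a b s x" "box_bump a b s x \<le> 1"
  unfolding box_bump_def
  by (auto intro!: prod_nonneg prod_le_1 mult_nonneg_nonneg mult_le_one flat_0_bounds)

lemma box_bump_pos_iff:
  assumes "s > 0"
  shows "box_bump a b s x \<noteq> 0 \<longleftrightarrow> x \<in> box a b"
proof -
  have "s * x $ i + - s * a $ i > 0 \<longleftrightarrow> a $ i < x $ i" "- s * x $ i + s * b $ i > 0 \<longleftrightarrow> x $ i < b $ i" for i
    using assms by (simp_all add: algebra_simps)
  then show ?thesis
    unfolding box_bump_def by (simp add: flat_0_pos_iff mem_box_cart)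
qed

lemma box_bump_test_function:
  assumes "cbox a b \<subseteq> \<Omega>" "s > 0"
  shows "box_bump a b s \<in> test_functions \<Omega>"
proof (rule test_functionI[OF _ compact_cbox assms(1)])
  show "C_infinity (box_bump a b s)"
    unfolding box_bump_def[abs_def] by (intro C_infinity_prod C_infinity_mult C_infinity_flat)
  show "x \<in> cbox a b" if "box_bump a b s x \<noteq> 0" for x
    using that box_bump_pos_iff[OF assms(2)] box_subset_cbox by blast
qed

lemma box_bump_tendsto: "(\<lambda>k. box_bump a b (real (Suc k)) x) \<longlonglongrightarrow> indicator (box a b) x"
proof (cases "x \<in> box a b")
  case False
  then have "box_bump a b (real (Suc k)) x = 0" for k
    using box_bump_pos_iff[of "real (Suc k)" a b x] by simp
  with False show ?thesis by simp
next
  case True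
  have 1: "(\<lambda>k. flat 0 (real (Suc k) * t)) \<longlonglongrightarrow> 1" if "t > 0" for t
  proof -
    have "(\<lambda>k. exp (- (inverse (real (Suc k)) * inverse t))) \<longlonglongrightarrow> exp (- (0 * inverse t))"
      by (intro tendsto_intros LIMSEQ_inverse_real_of_nat)
    moreover have "flat 0 (real (Suc k) * t) = exp (- (inverse (real (Suc k)) * inverse t))" for k
      using that by (simp add: flat_def mult_le_0_iff del: of_nat_Suc)
    ultimately show ?thesis by simp
  qed
  have "(\<lambda>k. \<Prod>i\<in>UNIV. flat 0 (real (Suc k) * (x $ i - a $ i)) * flat 0 (real (Suc k) * (b $ i - x $ i)))
     \<longlonglongrightarrow> (\<Prod>i\<in>(UNIV::'a set). 1 * 1)"
    using True by (intro tendsto_prod tendsto_mult 1) (auto simp: mem_box_cart)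
  with True show ?thesis
    by (simp add: box_bump_def algebra_simps)
qed

section \<open>Zero extension\<close>

definition l2_of :: "(real ^ 'n) set \<Rightarrow> (real ^ 'n \<Rightarrow> real) \<Rightarrow> (real ^ 'n) l2" where
  "l2_of \<Omega> u = abs_l2 (\<lambda>x. indicator \<Omega> x * u x)"

lemma open_in_sets_lebesgue: "open (S :: 'a::euclidean_space set) \<Longrightarrow> S \<in> sets lebesgue"
  by auto

lemma square_integrable_indicator:
  assumes "S \<in> lmeasurable"
  shows "square_integrable (\<lambda>x. C * indicator S x :: real)"
proof (rule square_integrable_scaleR)
  have "(indicator S x)\<^sup>2 = (indicator S x :: real)" for x by (simp add: indicator_def)
  then show "square_integrable (indicator S :: _ \<Rightarrow> real)"
    using assms unfolding square_integrable_def
    by (auto simp: fmeasurable_def intro!: borel_measurable_indicator)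
qed

lemma AE_lebesgue_on_open:
  assumes "open (\<Omega> :: (real ^ 'n) set)"
  shows "(AE x in lebesgue_on \<Omega>. P x) \<longleftrightarrow> (AE x in lebesgue. x \<in> \<Omega> \<longrightarrow> P x)"
  using assms by (subst AE_restrict_space_iff) auto

lemma L2_iff_square_integrable:
  assumes "open (\<Omega> :: (real ^ 'n) set)"
  shows "u \<in> L2 \<Omega> \<longleftrightarrow> square_integrable (\<lambda>x. indicator \<Omega> x * u x)"
proof -
  have sq: "(indicator \<Omega> x * u x)\<^sup>2 = indicator \<Omega> x * (u x)\<^sup>2" for x
    by (simp add: indicator_def)
  show ?thesis
    unfolding L2_def square_integrable_def sq
    using assms by (auto simp: borel_measurable_restrict_space_iff integrable_restrict_space)
qed

lemma L2_inner_eq_integral: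
  assumes "open (\<Omega> :: (real ^ 'n) set)"
  shows "L2_inner \<Omega> u v = (LINT x|lebesgue. (indicator \<Omega> x * u x) * (indicator \<Omega> x * v x))"
  unfolding L2_inner_def
  by (subst integral_restrict_space)
     (use assms in \<open>auto intro!: Bochner_Integration.integral_cong simp: indicator_def\<close>)

lemma inner_l2_of:
  assumes "open \<Omega>" "u \<in> L2 \<Omega>" "v \<in> L2 \<Omega>"
  shows "inner (l2_of \<Omega> u) (l2_of \<Omega> v) = L2_inner \<Omega> u v"
  using assms by (simp add: l2_of_def inner_abs_l2 L2_iff_square_integrable L2_inner_eq_integral)

lemma norm_l2_of:
  assumes "open \<Omega>" "u \<in> L2 \<Omega>"
  shows "norm (l2_of \<Omega> u) = L2_norm \<Omega> u"
  by (simp add: norm_eq_sqrt_inner inner_l2_of[OF assms(1,2,2)] L2_norm_def)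

lemma L2_diff:
  assumes "open \<Omega>" "u \<in> L2 \<Omega>" "v \<in> L2 \<Omega>"
  shows "(\<lambda>x. u x - v x) \<in> L2 \<Omega>" "l2_of \<Omega> (\<lambda>x. u x - v x) = l2_of \<Omega> u - l2_of \<Omega> v"
  using assms square_integrable_diff[of "\<lambda>x. indicator \<Omega> x * u x" "\<lambda>x. indicator \<Omega> x * v x"]
  by (simp_all add: L2_iff_square_integrable l2_of_def right_diff_distrib abs_l2_diff)

lemma L2_add:
  assumes "open \<Omega>" "u \<in> L2 \<Omega>" "v \<in> L2 \<Omega>"
  shows "(\<lambda>x. u x + v x) \<in> L2 \<Omega>" "l2_of \<Omega> (\<lambda>x. u x + v x) = l2_of \<Omega> u + l2_of \<Omega> v"
  using assms square_integrable_add[of "\<lambda>x. indicator \<Omega> x * u x" "\<lambda>x. indicator \<Omega> x * v x"]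
  by (simp_all add: L2_iff_square_integrable l2_of_def distrib_left abs_l2_add)

lemma L2_norm_diff:
  assumes "open \<Omega>" "u \<in> L2 \<Omega>" "v \<in> L2 \<Omega>"
  shows "L2_norm \<Omega> (\<lambda>x. u x - v x) = norm (l2_of \<Omega> u - l2_of \<Omega> v)"
  using norm_l2_of[OF assms(1) L2_diff(1)[OF assms]] L2_diff(2)[OF assms] by simp

lemma l2_of_eq_iff:
  assumes "open \<Omega>" "u \<in> L2 \<Omega>" "v \<in> L2 \<Omega>"
  shows "l2_of \<Omega> u = l2_of \<Omega> v \<longleftrightarrow> (AE x in lebesgue_on \<Omega>. u x = v x)"
  using assms
  by (simp add: l2_of_def abs_l2_eq_iff L2_iff_square_integrable AE_lebesgue_on_open indicator_def
      if_distrib[of "\<lambda>c. c * _"] cong: if_cong)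

lemma indicator_mult_square_integrable:
  assumes "open (\<Omega> :: (real ^ 'n) set)" "square_integrable u"
  shows "square_integrable (\<lambda>x. indicator \<Omega> x * u x)"
proof (rule square_integrable_bound[OF assms(2)])
  show "(\<lambda>x. indicator \<Omega> x * u x) \<in> borel_measurable lebesgue"
    by (intro borel_measurable_times square_integrable_measurable[OF assms(2)]
        borel_measurable_indicator open_in_sets_lebesgue assms(1))
qed (simp add: indicator_def)

lemma rep_l2_in_L2:
  assumes "open (\<Omega> :: (real ^ 'n) set)"
  shows "rep_l2 w \<in> L2 \<Omega>"
  using assms by (simp add: L2_iff_square_integrable indicator_mult_square_integrable)

lemma inner_l2_of_right:
  assumes "open \<Omega>" "h \<in> L2 \<Omega>"
  shows "inner w (l2_of \<Omega> h) = L2_inner \<Omega> (rep_l2 w) h"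
proof -
  have "inner w (l2_of \<Omega> h) = inner (abs_l2 (rep_l2 w)) (l2_of \<Omega> h)" by simp
  also have "\<dots> = (LINT x|lebesgue. rep_l2 w x * (indicator \<Omega> x * h x))"
    unfolding l2_of_def
    by (rule inner_abs_l2) (use assms in \<open>simp_all add: L2_iff_square_integrable\<close>)
  also have "\<dots> = L2_inner \<Omega> (rep_l2 w) h"
    unfolding L2_inner_eq_integral[OF assms(1)]
    by (rule Bochner_Integration.integral_cong) (auto simp: indicator_def)
  finally show ?thesis .
qed

text \<open>Cutting a representative off outside \<open>\<Omega>\<close> is the orthogonal projection onto the functions that vanish
  outside \<open>\<Omega>\<close>; hence it does not increase the distance to such functions.\<close>

lemma norm_l2_of_rep_le:
  assumes "open \<Omega>" "u \<in> L2 \<Omega>"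
  shows "norm (l2_of \<Omega> (rep_l2 w) - l2_of \<Omega> u) \<le> norm (w - l2_of \<Omega> u)"
proof -
  have R: "rep_l2 w \<in> L2 \<Omega>" by (rule rep_l2_in_L2[OF assms(1)])
  define d where "d = (\<lambda>x. rep_l2 w x - u x)"
  have d: "d \<in> L2 \<Omega>" "l2_of \<Omega> d = l2_of \<Omega> (rep_l2 w) - l2_of \<Omega> u"
    unfolding d_def using L2_diff[OF assms(1) R assms(2)] by auto
  have "inner (l2_of \<Omega> d) (l2_of \<Omega> d) = inner (w - l2_of \<Omega> u) (l2_of \<Omega> d)"
  proof -
    have "inner w (l2_of \<Omega> d) = inner (l2_of \<Omega> (rep_l2 w)) (l2_of \<Omega> d)"
      by (rule trans[OF inner_l2_of_right[OF assms(1) d(1)] inner_l2_of[OF assms(1) R d(1), symmetric]])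
    then show ?thesis by (subst (1) d(2)) (simp add: inner_diff_left)
  qed
  also have "\<dots> \<le> norm (w - l2_of \<Omega> u) * norm (l2_of \<Omega> d)" by (rule norm_cauchy_schwarz)
  finally have "norm (l2_of \<Omega> d) * norm (l2_of \<Omega> d) \<le> norm (w - l2_of \<Omega> u) * norm (l2_of \<Omega> d)"
    by (simp add: power2_norm_eq_inner flip: power2_eq_square)
  then have "norm (l2_of \<Omega> d) \<le> norm (w - l2_of \<Omega> u)"
    by (cases "norm (l2_of \<Omega> d) = 0") (auto simp: mult_le_cancel_right)
  then show ?thesis by (simp add: d(2))
qed

text \<open>The classes of functions that vanish outside \<open>\<Omega>\<close> form a closed subspace.\<close>

lemma l2_of_limit:
  assumes "open \<Omega>" "\<And>k. u k \<in> L2 \<Omega>" "(\<lambda>k. l2_of \<Omega> (u k)) \<longlonglongrightarrow> w"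
  shows "l2_of \<Omega> (rep_l2 w) = w"
proof -
  have 0: "(\<lambda>k. norm (w - l2_of \<Omega> (u k))) \<longlonglongrightarrow> 0"
    using tendsto_norm_zero[OF LIM_zero[OF assms(3)]] by (simp add: norm_minus_commute)
  have "(\<lambda>k. norm (l2_of \<Omega> (rep_l2 w) - l2_of \<Omega> (u k))) \<longlonglongrightarrow> 0"
    by (rule tendsto_sandwich[OF _ _ tendsto_const 0])
       (auto intro!: always_eventually norm_l2_of_rep_le assms)
  then have "(\<lambda>k. norm (l2_of \<Omega> (u k) - l2_of \<Omega> (rep_l2 w))) \<longlonglongrightarrow> 0"
    by (simp only: norm_minus_commute[of "l2_of \<Omega> (rep_l2 w)"])
  then have "(\<lambda>k. l2_of \<Omega> (u k)) \<longlonglongrightarrow> l2_of \<Omega> (rep_l2 w)"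
    by (rule LIM_zero_cancel[OF tendsto_norm_zero_cancel])
  from LIMSEQ_unique[OF this assms(3)] show ?thesis .
qed

lemma L2_tendsto_iff:
  assumes "open \<Omega>" "\<And>k. u k \<in> L2 \<Omega>" "w \<in> L2 \<Omega>"
  shows "L2_tendsto \<Omega> u w \<longleftrightarrow> (\<lambda>k. l2_of \<Omega> (u k)) \<longlonglongrightarrow> l2_of \<Omega> w"
  unfolding L2_tendsto_def L2_norm_diff[OF assms(1,2,3)]
  by (simp add: LIM_zero_iff tendsto_norm_zero_iff)

section \<open>The fundamental lemma of the calculus of variations\<close>

text \<open>The boxes are an intersection-stable generator of the Borel sets, so the integrals over all Borel
  sets vanish, in particular those over the sets where a Borel version of \<open>V\<close> is positive or negative.\<close>

lemma integral_boxes_zero_imp_AE_zero: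
  fixes V :: "'a::euclidean_space \<Rightarrow> real"
  assumes V: "integrable lebesgue V"
    and box: "\<And>a b. (LINT x|lebesgue. indicator (box a b) x * V x) = 0"
  shows "AE x in lebesgue. V x = 0"
proof -
  have int: "integrable lebesgue (\<lambda>x. indicator A x * V x)" if "A \<in> sets borel" for A
    using integrable_mult_indicator[OF _ V, of A] that by simp
  have all: "(LINT x|lebesgue. V x) = 0"
  proof -
    have "(\<lambda>k. LINT x|lebesgue. indicator (box (- real k *\<^sub>R One) (real k *\<^sub>R One)) x * V x)
        \<longlonglongrightarrow> (LINT x|lebesgue. V x)"
    proof (rule integral_dominated_convergence[where w = "\<lambda>x. norm (V x)"])
      show "AE x in lebesgue. (\<lambda>k. indicator (box (- real k *\<^sub>R One) (real k *\<^sub>R One)) x * V x) \<longlonglongrightarrow> V x"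
      proof (rule always_eventually, rule allI, rule tendsto_eventually)
        fix x :: 'a
        obtain K :: nat where K: "norm x < real K" using reals_Archimedean2 by blast
        show "\<forall>\<^sub>F k in sequentially. indicator (box (- real k *\<^sub>R One) (real k *\<^sub>R One)) x * V x = V x"
          using eventually_ge_at_top[of K]
        proof eventually_elim
          case (elim k)
          have "- real k < x \<bullet> i \<and> x \<bullet> i < real k" if "i \<in> Basis" for i
          proof -
            have "\<bar>x \<bullet> i\<bar> < real k" using Basis_le_norm[OF that, of x] K elim by linarith
            then show ?thesis by linarith
          qed
          then have "x \<in> box (- real k *\<^sub>R One) (real k *\<^sub>R One)" by (simp add: mem_box)
          then show ?case by simp
        qed
      qed
    qed (use V int in \<open>auto simp: indicator_def\<close>)
    then show ?thesis using box by (simp add: LIMSEQ_const_iff)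
  qed
  have *: "(LINT x|lebesgue. indicator A x * V x) = 0" if "A \<in> sets borel" for A
  proof -
    have "Int_stable (range (\<lambda>(a, b). box a b :: 'a set))"
      by (auto simp: Int_stable_def box_Int_box)
    moreover have "range (\<lambda>(a, b). box a b :: 'a set) \<subseteq> Pow UNIV" by simp
    moreover have "A \<in> sigma_sets UNIV (range (\<lambda>(a, b). box a b :: 'a set))"
      using that by (simp add: borel_eq_box)
    ultimately show ?thesis
    proof (induction rule: sigma_sets_induct_disjoint)
      case (basic A)
      then show ?case using box by auto
    next
      case empty
      then show ?case by simp
    next
      case (compl A)
      then have A: "A \<in> sets borel" by (simp add: borel_eq_box)
      have "(LINT x|lebesgue. indicator (UNIV - A) x * V x)
          = (LINT x|lebesgue. V x - indicator A x * V x)"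
        by (rule Bochner_Integration.integral_cong) (auto simp: indicator_def)
      also have "\<dots> = 0" using compl all V int[OF A] by simp
      finally show ?case .
    next
      case (union A)
      have A: "A i \<in> sets borel" for i using union(2) by (auto simp: borel_eq_box)
      have UA: "(\<Union>i. A i) \<in> sets borel" using A by blast
      have "(LINT x:(\<Union>i. A i)|lebesgue. V x) = (\<Sum>i. (LINT x:(A i)|lebesgue. V x))"
        by (rule lebesgue_integral_countable_add)
           (use union(1) A int[OF UA] in \<open>auto simp: disjoint_family_on_def set_integrable_def\<close>)
      also have "\<dots> = 0" using union(3) by (simp add: set_lebesgue_integral_def)
      finally show ?case by (simp add: set_lebesgue_integral_def)
    qed
  qed
  obtain V' where V': "V' \<in> borel_measurable lborel" "AE x in lborel. V x = V' x"
    using completion_ex_borel_measurable_real[OF borel_measurable_integrable[OF V]] by auto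
  have Vb: "V' \<in> borel_measurable borel" using V'(1) by simp
  have meas: "{x. V' x > 0} \<in> sets borel" "{x. V' x < 0} \<in> sets borel"
    using borel_measurable_less[OF borel_measurable_const Vb, of 0]
      borel_measurable_less[OF Vb borel_measurable_const, of 0] by simp_all
  note zero = *[OF meas(1)] *[OF meas(2)]
  have ae: "AE x in lebesgue. V x = V' x" using V'(2) by (rule AE_completion)
  have "AE x in lebesgue. indicator {x. V' x > 0} x * V x = 0"
    by (subst integral_nonneg_eq_0_iff_AE[symmetric])
       (use zero(1) int[OF meas(1)] ae in \<open>auto elim!: eventually_mono simp: indicator_def\<close>)
  moreover have "AE x in lebesgue. - (indicator {x. V' x < 0} x * V x) = 0"
    by (subst integral_nonneg_eq_0_iff_AE[symmetric])
       (use zero(2) int[OF meas(2)] ae in \<open>auto elim!: eventually_mono simp: indicator_def\<close>)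
  ultimately show ?thesis
    using ae by eventually_elim (auto simp: indicator_def split: if_splits)
qed

lemma test_function_props:
  assumes "\<phi> \<in> test_functions \<Omega>"
  shows "C_infinity \<phi>" "continuous_on S \<phi>" "\<phi> \<in> borel_measurable borel"
    "\<phi> \<in> borel_measurable lebesgue" "x \<notin> \<Omega> \<Longrightarrow> \<phi> x = 0" "indicator \<Omega> x * \<phi> x = \<phi> x"
    "\<exists>C B. \<forall>x. \<bar>\<phi> x\<bar> \<le> C * indicator (cball 0 B) x" "square_integrable \<phi>"
proof -
  show C: "C_infinity \<phi>" using assms by (simp add: test_functions_def)
  then show "continuous_on S \<phi>" for S by (rule C_infinity_continuous_on)
  note cont = this
  show m: "\<phi> \<in> borel_measurable borel" by (rule borel_measurable_continuous_onI[OF cont])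
  then show ml: "\<phi> \<in> borel_measurable lebesgue"
    by (simp add: measurable_completion)
  show z: "\<phi> x = 0" if "x \<notin> \<Omega>" for x
    using assms that closure_subset[of "{x. \<phi> x \<noteq> 0}"] by (auto simp: test_functions_def)
  show "indicator \<Omega> x * \<phi> x = \<phi> x" using z by (auto simp: indicator_def)
  let ?K = "closure {x. \<phi> x \<noteq> 0}"
  have K: "compact ?K" using assms by (simp add: test_functions_def)
  have "compact (\<phi> ` ?K)" by (rule compact_continuous_image[OF cont K])
  then obtain C where C: "C > 0" "\<And>x. x \<in> ?K \<Longrightarrow> \<bar>\<phi> x\<bar> \<le> C"
    by (auto dest!: compact_imp_bounded simp: bounded_pos)
  obtain B where B: "\<And>x. x \<in> ?K \<Longrightarrow> norm x \<le> B"
    using compact_imp_bounded[OF K] by (auto simp: bounded_pos)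
  have "\<bar>\<phi> x\<bar> \<le> C * indicator (cball 0 B) x" for x
    using C B[of x] closure_subset[of "{x. \<phi> x \<noteq> 0}"] by (cases "\<phi> x = 0") (auto simp: indicator_def)
  then have "\<forall>x. \<bar>\<phi> x\<bar> \<le> C * indicator (cball 0 B) x" by blast
  then show e: "\<exists>C B. \<forall>x. \<bar>\<phi> x\<bar> \<le> C * indicator (cball 0 B) x" by blast
  then obtain C B where CB: "\<And>x. \<bar>\<phi> x\<bar> \<le> C * indicator (cball 0 B) x" by blast
  have "C \<ge> 0 \<or> (\<forall>x. \<phi> x = 0)"
  proof (cases "C \<ge> 0")
    case False
    then have "C * indicator (cball 0 B) x \<le> 0" for x by (simp add: mult_nonpos_nonneg)
    then have "\<bar>\<phi> x\<bar> \<le> 0" for x using CB order_trans by blast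
    then show ?thesis by simp
  qed simp
  show "square_integrable \<phi>"
    by (rule square_integrable_bound[OF square_integrable_indicator[of "cball 0 B" C] ml])
       (use CB in \<open>auto intro!: always_eventually intro: order_trans[OF _ abs_ge_self]\<close>)
qed

lemma test_function_L2:
  assumes "open \<Omega>" "\<phi> \<in> test_functions \<Omega>"
  shows "\<phi> \<in> L2 \<Omega>" "l2_of \<Omega> \<phi> = abs_l2 \<phi>"
proof -
  have "(\<lambda>x. indicator \<Omega> x * \<phi> x) = \<phi>" by (rule ext) (rule test_function_props(6)[OF assms(2)])
  then show "\<phi> \<in> L2 \<Omega>" "l2_of \<Omega> \<phi> = abs_l2 \<phi>"
    using test_function_props(8)[OF assms(2)] by (simp_all add: L2_iff_square_integrable assms l2_of_def)
qed

lemma AE_zero_on_open_if_on_cboxes: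
  fixes \<Omega> :: "'a::euclidean_space set"
  assumes "open \<Omega>" "\<And>a b. cbox a b \<subseteq> \<Omega> \<Longrightarrow> AE x in lebesgue. x \<in> cbox a b \<longrightarrow> P x"
  shows "AE x in lebesgue. x \<in> \<Omega> \<longrightarrow> P x"
proof -
  obtain D where D: "countable D" "D \<subseteq> Pow \<Omega>" "\<And>X. X \<in> D \<Longrightarrow> \<exists>a b. X = cbox a b" "\<Union>D = \<Omega>"
    using open_countable_Union_open_cbox[OF assms(1)] by metis
  have "AE x in lebesgue. \<forall>X\<in>D. x \<in> X \<longrightarrow> P x"
    unfolding AE_ball_countable[OF D(1)]
  proof
    fix X assume "X \<in> D"
    with D obtain a b where "X = cbox a b" "X \<subseteq> \<Omega>" by blast
    with assms(2)[of a b] show "AE x in lebesgue. x \<in> X \<longrightarrow> P x" by simp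
  qed
  then show ?thesis by eventually_elim (use D(4) in blast)
qed

text \<open>The bumps on a box converge boundedly to its indicator function, so \<open>w\<close> has integral zero over every
  box whose closure lies in \<open>\<Omega>\<close>.\<close>

lemma fundamental_lemma_variations:
  assumes "open \<Omega>" "w \<in> L2 \<Omega>" "\<And>\<phi>. \<phi> \<in> test_functions \<Omega> \<Longrightarrow> L2_inner \<Omega> w \<phi> = 0"
  shows "AE x in lebesgue_on \<Omega>. w x = 0"
proof -
  define W where "W x = indicator \<Omega> x * w x" for x
  have W: "square_integrable W"
    using assms(1,2) by (simp add: W_def[abs_def] L2_iff_square_integrable)
  have sqi: "square_integrable (indicator (cbox a b) :: real ^ 'a \<Rightarrow> real)" for a b
    using square_integrable_indicator[of "cbox a b" 1] by simp
  have box0: "(LINT x|lebesgue. indicator (box a b) x * W x) = 0" if sub: "cbox a b \<subseteq> \<Omega>" for a b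
  proof -
    have "(\<lambda>k. LINT x|lebesgue. box_bump a b (real (Suc k)) x * W x)
        \<longlonglongrightarrow> (LINT x|lebesgue. indicator (box a b) x * W x)"
    proof (rule integral_dominated_convergence[where w = "\<lambda>x. norm (indicator (cbox a b) x * W x)"])
      show "integrable lebesgue (\<lambda>x. norm (indicator (cbox a b) x * W x))"
        by (intro integrable_norm square_integrable_mult_integrable sqi W)
      show "(\<lambda>x. indicator (box a b) x * W x) \<in> borel_measurable lebesgue"
        using square_integrable_measurable[OF W] by (intro borel_measurable_times borel_measurable_indicator) auto
      show "(\<lambda>x. box_bump a b (real (Suc k)) x * W x) \<in> borel_measurable lebesgue" for k
        by (intro borel_measurable_times square_integrable_measurable[OF W]
            test_function_props(4)[OF box_bump_test_function[OF sub]]) simp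
      show "AE x in lebesgue. (\<lambda>k. box_bump a b (real (Suc k)) x * W x) \<longlonglongrightarrow> indicator (box a b) x * W x"
        by (intro always_eventually allI tendsto_mult box_bump_tendsto tendsto_const)
      show "AE x in lebesgue. norm (box_bump a b (real (Suc k)) x * W x) \<le> norm (indicator (cbox a b) x * W x)" for k
      proof (intro always_eventually allI)
        fix x
        have "\<bar>box_bump a b (real (Suc k)) x\<bar> \<le> indicator (cbox a b) x"
          using box_bump_bounds[of a b "real (Suc k)" x] box_bump_pos_iff[of "real (Suc k)" a b x]
            box_subset_cbox[of a b] by (auto simp: indicator_def)
        then show "norm (box_bump a b (real (Suc k)) x * W x) \<le> norm (indicator (cbox a b) x * W x)"
          by (simp add: abs_mult mult_right_mono)
      qed
    qed
    moreover have "(LINT x|lebesgue. box_bump a b (real (Suc k)) x * W x) = 0" for k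
    proof -
      have \<phi>: "box_bump a b (real (Suc k)) \<in> test_functions \<Omega>" by (rule box_bump_test_function[OF sub]) simp
      have "(LINT x|lebesgue. box_bump a b (real (Suc k)) x * W x) = L2_inner \<Omega> w (box_bump a b (real (Suc k)))"
        unfolding L2_inner_eq_integral[OF assms(1)] test_function_props(6)[OF \<phi>] W_def
        by (simp add: mult.commute)
      then show ?thesis using assms(3)[OF \<phi>] by simp
    qed
    ultimately show ?thesis by (simp add: LIMSEQ_const_iff)
  qed
  have "AE x in lebesgue. x \<in> \<Omega> \<longrightarrow> W x = 0"
  proof (rule AE_zero_on_open_if_on_cboxes[OF assms(1)])
    fix c d :: "real ^ 'a" assume sub: "cbox c d \<subseteq> \<Omega>"
    have sb: "square_integrable (indicator (box c d) :: real ^ 'a \<Rightarrow> real)"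
      using square_integrable_indicator[of "box c d" 1] by simp
    \<comment> \<open>Cutting off to the open box keeps its intersections with other boxes open boxes, whose
      closures lie in \<open>\<Omega>\<close>.\<close>
    have V: "integrable lebesgue (\<lambda>x. indicator (box c d) x * W x)"
      by (rule square_integrable_mult_integrable[OF sb W])
    have "AE x in lebesgue. indicator (box c d) x * W x = 0"
    proof (rule integral_boxes_zero_imp_AE_zero[OF V])
      fix a b :: "real ^ 'a"
      obtain a' b' where ab: "box a b \<inter> box c d = box a' b'"
        using box_Int_box[of a b c d] by blast
      have "(LINT x|lebesgue. indicator (box a b) x * (indicator (box c d) x * W x))
          = (LINT x|lebesgue. indicator (box a' b') x * W x)"
        unfolding ab[symmetric] by (simp add: indicator_inter_arith mult.assoc)
      also have "\<dots> = 0"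
      proof (cases "box a' b' = {}")
        case False
        then have "cbox a' b' = closure (box a' b')" by simp
        also have "\<dots> \<subseteq> cbox c d"
          by (rule closure_minimal) (use ab box_subset_cbox[of c d] in auto)
        finally show ?thesis using box0 sub by blast
      qed simp
      finally show "(LINT x|lebesgue. indicator (box a b) x * (indicator (box c d) x * W x)) = 0" .
    qed
    moreover have "AE x in lebesgue. x \<notin> cbox c d - box c d"
      by (intro AE_not_in) (use negligible_frontier_interval[of c d] in \<open>simp add: negligible_iff_null_sets\<close>)
    ultimately show "AE x in lebesgue. x \<in> cbox c d \<longrightarrow> W x = 0"
      by eventually_elim (auto simp: indicator_def split: if_splits)
  qed
  then show ?thesis
    unfolding AE_lebesgue_on_open[OF assms(1)] by (auto elim!: eventually_mono simp: W_def)
qed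

section \<open>Integration by parts and translations\<close>

lemma partial_d_test_function:
  assumes "\<phi> \<in> test_functions \<Omega>"
  shows "partial_d i \<phi> \<in> test_functions \<Omega>"
proof -
  let ?K = "closure {x. \<phi> x \<noteq> 0}"
  have \<phi>: "C_infinity \<phi>" "compact ?K" "?K \<subseteq> \<Omega>" using assms by (auto simp: test_functions_def)
  have "partial_d i \<phi> x = 0" if "x \<notin> ?K" for x
  proof -
    have "(\<phi> has_derivative (\<lambda>h. 0)) (at x)"
    proof (rule has_derivative_transform_within_open[OF has_derivative_const[of 0]])
      show "open (- ?K)" "x \<in> - ?K" using that by auto
      show "0 = \<phi> y" if "y \<in> - ?K" for y
        using that closure_subset[of "{x. \<phi> x \<noteq> 0}"] by auto
    qed
    from partial_d_eqI[OF this] show ?thesis .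
  qed
  then show ?thesis
    by (intro test_functionI[OF C_infinity_partial_d[OF \<phi>(1)] \<phi>(2,3)]) blast
qed

lemma test_function_support:
  assumes "\<phi> \<in> test_functions \<Omega>"
  shows "C_infinity \<phi>" "compact (closure {x. \<phi> x \<noteq> 0})" "closure {x. \<phi> x \<noteq> 0} \<subseteq> \<Omega>"
    "\<phi> x \<noteq> 0 \<Longrightarrow> x \<in> closure {x. \<phi> x \<noteq> 0}"
  using assms closure_subset[of "{x. \<phi> x \<noteq> 0}"] by (auto simp: test_functions_def)

lemma test_function_diff:
  assumes "\<phi> \<in> test_functions \<Omega>" "\<psi> \<in> test_functions \<Omega>"
  shows "(\<lambda>x. \<phi> x - \<psi> x) \<in> test_functions \<Omega>"
proof -
  note \<phi> = test_function_support[OF assms(1)] and \<psi> = test_function_support[OF assms(2)]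
  show ?thesis
  proof (rule test_functionI[OF C_infinity_diff[OF \<phi>(1) \<psi>(1)] compact_Un[OF \<phi>(2) \<psi>(2)] Un_least[OF \<phi>(3) \<psi>(3)]])
    fix x assume "\<phi> x - \<psi> x \<noteq> 0"
    then have "\<phi> x \<noteq> 0 \<or> \<psi> x \<noteq> 0" by auto
    then show "x \<in> closure {x. \<phi> x \<noteq> 0} \<union> closure {x. \<psi> x \<noteq> 0}" using \<phi>(4) \<psi>(4) by auto
  qed
qed

lemma test_function_mult:
  assumes "\<phi> \<in> test_functions \<Omega>" "\<psi> \<in> test_functions \<Omega>"
  shows "(\<lambda>x. \<phi> x * \<psi> x) \<in> test_functions \<Omega>"
proof -
  note \<phi> = test_function_support[OF assms(1)] and \<psi> = test_function_support[OF assms(2)]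
  show ?thesis
    by (rule test_functionI[OF C_infinity_mult[OF \<phi>(1) \<psi>(1)] \<phi>(2,3)]) (use \<phi>(4) in auto)
qed

lemma integral_lebesgue_translate:
  fixes f :: "'a::euclidean_space \<Rightarrow> real"
  assumes "f \<in> borel_measurable borel"
  shows "(LINT x|lebesgue. f (h + x)) = (LINT x|lebesgue. f x)"
proof -
  have "(LINT x|lebesgue. f (h + x)) = (LINT x|lborel. f (h + x))"
    by (rule integral_completion) (use assms in measurable)
  also have "\<dots> = (LINT x|distr lborel borel ((+) h). f x)"
    by (rule integral_distr[symmetric]) (use assms in auto)
  also have "\<dots> = (LINT x|lborel. f x)" by (simp only: lborel_distr_plus)
  also have "\<dots> = (LINT x|lebesgue. f x)"
    by (rule integral_completion[symmetric]) (use assms in measurable)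
  finally show ?thesis .
qed

lemma square_integrable_translate:
  fixes f :: "'a::euclidean_space \<Rightarrow> real"
  assumes "f \<in> borel_measurable borel" "square_integrable f"
  shows "square_integrable (\<lambda>x. f (h + x))"
proof -
  have m: "(\<lambda>x. f (h + x)) \<in> borel_measurable borel" using assms(1) by measurable
  have "integrable lborel (\<lambda>x. (f x)\<^sup>2)"
    using assms by (subst integrable_completion[symmetric]) (auto simp: square_integrable_def)
  then have "integrable (distr lborel borel ((+) h)) (\<lambda>x. (f x)\<^sup>2)" by (simp only: lborel_distr_plus)
  then have "integrable lborel (\<lambda>x. (f (h + x))\<^sup>2)"
    by (subst (asm) integrable_distr_eq) (use assms(1) in auto)
  then have "integrable lebesgue (\<lambda>x. (f (h + x))\<^sup>2)"
    by (subst integrable_completion) (use m in auto)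
  then show ?thesis using m by (simp add: square_integrable_def measurable_completion)
qed

lemma norm_translate:
  fixes f :: "'a::euclidean_space \<Rightarrow> real"
  assumes "f \<in> borel_measurable borel" "square_integrable f"
  shows "norm (abs_l2 (\<lambda>x. f (h + x))) = norm (abs_l2 f)"
proof -
  have "(norm (abs_l2 (\<lambda>x. f (h + x))))\<^sup>2 = (norm (abs_l2 f))\<^sup>2"
    unfolding norm_abs_l2[OF square_integrable_translate[OF assms]] norm_abs_l2[OF assms(2)]
    by (rule integral_lebesgue_translate) (use assms(1) in measurable)
  then show ?thesis by simp
qed

definition difference_quotient :: "real ^ 'n \<Rightarrow> (real ^ 'n \<Rightarrow> real) \<Rightarrow> nat \<Rightarrow> real ^ 'n \<Rightarrow> real" where
  "difference_quotient h \<phi> k x = real (Suc k) * (\<phi> (inverse (real (Suc k)) *\<^sub>R h + x) - \<phi> x)"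

definition directional_derivative :: "real ^ 'n \<Rightarrow> (real ^ 'n \<Rightarrow> real) \<Rightarrow> real ^ 'n \<Rightarrow> real" where
  "directional_derivative h \<phi> x = (\<Sum>i\<in>UNIV. h $ i * partial_d i \<phi> x)"

text \<open>By the mean value theorem the difference quotients of a test function are values of its
  directional derivative at nearby points.\<close>

lemma difference_quotients_converge:
  fixes \<phi> :: "real ^ 'n \<Rightarrow> real" and h :: "real ^ 'n"
  assumes "\<phi> \<in> test_functions \<Omega>"
  shows "\<exists>B. \<forall>k x. B < norm x \<longrightarrow> difference_quotient h \<phi> k x = 0 \<and> directional_derivative h \<phi> x = 0"
    "square_integrable (difference_quotient h \<phi> k)" "square_integrable (directional_derivative h \<phi>)"
    "(\<lambda>k. abs_l2 (difference_quotient h \<phi> k)) \<longlonglongrightarrow> abs_l2 (directional_derivative h \<phi>)"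
proof -
  let ?q = "difference_quotient h \<phi>" and ?D = "directional_derivative h \<phi>"
  note p = test_function_props[OF partial_d_test_function[OF assms(1)]]
  note \<phi> = test_function_props[OF assms(1)]
  have Dcont: "continuous_on UNIV ?D" unfolding directional_derivative_def[abs_def] by (intro continuous_intros p)
  have "\<exists>C B. \<forall>x. \<bar>partial_d i \<phi> x\<bar> \<le> C * indicator (cball 0 B) x" for i by (rule p(7))
  then obtain C B where CB: "\<And>i x. \<bar>partial_d i \<phi> x\<bar> \<le> C i * indicator (cball 0 (B i)) x" by metis
  define B' where "B' = (\<Sum>i\<in>UNIV. \<bar>B i\<bar>)"
  define C' where "C' = (\<Sum>i\<in>UNIV. \<bar>h $ i\<bar> * \<bar>C i\<bar>)"
  have BB: "B i \<le> B'" for i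
    unfolding B'_def using abs_ge_self[of "B i"] member_le_sum[of i UNIV "\<lambda>i. \<bar>B i\<bar>"] by simp
  have D0: "?D x = 0" if "norm x > B'" for x
  proof -
    have "partial_d i \<phi> x = 0" for i
      using CB[of i x] BB[of i] that by (auto simp: indicator_def split: if_splits)
    then show ?thesis by (simp add: directional_derivative_def)
  qed
  have DC: "\<bar>?D x\<bar> \<le> C'" for x
    unfolding directional_derivative_def C'_def
  proof (rule order_trans[OF sum_abs sum_mono])
    fix i
    have "\<bar>partial_d i \<phi> x\<bar> \<le> \<bar>C i\<bar>" using CB[of i x] by (cases "x \<in> cball 0 (B i)") auto
    then show "\<bar>h $ i * partial_d i \<phi> x\<bar> \<le> \<bar>h $ i\<bar> * \<bar>C i\<bar>" by (simp add: abs_mult mult_left_mono)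
  qed
  have mvt: "\<exists>z. 0 < z \<and> z < inverse (real (Suc k)) \<and> ?q k x = ?D (x + z *\<^sub>R h)" for k x
  proof -
    have "((\<lambda>t. \<phi> (x + t *\<^sub>R h)) has_real_derivative ?D (x + t *\<^sub>R h)) (at t)" for t
    proof -
      have "((\<lambda>t. x + t *\<^sub>R h) has_derivative (\<lambda>s. s *\<^sub>R h)) (at t)"
        by (auto intro!: derivative_eq_intros)
      from has_derivative_compose[OF this C_infinity_has_derivative[OF \<phi>(1)]]
      have "((\<lambda>t. \<phi> (x + t *\<^sub>R h)) has_derivative
          (\<lambda>s. \<Sum>i\<in>UNIV. (s *\<^sub>R h) $ i * partial_d i \<phi> (x + t *\<^sub>R h))) (at t)" .
      moreover have "(\<lambda>s. \<Sum>i\<in>UNIV. (s *\<^sub>R h) $ i * partial_d i \<phi> (x + t *\<^sub>R h)) = (*) (?D (x + t *\<^sub>R h))"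
        by (rule ext) (simp add: directional_derivative_def sum_distrib_left mult_ac)
      ultimately show ?thesis by (simp only: has_field_derivative_def)
    qed
    then obtain z where z: "z > 0" "z < inverse (real (Suc k))"
      "\<phi> (x + inverse (real (Suc k)) *\<^sub>R h) - \<phi> (x + 0 *\<^sub>R h) = (inverse (real (Suc k)) - 0) * ?D (x + z *\<^sub>R h)"
      using MVT2[of 0 "inverse (real (Suc k))" "\<lambda>t. \<phi> (x + t *\<^sub>R h)" "\<lambda>t. ?D (x + t *\<^sub>R h)"] by auto
    then have "?q k x = ?D (x + z *\<^sub>R h)"
      unfolding difference_quotient_def by (simp add: add.commute del: of_nat_Suc)
    with z show ?thesis by blast
  qed
  define B2 where "B2 = B' + norm h"
  have q0: "?q k x = 0" if "norm x > B2" for k x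
  proof -
    obtain z where z: "0 < z" "z < inverse (real (Suc k))" "?q k x = ?D (x + z *\<^sub>R h)" using mvt by blast
    have "z \<le> 1" using z(2) inverse_le_1_iff[of "real (Suc k)"] by linarith
    then have "norm (z *\<^sub>R h) \<le> norm h" using z(1) by (simp add: mult_left_le_one_le)
    then have "norm (x + z *\<^sub>R h) > B'"
      using that norm_triangle_ineq4[of "x + z *\<^sub>R h" "z *\<^sub>R h"] by (simp add: B2_def)
    then show ?thesis using D0 z(3) by simp
  qed
  have D02: "?D x = 0" if "norm x > B2" for x
    using that norm_ge_zero[of h] unfolding B2_def by (intro D0) linarith
  show "\<exists>B. \<forall>k x. B < norm x \<longrightarrow> ?q k x = 0 \<and> ?D x = 0" using q0 D02 by blast
  have qb: "\<bar>?q k x\<bar> \<le> C' * indicator (cball 0 B2) x" for k x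
    using q0[of x k] mvt[of k x] DC by (cases "norm x > B2") (auto simp: indicator_def)
  have qm: "?q k \<in> borel_measurable lebesgue" for k
  proof -
    have "?q k \<in> borel_measurable borel" unfolding difference_quotient_def[abs_def] using \<phi>(3) by measurable
    then show ?thesis by (simp add: measurable_completion)
  qed
  have Dm: "?D \<in> borel_measurable lebesgue"
    using borel_measurable_continuous_onI[OF Dcont] by (simp add: measurable_completion)
  have lim: "(\<lambda>k. ?q k x) \<longlonglongrightarrow> ?D x" for x
  proof -
    have "\<forall>k. \<exists>z. 0 < z \<and> z < inverse (real (Suc k)) \<and> ?q k x = ?D (x + z *\<^sub>R h)"
      using mvt by blast
    from choice[OF this] obtain z
      where z: "\<And>k. 0 < z k \<and> z k < inverse (real (Suc k)) \<and> ?q k x = ?D (x + z k *\<^sub>R h)"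
      by blast
    have "z \<longlonglongrightarrow> 0"
      by (rule tendsto_sandwich[OF _ _ tendsto_const LIMSEQ_inverse_real_of_nat])
         (use z in \<open>auto intro!: always_eventually less_imp_le\<close>)
    then have "(\<lambda>k. x + z k *\<^sub>R h) \<longlonglongrightarrow> x + 0 *\<^sub>R h" by (intro tendsto_intros)
    moreover have "isCont ?D (x + 0 *\<^sub>R h)" using Dcont by (simp add: continuous_on_eq_continuous_at)
    ultimately have "(\<lambda>k. ?D (x + z k *\<^sub>R h)) \<longlonglongrightarrow> ?D (x + 0 *\<^sub>R h)" by (rule isCont_tendsto_compose[rotated])
    then show ?thesis using z by simp
  qed
  have S: "square_integrable (\<lambda>x::real^'n. C' * indicator (cball 0 B2) x)"
    by (rule square_integrable_indicator) simp
  note dc = l2_dominated_convergence[OF S qm Dm always_eventually[OF allI[OF lim]] always_eventually[OF allI[OF qb]]]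
  show "square_integrable (?q k)" by (rule dc(1))
  show "square_integrable ?D" by (rule dc(2))
  show "(\<lambda>k. abs_l2 (?q k)) \<longlonglongrightarrow> abs_l2 ?D" by (rule dc(3))
qed

text \<open>Translation invariance makes the integrals of all difference quotients vanish. The difference
  quotients vanish outside a common ball, so their integrals are inner products with its indicator function
  and pass to the limit.\<close>

lemma integral_partial_d_zero:
  fixes \<phi> :: "real ^ 'n \<Rightarrow> real"
  assumes "\<phi> \<in> test_functions \<Omega>"
  shows "(LINT x|lebesgue. partial_d i \<phi> x) = 0"
proof -
  let ?q = "difference_quotient (axis i 1) \<phi>" and ?D = "directional_derivative (axis i 1) \<phi>"
  note dq = difference_quotients_converge[OF assms, where h = "axis i 1"]
  have D: "?D = partial_d i \<phi>"
    by (rule ext) (simp add: directional_derivative_def axis_def if_distrib[of "\<lambda>c. c * _"] cong: if_cong)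
  obtain B where B: "\<And>k x. B < norm x \<Longrightarrow> ?q k x = 0 \<and> ?D x = 0" using dq(1) by blast
  define I where "I = (\<lambda>x::real^'n. 1 * indicator (cball 0 B) x :: real)"
  have I: "square_integrable I" unfolding I_def by (rule square_integrable_indicator) simp
  have eqI: "inner (abs_l2 f) (abs_l2 I) = (LINT x|lebesgue. f x)"
    if "square_integrable f" "\<And>x. B < norm x \<Longrightarrow> f x = 0" for f :: "real ^ 'n \<Rightarrow> real"
    unfolding inner_abs_l2[OF that(1) I]
    by (rule Bochner_Integration.integral_cong) (use that(2) in \<open>auto simp: I_def indicator_def\<close>)
  note sq = dq(2,3)
  have int: "integrable lebesgue \<phi>"
  proof -
    obtain C B where CB: "\<And>x. \<bar>\<phi> x\<bar> \<le> C * indicator (cball 0 B) x"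
      using test_function_props(7)[OF assms] by blast
    have "integrable lebesgue (\<lambda>x::real^'n. C * indicator (cball 0 B) x)"
      by (rule integrable_mult_right) (simp flip: lmeasurable_iff_integrable)
    then show ?thesis
      by (rule Bochner_Integration.integrable_bound)
         (use CB test_function_props(4)[OF assms] in \<open>auto intro!: always_eventually intro: order_trans[OF _ abs_ge_self]\<close>)
  qed
  have q0: "(LINT x|lebesgue. ?q k x) = 0" for k
  proof -
    let ?s = "inverse (real (Suc k)) *\<^sub>R axis i 1 :: real ^ 'n"
    have "integrable lebesgue (\<lambda>x. \<phi> (?s + x))"
    proof -
      have "integrable (distr lborel borel ((+) ?s)) \<phi>"
        using int test_function_props(3)[OF assms] by (simp add: integrable_completion lborel_distr_plus)
      then have "integrable lborel (\<lambda>x. \<phi> (?s + x))"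
        by (subst (asm) integrable_distr_eq) (use test_function_props(3)[OF assms] in auto)
      then show ?thesis
        by (subst integrable_completion) (use test_function_props(3)[OF assms] in auto)
    qed
    then show ?thesis
      unfolding difference_quotient_def using int integral_lebesgue_translate[OF test_function_props(3)[OF assms], of ?s]
      by (simp del: of_nat_Suc)
  qed
  have "(\<lambda>k. inner (abs_l2 (?q k)) (abs_l2 I)) \<longlonglongrightarrow> inner (abs_l2 ?D) (abs_l2 I)"
    using dq(4) by (intro tendsto_intros)
  then have "(\<lambda>k. 0) \<longlonglongrightarrow> inner (abs_l2 ?D) (abs_l2 I)"
    using eqI[OF sq(1)] B q0 by simp
  then have "inner (abs_l2 ?D) (abs_l2 I) = 0" by (simp add: LIMSEQ_const_iff)
  then show ?thesis using eqI[OF sq(2)] B by (simp add: D)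
qed

text \<open>Integration by parts: the derivative of the product of two test functions has integral zero.\<close>

lemma has_weak_pd_test_function:
  assumes "open \<Omega>" "\<phi> \<in> test_functions \<Omega>"
  shows "has_weak_pd \<Omega> i \<phi> (partial_d i \<phi>)"
  unfolding has_weak_pd_def
proof (intro conjI ballI test_function_L2 partial_d_test_function assms)
  fix \<psi> assume \<psi>: "\<psi> \<in> test_functions \<Omega>"
  note dp = partial_d_test_function[OF assms(2)] partial_d_test_function[OF \<psi>]
  note sq = test_function_props(8)[OF assms(2)] test_function_props(8)[OF \<psi>]
    test_function_props(8)[OF dp(1)] test_function_props(8)[OF dp(2)]
  have "partial_d i (\<lambda>x. \<phi> x * \<psi> x) = (\<lambda>x. \<phi> x * partial_d i \<psi> x + partial_d i \<phi> x * \<psi> x)"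
    by (intro partial_d_mult C_infinity_differentiable test_function_props(1)[OF assms(2)]
        test_function_props(1)[OF \<psi>])
  then have "0 = (LINT x|lebesgue. \<phi> x * partial_d i \<psi> x + partial_d i \<phi> x * \<psi> x)"
    using integral_partial_d_zero[OF test_function_mult[OF assms(2) \<psi>], of i] by simp
  also have "\<dots> = (LINT x|lebesgue. \<phi> x * partial_d i \<psi> x) + (LINT x|lebesgue. partial_d i \<phi> x * \<psi> x)"
    by (intro Bochner_Integration.integral_add square_integrable_mult_integrable sq)
  finally show "L2_inner \<Omega> \<phi> (partial_d i \<psi>) = - L2_inner \<Omega> (partial_d i \<phi>) \<psi>"
    unfolding L2_inner_eq_integral[OF assms(1)] test_function_props(6)[OF assms(2)]
      test_function_props(6)[OF \<psi>] test_function_props(6)[OF dp(1)] test_function_props(6)[OF dp(2)]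
    by simp
qed

text \<open>Telescoping along the segment reduces a translation to an infinitesimal one.\<close>

lemma translation_estimate:
  fixes \<phi> :: "real ^ 'n \<Rightarrow> real"
  assumes "\<phi> \<in> test_functions \<Omega>"
  shows "norm (abs_l2 (\<lambda>x. \<phi> (h + x)) - abs_l2 \<phi>) \<le> norm h * (\<Sum>i\<in>UNIV. norm (abs_l2 (partial_d i \<phi>)))"
proof -
  let ?q = "difference_quotient h \<phi>" and ?D = "directional_derivative h \<phi>"
  note dq = difference_quotients_converge[OF assms, where h = "h"]
  note sq = dq(2,3)
  note \<phi> = test_function_props(3)[OF assms] test_function_props(8)[OF assms]
  have T: "square_integrable (\<lambda>x. \<phi> (s + x))" for s by (rule square_integrable_translate[OF \<phi>])
  have "norm (abs_l2 (\<lambda>x. \<phi> (h + x)) - abs_l2 \<phi>) \<le> norm (abs_l2 (?q k))" for k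
  proof -
    define s where "s = inverse (real (Suc k)) *\<^sub>R h"
    have step: "norm (abs_l2 (\<lambda>x. \<phi> ((real (Suc j) *\<^sub>R s) + x)) - abs_l2 (\<lambda>x. \<phi> ((real j *\<^sub>R s) + x)))
        = norm (abs_l2 (\<lambda>x. \<phi> (s + x) - \<phi> x))" for j
    proof -
      have "abs_l2 (\<lambda>x. \<phi> ((real (Suc j) *\<^sub>R s) + x)) - abs_l2 (\<lambda>x. \<phi> ((real j *\<^sub>R s) + x))
          = abs_l2 (\<lambda>x. \<phi> (s + (real j *\<^sub>R s + x)) - \<phi> (real j *\<^sub>R s + x))"
        using abs_l2_diff[OF T T, of "real (Suc j) *\<^sub>R s" "real j *\<^sub>R s"] by (simp add: algebra_simps)
      moreover have "(\<lambda>x. \<phi> (s + x) - \<phi> x) \<in> borel_measurable borel" using \<phi>(1) by measurable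
      ultimately show ?thesis
        using norm_translate[OF _ square_integrable_diff[OF T[of s] \<phi>(2)], of "real j *\<^sub>R s"] by simp
    qed
    have tel: "norm (abs_l2 (\<lambda>x. \<phi> (real n *\<^sub>R s + x)) - abs_l2 \<phi>) \<le> real n * norm (abs_l2 (\<lambda>x. \<phi> (s + x) - \<phi> x))" for n
    proof (induction n)
      case (Suc n)
      have "norm (abs_l2 (\<lambda>x. \<phi> (real (Suc n) *\<^sub>R s + x)) - abs_l2 \<phi>)
          \<le> norm (abs_l2 (\<lambda>x. \<phi> (real (Suc n) *\<^sub>R s + x)) - abs_l2 (\<lambda>x. \<phi> (real n *\<^sub>R s + x)))
           + norm (abs_l2 (\<lambda>x. \<phi> (real n *\<^sub>R s + x)) - abs_l2 \<phi>)"
        using norm_triangle_ineq[of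
          "abs_l2 (\<lambda>x. \<phi> (real (Suc n) *\<^sub>R s + x)) - abs_l2 (\<lambda>x. \<phi> (real n *\<^sub>R s + x))"
          "abs_l2 (\<lambda>x. \<phi> (real n *\<^sub>R s + x)) - abs_l2 \<phi>"] by (simp only: diff_add_cancel add_diff_eq)
      with Suc show ?case unfolding step by (simp add: algebra_simps)
    qed simp
    have "norm (abs_l2 (?q k)) = real (Suc k) * norm (abs_l2 (\<lambda>x. \<phi> (s + x) - \<phi> x))"
    proof -
      have "abs_l2 (?q k) = real (Suc k) *\<^sub>R abs_l2 (\<lambda>x. \<phi> (s + x) - \<phi> x)"
        unfolding difference_quotient_def[abs_def] s_def
        by (subst scaleR_l2.abs_eq) (use square_integrable_diff[OF T \<phi>(2)] in auto)
      then show ?thesis by (simp del: of_nat_Suc)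
    qed
    moreover have "real (Suc k) *\<^sub>R s = h" by (simp add: s_def del: of_nat_Suc)
    ultimately show ?thesis using tel[of "Suc k"] by simp
  qed
  then have "norm (abs_l2 (\<lambda>x. \<phi> (h + x)) - abs_l2 \<phi>) \<le> norm (abs_l2 ?D)"
    using tendsto_norm[OF dq(4)]
    by (intro LIMSEQ_le_const) auto
  also have "abs_l2 ?D = (\<Sum>j\<in>UNIV. h $ j *\<^sub>R abs_l2 (partial_d j \<phi>))"
  proof -
    have p: "square_integrable (partial_d j \<phi>)" for j
      by (rule test_function_props(8)[OF partial_d_test_function[OF assms]])
    have "abs_l2 (\<lambda>x. h $ j * partial_d j \<phi> x) = h $ j *\<^sub>R abs_l2 (partial_d j \<phi>)" for j
      by (simp add: scaleR_l2.abs_eq p)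
    then show ?thesis
      using abs_l2_sum[of "\<lambda>j x. h $ j * partial_d j \<phi> x" UNIV] p
      by (simp add: directional_derivative_def[abs_def] square_integrable_scaleR)
  qed
  also have "norm \<dots> \<le> (\<Sum>j\<in>UNIV. norm h * norm (abs_l2 (partial_d j \<phi>)))"
    by (rule sum_norm_le) (simp add: component_le_norm_cart mult_right_mono)
  finally show ?thesis by (simp add: sum_distrib_left)
qed

section \<open>Sobolev spaces\<close>

lemma has_weak_pd_iff:
  assumes "open \<Omega>"
  shows "has_weak_pd \<Omega> i u w \<longleftrightarrow> u \<in> L2 \<Omega> \<and> w \<in> L2 \<Omega> \<and>
    (\<forall>\<phi>\<in>test_functions \<Omega>. inner (l2_of \<Omega> u) (l2_of \<Omega> (partial_d i \<phi>)) = - inner (l2_of \<Omega> w) (l2_of \<Omega> \<phi>))"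
  unfolding has_weak_pd_def
  using inner_l2_of[OF assms] test_function_L2(1)[OF assms] partial_d_test_function by metis

text \<open>By uniqueness the chosen weak derivative depends linearly on the function, up to null sets.\<close>

lemma has_weak_pd_unique:
  assumes "open \<Omega>" "has_weak_pd \<Omega> i u w" "has_weak_pd \<Omega> i u w'"
  shows "l2_of \<Omega> w = l2_of \<Omega> w'"
proof -
  have w: "w \<in> L2 \<Omega>" "w' \<in> L2 \<Omega>" using assms by (auto simp: has_weak_pd_def)
  note d = L2_diff[OF assms(1) w]
  have "AE x in lebesgue_on \<Omega>. w x - w' x = 0"
  proof (rule fundamental_lemma_variations[OF assms(1) d(1)])
    fix \<phi> assume \<phi>: "\<phi> \<in> test_functions \<Omega>"
    have "L2_inner \<Omega> (\<lambda>x. w x - w' x) \<phi> = inner (l2_of \<Omega> w - l2_of \<Omega> w') (l2_of \<Omega> \<phi>)"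
      using inner_l2_of[OF assms(1) d(1) test_function_L2(1)[OF assms(1) \<phi>]] d(2) by simp
    also have "\<dots> = 0"
      using assms(2,3) \<phi> unfolding has_weak_pd_iff[OF assms(1)] by (simp add: inner_diff_left)
    finally show "L2_inner \<Omega> (\<lambda>x. w x - w' x) \<phi> = 0" .
  qed
  then show ?thesis using l2_of_eq_iff[OF assms(1) w] by simp
qed

lemma has_weak_pd_weak_pd: "has_weak_pd \<Omega> i u w \<Longrightarrow> has_weak_pd \<Omega> i u (weak_pd \<Omega> i u)"
  unfolding weak_pd_def by (rule someI[where P = "has_weak_pd \<Omega> i u"])

lemma H1_weak_pd:
  assumes "u \<in> H1 \<Omega>"
  shows "has_weak_pd \<Omega> i u (weak_pd \<Omega> i u)"
proof -
  obtain w where "has_weak_pd \<Omega> i u w" using assms by (auto simp: H1_def)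
  then show ?thesis by (rule has_weak_pd_weak_pd)
qed

lemma H1_L2: "u \<in> H1 \<Omega> \<Longrightarrow> u \<in> L2 \<Omega>"
  by (simp add: H1_def)

lemma weak_pd_L2: "u \<in> H1 \<Omega> \<Longrightarrow> weak_pd \<Omega> i u \<in> L2 \<Omega>"
  using H1_weak_pd[of u \<Omega> i] by (simp add: has_weak_pd_def)

lemma H1_I:
  "u \<in> L2 \<Omega> \<Longrightarrow> (\<And>i. has_weak_pd \<Omega> i u (w i)) \<Longrightarrow> u \<in> H1 \<Omega>"
  unfolding H1_def by auto

lemma l2_of_weak_pd:
  assumes "open \<Omega>" "has_weak_pd \<Omega> i u w"
  shows "l2_of \<Omega> (weak_pd \<Omega> i u) = l2_of \<Omega> w"
  by (rule has_weak_pd_unique[OF assms(1) has_weak_pd_weak_pd[OF assms(2)] assms(2)])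

text \<open>The norm of this pair is the \<open>H\<^sup>1\<close> norm, which embeds \<open>H1 \<Omega>\<close> isometrically into a Hilbert
  space.\<close>

definition h1_of :: "(real ^ 'n) set \<Rightarrow> (real ^ 'n \<Rightarrow> real) \<Rightarrow> (real ^ 'n) l2 \<times> (((real ^ 'n) l2) ^ 'n)" where
  "h1_of \<Omega> u = (l2_of \<Omega> u, \<chi> i. l2_of \<Omega> (weak_pd \<Omega> i u))"

lemma H1_norm_eq:
  assumes "open \<Omega>" "u \<in> H1 \<Omega>"
  shows "H1_norm \<Omega> u = norm (h1_of \<Omega> u)"
  by (simp add: H1_norm_def h1_of_def norm_Pair norm_vec_def L2_set_def norm_l2_of assms H1_L2 weak_pd_L2
      sum_nonneg)

lemma norm_l2_of_le_h1_of: "norm (l2_of \<Omega> u) \<le> norm (h1_of \<Omega> u)"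
  using norm_fst_le[of "l2_of \<Omega> u"] by (simp add: h1_of_def)

lemma norm_weak_pd_le_h1_of: "norm (l2_of \<Omega> (weak_pd \<Omega> i u)) \<le> norm (h1_of \<Omega> u)"
proof -
  have "norm (l2_of \<Omega> (weak_pd \<Omega> i u)) \<le> norm (snd (h1_of \<Omega> u))"
    using Finite_Cartesian_Product.norm_nth_le[of "snd (h1_of \<Omega> u)" i] by (simp add: h1_of_def)
  also have "\<dots> \<le> norm (h1_of \<Omega> u)" using norm_snd_le[of "snd (h1_of \<Omega> u)" "fst (h1_of \<Omega> u)"] by simp
  finally show ?thesis .
qed

lemma has_weak_pd_diff:
  assumes "open \<Omega>" "has_weak_pd \<Omega> i u w" "has_weak_pd \<Omega> i u' w'"
  shows "has_weak_pd \<Omega> i (\<lambda>x. u x - u' x) (\<lambda>x. w x - w' x)"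
proof -
  have L: "u \<in> L2 \<Omega>" "w \<in> L2 \<Omega>" "u' \<in> L2 \<Omega>" "w' \<in> L2 \<Omega>" using assms by (auto simp: has_weak_pd_def)
  show ?thesis
    using assms(2,3) unfolding has_weak_pd_iff[OF assms(1)]
    by (simp add: L2_diff[OF assms(1) L(1,3)] L2_diff[OF assms(1) L(2,4)] inner_diff_left)
qed

lemma H1_diff:
  assumes "open \<Omega>" "u \<in> H1 \<Omega>" "v \<in> H1 \<Omega>"
  shows "(\<lambda>x. u x - v x) \<in> H1 \<Omega>" "h1_of \<Omega> (\<lambda>x. u x - v x) = h1_of \<Omega> u - h1_of \<Omega> v"
    "l2_of \<Omega> (weak_pd \<Omega> i (\<lambda>x. u x - v x)) = l2_of \<Omega> (weak_pd \<Omega> i u) - l2_of \<Omega> (weak_pd \<Omega> i v)"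
proof -
  have pd: "has_weak_pd \<Omega> i (\<lambda>x. u x - v x) (\<lambda>x. weak_pd \<Omega> i u x - weak_pd \<Omega> i v x)" for i
    by (intro has_weak_pd_diff H1_weak_pd assms)
  show "(\<lambda>x. u x - v x) \<in> H1 \<Omega>" by (intro H1_I[OF _ pd] L2_diff H1_L2 assms)
  show w: "l2_of \<Omega> (weak_pd \<Omega> i (\<lambda>x. u x - v x)) = l2_of \<Omega> (weak_pd \<Omega> i u) - l2_of \<Omega> (weak_pd \<Omega> i v)" for i
    unfolding l2_of_weak_pd[OF assms(1) pd] by (intro L2_diff weak_pd_L2 assms)
  show "h1_of \<Omega> (\<lambda>x. u x - v x) = h1_of \<Omega> u - h1_of \<Omega> v"
    unfolding h1_of_def w L2_diff(2)[OF assms(1) H1_L2[OF assms(2)] H1_L2[OF assms(3)]]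
    by (simp add: vec_eq_iff)
qed

lemma H1_tendsto_iff:
  assumes "open \<Omega>" "\<And>k. u k \<in> H1 \<Omega>" "w \<in> H1 \<Omega>"
  shows "H1_tendsto \<Omega> u w \<longleftrightarrow> (\<lambda>k. h1_of \<Omega> (u k)) \<longlonglongrightarrow> h1_of \<Omega> w"
  unfolding H1_tendsto_def H1_norm_eq[OF assms(1) H1_diff(1)[OF assms(1,2,3)]] H1_diff(2)[OF assms(1,2,3)]
  by (simp add: LIM_zero_iff tendsto_norm_zero_iff)

lemma test_function_H1:
  assumes "open \<Omega>" "\<phi> \<in> test_functions \<Omega>"
  shows "\<phi> \<in> H1 \<Omega>" "l2_of \<Omega> (weak_pd \<Omega> i \<phi>) = abs_l2 (partial_d i \<phi>)"
proof -
  note pd = has_weak_pd_test_function[OF assms]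
  show "\<phi> \<in> H1 \<Omega>" by (rule H1_I[OF test_function_L2(1)[OF assms] pd])
  show "l2_of \<Omega> (weak_pd \<Omega> i \<phi>) = abs_l2 (partial_d i \<phi>)"
    using l2_of_weak_pd[OF assms(1) pd] test_function_L2(2)[OF assms(1) partial_d_test_function[OF assms(2)]]
    by simp
qed

text \<open>The identity that defines the weak derivative is continuous in both functions, so the graph of the
  weak gradient is closed.\<close>

lemma H1_closed:
  assumes "open \<Omega>" "\<And>k. u k \<in> H1 \<Omega>" "(\<lambda>k. h1_of \<Omega> (u k)) \<longlonglongrightarrow> z"
  obtains w where "w \<in> H1 \<Omega>" "h1_of \<Omega> w = z"
proof -
  define w where "w = rep_l2 (fst z)"
  define d where "d i = rep_l2 (snd z $ i)" for i
  have 0: "(\<lambda>k. l2_of \<Omega> (u k)) \<longlonglongrightarrow> fst z"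
    using tendsto_fst[OF assms(3)] by (simp add: h1_of_def)
  have 1: "(\<lambda>k. l2_of \<Omega> (weak_pd \<Omega> i (u k))) \<longlonglongrightarrow> snd z $ i" for i
    using tendsto_vec_nth[OF tendsto_snd[OF assms(3)], of i] by (simp add: h1_of_def)
  have L: "w \<in> L2 \<Omega>" "d i \<in> L2 \<Omega>" for i
    unfolding w_def d_def by (rule rep_l2_in_L2[OF assms(1)])+
  have w: "l2_of \<Omega> w = fst z" unfolding w_def by (rule l2_of_limit[OF assms(1) H1_L2[OF assms(2)] 0])
  have d: "l2_of \<Omega> (d i) = snd z $ i" for i
    unfolding d_def by (rule l2_of_limit[OF assms(1) weak_pd_L2[OF assms(2)] 1])
  have pd: "has_weak_pd \<Omega> i w (d i)" for i
    unfolding has_weak_pd_iff[OF assms(1)] w d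
  proof (intro conjI L ballI)
    fix \<phi> assume \<phi>: "\<phi> \<in> test_functions \<Omega>"
    have "(\<lambda>k. inner (l2_of \<Omega> (u k)) (l2_of \<Omega> (partial_d i \<phi>))) \<longlonglongrightarrow> inner (fst z) (l2_of \<Omega> (partial_d i \<phi>))"
      by (intro tendsto_intros 0)
    moreover have "(\<lambda>k. - inner (l2_of \<Omega> (weak_pd \<Omega> i (u k))) (l2_of \<Omega> \<phi>)) \<longlonglongrightarrow> - inner (snd z $ i) (l2_of \<Omega> \<phi>)"
      by (intro tendsto_intros 1)
    moreover have "inner (l2_of \<Omega> (u k)) (l2_of \<Omega> (partial_d i \<phi>)) = - inner (l2_of \<Omega> (weak_pd \<Omega> i (u k))) (l2_of \<Omega> \<phi>)" for k
      using H1_weak_pd[OF assms(2)] \<phi> unfolding has_weak_pd_iff[OF assms(1)] by blast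
    ultimately show "inner (fst z) (l2_of \<Omega> (partial_d i \<phi>)) = - inner (snd z $ i) (l2_of \<Omega> \<phi>)"
      using LIMSEQ_unique by simp
  qed
  have "h1_of \<Omega> w = z"
    by (simp add: h1_of_def w l2_of_weak_pd[OF assms(1) pd] d vec_lambda_eta prod_eq_iff)
  with H1_I[OF L(1) pd] show ?thesis by (rule that)
qed

lemma H10_H1: "u \<in> H10 \<Omega> \<Longrightarrow> u \<in> H1 \<Omega>"
  by (simp add: H10_def)

lemma H10_iff_closure:
  assumes "open \<Omega>"
  shows "u \<in> H10 \<Omega> \<longleftrightarrow> u \<in> H1 \<Omega> \<and> h1_of \<Omega> u \<in> closure (h1_of \<Omega> ` test_functions \<Omega>)"
proof (cases "u \<in> H1 \<Omega>")
  case True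
  have "(\<exists>\<phi>. (\<forall>k. \<phi> k \<in> test_functions \<Omega>) \<and> H1_tendsto \<Omega> \<phi> u) \<longleftrightarrow>
      (\<exists>\<phi>. (\<forall>k. \<phi> k \<in> test_functions \<Omega>) \<and> (\<lambda>k. h1_of \<Omega> (\<phi> k)) \<longlonglongrightarrow> h1_of \<Omega> u)"
    using H1_tendsto_iff[OF assms _ True] test_function_H1(1)[OF assms] by metis
  also have "\<dots> \<longleftrightarrow> (\<exists>x. (\<forall>n::nat. x n \<in> h1_of \<Omega> ` test_functions \<Omega>) \<and> x \<longlonglongrightarrow> h1_of \<Omega> u)" (is "?L \<longleftrightarrow> ?R")
  proof
    assume ?R
    then obtain x where x: "\<And>n::nat. x n \<in> h1_of \<Omega> ` test_functions \<Omega>" "x \<longlonglongrightarrow> h1_of \<Omega> u" by blast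
    then have "\<forall>n. \<exists>\<phi>. \<phi> \<in> test_functions \<Omega> \<and> x n = h1_of \<Omega> \<phi>" by blast
    from choice[OF this] obtain \<phi> where \<phi>: "\<And>n. \<phi> n \<in> test_functions \<Omega> \<and> x n = h1_of \<Omega> (\<phi> n)" by blast
    then have "x = (\<lambda>n. h1_of \<Omega> (\<phi> n))" by auto
    with x(2) \<phi> show ?L by (intro exI[of _ \<phi>]) simp
  qed (auto intro: exI[of _ "\<lambda>k. h1_of \<Omega> (_ k)"])
  finally show ?thesis using True by (simp add: H10_def closure_sequential)
qed (simp add: H10_def)

lemma H10_closed:
  assumes "open \<Omega>" "\<And>k. u k \<in> H10 \<Omega>" "(\<lambda>k. h1_of \<Omega> (u k)) \<longlonglongrightarrow> z"
  obtains w where "w \<in> H10 \<Omega>" "h1_of \<Omega> w = z"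
proof -
  obtain w where w: "w \<in> H1 \<Omega>" "h1_of \<Omega> w = z"
    using H1_closed[OF assms(1) H10_H1[OF assms(2)] assms(3)] by blast
  have "z \<in> closure (h1_of \<Omega> ` test_functions \<Omega>)"
    by (rule closed_sequentially[OF closed_closure _ assms(3)])
       (use assms(2) in \<open>simp add: H10_iff_closure[OF assms(1)]\<close>)
  with w have "w \<in> H10 \<Omega>" by (simp add: H10_iff_closure[OF assms(1)])
  with w show ?thesis using that by blast
qed

lemma H10_approx:
  assumes "open \<Omega>" "u \<in> H10 \<Omega>" "e > 0"
  shows "\<exists>\<phi>\<in>test_functions \<Omega>. norm (h1_of \<Omega> \<phi> - h1_of \<Omega> u) < e"
  using assms(2,3) unfolding H10_iff_closure[OF assms(1)] closure_approachable dist_norm by auto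

lemma H10_diff:
  assumes "open \<Omega>" "u \<in> H10 \<Omega>" "v \<in> H10 \<Omega>"
  shows "(\<lambda>x. u x - v x) \<in> H10 \<Omega>"
proof -
  note d = H1_diff[OF assms(1) H10_H1[OF assms(2)] H10_H1[OF assms(3)]]
  have "h1_of \<Omega> u - h1_of \<Omega> v \<in> closure (h1_of \<Omega> ` test_functions \<Omega>)"
    unfolding closure_approachable
  proof (intro allI impI)
    fix e :: real assume "e > 0"
    then obtain \<phi> \<psi> where \<phi>: "\<phi> \<in> test_functions \<Omega>" "norm (h1_of \<Omega> \<phi> - h1_of \<Omega> u) < e / 2"
      and \<psi>: "\<psi> \<in> test_functions \<Omega>" "norm (h1_of \<Omega> \<psi> - h1_of \<Omega> v) < e / 2"
      using H10_approx[OF assms(1,2), of "e/2"] H10_approx[OF assms(1,3), of "e/2"] by auto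
    have "h1_of \<Omega> (\<lambda>x. \<phi> x - \<psi> x) = h1_of \<Omega> \<phi> - h1_of \<Omega> \<psi>"
      by (intro H1_diff assms(1) test_function_H1(1) \<phi> \<psi>)
    moreover have "norm ((h1_of \<Omega> \<phi> - h1_of \<Omega> \<psi>) - (h1_of \<Omega> u - h1_of \<Omega> v)) < e"
      using norm_diff_triangle_ineq[of "h1_of \<Omega> \<phi>" "- h1_of \<Omega> \<psi>" "h1_of \<Omega> u" "- h1_of \<Omega> v"] \<phi>(2) \<psi>(2)
      by (simp add: norm_minus_commute)
    ultimately show "\<exists>y\<in>h1_of \<Omega> ` test_functions \<Omega>. dist y (h1_of \<Omega> u - h1_of \<Omega> v) < e"
      by (intro bexI[of _ "h1_of \<Omega> (\<lambda>x. \<phi> x - \<psi> x)"] imageI test_function_diff \<phi> \<psi>) (simp add: dist_norm)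
  qed
  with d show ?thesis by (simp add: H10_iff_closure[OF assms(1)])
qed

section \<open>The Rellich compactness theorem\<close>

definition ball_average :: "real \<Rightarrow> ('a::euclidean_space \<Rightarrow> real) \<Rightarrow> 'a \<Rightarrow> real" where
  "ball_average r \<phi> x = (LINT h|lborel. indicator (ball 0 r) h * \<phi> (h + x)) / measure lborel (ball (0::'a) r)"

lemma ball_average_measurable:
  assumes "\<phi> \<in> borel_measurable borel"
  shows "ball_average r \<phi> \<in> borel_measurable borel"
  unfolding ball_average_def[abs_def]
proof (intro borel_measurable_divide borel_measurable_const)
  show "(\<lambda>x. LINT h|lborel. indicator (ball 0 r) h * \<phi> (h + x)) \<in> borel_measurable borel"
  proof (rule lborel.borel_measurable_lebesgue_integral)
    note [measurable] = assms
    have "(\<lambda>z::'a \<times> 'a. (if norm (snd z) < r then 1 else 0) * \<phi> (snd z + fst z)) \<in> borel_measurable (borel \<Otimes>\<^sub>M borel)"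
      by measurable
    then show "(\<lambda>(x, h). indicator (ball 0 r) h * \<phi> (h + x)) \<in> borel_measurable (borel \<Otimes>\<^sub>M lborel)"
      by (simp add: split_beta' indicator_def of_bool_def cong: measurable_cong_sets)
  qed
qed

text \<open>For a fixed radius the average at a point is a fixed functional, so that weak convergence gives
  pointwise convergence of the averages.\<close>

lemma ball_average_inner:
  fixes \<phi> :: "'a::euclidean_space \<Rightarrow> real"
  assumes "\<phi> \<in> borel_measurable borel" "square_integrable \<phi>"
  shows "ball_average r \<phi> x = inner (abs_l2 \<phi>) (abs_l2 (indicator (ball x r))) / measure lborel (ball (0::'a) r)"
proof -
  have I: "square_integrable (indicator (ball x r) :: 'a \<Rightarrow> real)"
    using square_integrable_indicator[of "ball x r" 1] by simp
  have "(LINT h|lborel. indicator (ball 0 r) h * \<phi> (h + x))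
      = (LINT h|lebesgue. indicator (ball x r) (x + h) * \<phi> (x + h))"
  proof (subst integral_completion)
    have "(\<lambda>h. indicator (ball x r) h * \<phi> h) \<in> borel_measurable borel"
      by (intro borel_measurable_times borel_measurable_indicator assms(1)) simp
    moreover have "(+) x \<in> borel_measurable borel" by measurable
    ultimately have "(\<lambda>h. indicator (ball x r) (x + h) * \<phi> (x + h)) \<in> borel_measurable borel"
      by (rule measurable_compose[rotated])
    then
    show "(\<lambda>h. indicator (ball x r) (x + h) * \<phi> (x + h)) \<in> borel_measurable lborel" by simp
    show "(LINT h|lborel. indicator (ball 0 r) h * \<phi> (h + x)) = (LINT h|lborel. indicator (ball x r) (x + h) * \<phi> (x + h))"
      by (rule Bochner_Integration.integral_cong) (auto simp: indicator_def dist_norm add.commute)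
  qed
  also have "\<dots> = (LINT h|lebesgue. indicator (ball x r) h * \<phi> h)"
    by (rule integral_lebesgue_translate[of "\<lambda>h. indicator (ball x r) h * \<phi> h"])
       (intro borel_measurable_times borel_measurable_indicator assms(1), simp)
  also have "\<dots> = inner (abs_l2 \<phi>) (abs_l2 (indicator (ball x r)))"
    unfolding inner_abs_l2[OF assms(2) I] by (simp add: mult.commute)
  finally show ?thesis by (simp add: ball_average_def)
qed


text \<open>The Cauchy--Schwarz inequality and Tonelli's theorem bound the distance of a function to its ball averages
  by its distances to small translates.\<close>

lemma ball_average_estimate:
  fixes \<phi> :: "real ^ 'n \<Rightarrow> real"
  assumes "\<phi> \<in> test_functions \<Omega>" "r > 0"
  defines "G \<equiv> (\<Sum>i\<in>UNIV. norm (abs_l2 (partial_d i \<phi>)))"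
  shows "square_integrable (ball_average r \<phi>)"
    "norm (abs_l2 (ball_average r \<phi>) - abs_l2 \<phi>) \<le> r * G"
proof -
  note \<phi> = test_function_props(3)[OF assms(1)] test_function_props(8)[OF assms(1)]
  note [measurable] = \<phi>(1)
  define V where "V = measure lborel (ball (0::real^'n) r)"
  have V: "V > 0" unfolding V_def using content_ball_pos[OF assms(2), of 0] by simp
  have em: "emeasure lborel (ball (0::real^'n) r) = ennreal V"
    unfolding V_def by (rule emeasure_eq_ennreal_measure) (metis emeasure_lborel_ball_finite infinity_ennreal_def less_irrefl)
  have G: "G \<ge> 0" unfolding G_def by (simp add: sum_nonneg)
  define I where "I h = (if norm h < r then 1 else 0 :: real)" for h :: "real ^ 'n"
  let ?F = "\<lambda>x h. ennreal (I h * (\<phi> (h + x) - \<phi> x)\<^sup>2)"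
  have Iind: "I h = indicator (ball 0 r) h" for h by (simp add: I_def indicator_def)
  have [measurable]: "I \<in> borel_measurable borel" unfolding I_def[abs_def] by measurable
  have Isq: "square_integrable I"
    using square_integrable_indicator[of "ball 0 r" 1] by (simp add: Iind[abs_def])
  have T: "square_integrable (\<lambda>h. \<phi> (h + x))" for x
    using square_integrable_translate[OF \<phi>, of x] by (simp add: add.commute)
  have pt: "ennreal ((ball_average r \<phi> x - \<phi> x)\<^sup>2) \<le> ennreal (inverse V) * (\<integral>\<^sup>+h. ?F x h \<partial>lborel)" for x
  proof -
    define f where "f h = I h * \<phi> (h + x) - \<phi> x * I h" for h
    have s1: "square_integrable (\<lambda>h. I h * \<phi> (h + x))"
      by (rule square_integrable_bound[OF T[of x] borel_measurable_times[OF
            square_integrable_measurable[OF Isq] square_integrable_measurable[OF T[of x]]]])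
         (simp add: I_def)
    have f: "square_integrable f"
      unfolding f_def[abs_def] by (intro square_integrable_diff s1 square_integrable_scaleR Isq)
    have II: "(LINT h|lebesgue. I h * I h) = V"
    proof -
      have "(LINT h|lebesgue. I h * I h) = (LINT h|lebesgue. indicator (ball (0::real ^ 'n) r) h)"
        by (rule Bochner_Integration.integral_cong) (auto simp: Iind indicator_def)
      also have "\<dots> = V" by (simp add: V_def)
      finally show ?thesis .
    qed
    have i1: "(LINT h|lebesgue. f h * I h) = V * (ball_average r \<phi> x - \<phi> x)"
    proof -
      have "(LINT h|lebesgue. f h * I h) = (LINT h|lebesgue. I h * \<phi> (h + x) - \<phi> x * (I h * I h))"
        by (rule Bochner_Integration.integral_cong) (auto simp: f_def I_def)
      also have "\<dots> = (LINT h|lebesgue. I h * \<phi> (h + x)) - \<phi> x * V"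
        using square_integrable_mult_integrable[OF Isq T, of x] square_integrable_mult_integrable[OF Isq Isq]
        by (subst Bochner_Integration.integral_diff) (auto simp: II)
      also have "(LINT h|lebesgue. I h * \<phi> (h + x)) = (LINT h|lborel. I h * \<phi> (h + x))"
        by (rule integral_completion) measurable
      also have "\<dots> = V * ball_average r \<phi> x"
        using V by (simp add: ball_average_def Iind V_def)
      finally show ?thesis by (simp add: algebra_simps)
    qed
    have "(V * (ball_average r \<phi> x - \<phi> x))\<^sup>2 = (inner (abs_l2 f) (abs_l2 I))\<^sup>2"
      by (simp add: inner_abs_l2 f Isq i1)
    also have "\<dots> \<le> inner (abs_l2 f) (abs_l2 f) * inner (abs_l2 I) (abs_l2 I)"
      by (rule Cauchy_Schwarz_ineq)
    also have "\<dots> = (norm (abs_l2 f))\<^sup>2 * V"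
      by (simp add: inner_abs_l2 f Isq II power2_norm_eq_inner)
    finally have "V * (V * (ball_average r \<phi> x - \<phi> x)\<^sup>2) \<le> V * (norm (abs_l2 f))\<^sup>2"
      by (simp only: power2_eq_square mult_ac)
    then have "V * (ball_average r \<phi> x - \<phi> x)\<^sup>2 \<le> (norm (abs_l2 f))\<^sup>2"
      using V by (simp only: mult_le_cancel_left_pos)
    then have "inverse V * (V * (ball_average r \<phi> x - \<phi> x)\<^sup>2) \<le> inverse V * (norm (abs_l2 f))\<^sup>2"
      using V by (intro mult_left_mono) auto
    then have "(ball_average r \<phi> x - \<phi> x)\<^sup>2 \<le> inverse V * (norm (abs_l2 f))\<^sup>2"
      using V by (simp flip: mult.assoc)
    then have "ennreal ((ball_average r \<phi> x - \<phi> x)\<^sup>2) \<le> ennreal (inverse V) * ennreal ((norm (abs_l2 f))\<^sup>2)"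
      using V by (simp add: ennreal_leI flip: ennreal_mult)
    also have "ennreal ((norm (abs_l2 f))\<^sup>2) = (\<integral>\<^sup>+h. ennreal ((f h)\<^sup>2) \<partial>lborel)"
      using nn_integral_square_abs_l2[OF f] by (simp add: nn_integral_completion)
    also have "\<dots> = (\<integral>\<^sup>+h. ?F x h \<partial>lborel)"
      by (rule nn_integral_cong) (simp add: f_def I_def)
    finally show ?thesis .
  qed
  have "(\<integral>\<^sup>+x. ennreal ((ball_average r \<phi> x - \<phi> x)\<^sup>2) \<partial>lborel)
      \<le> (\<integral>\<^sup>+x. ennreal (inverse V) * (\<integral>\<^sup>+h. ?F x h \<partial>lborel) \<partial>lborel)"
    by (rule nn_integral_mono) (rule pt)
  also have "\<dots> = ennreal (inverse V) * (\<integral>\<^sup>+x. (\<integral>\<^sup>+h. ?F x h \<partial>lborel) \<partial>lborel)"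
    by (rule nn_integral_cmult) measurable
  finally have le1: "(\<integral>\<^sup>+x. ennreal ((ball_average r \<phi> x - \<phi> x)\<^sup>2) \<partial>lborel)
      \<le> ennreal (inverse V) * (\<integral>\<^sup>+x. (\<integral>\<^sup>+h. ?F x h \<partial>lborel) \<partial>lborel)" .
  have "(\<integral>\<^sup>+x. (\<integral>\<^sup>+h. ?F x h \<partial>lborel) \<partial>lborel)
      = (\<integral>\<^sup>+h. (\<integral>\<^sup>+x. ?F x h \<partial>lborel) \<partial>lborel)"
    by (rule lborel_pair.Fubini') measurable
  also have "\<dots> \<le> (\<integral>\<^sup>+h. ennreal ((r * G)\<^sup>2) * indicator (ball (0::real ^ 'n) r) h \<partial>lborel)"
  proof (rule nn_integral_mono)
    fix h :: "real ^ 'n"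
    show "(\<integral>\<^sup>+x. ?F x h \<partial>lborel) \<le> ennreal ((r * G)\<^sup>2) * indicator (ball 0 r) h"
    proof (cases "norm h < r")
      case True
      have d: "square_integrable (\<lambda>x. \<phi> (h + x) - \<phi> x)"
        by (intro square_integrable_diff square_integrable_translate \<phi>)
      have "(\<integral>\<^sup>+x. ?F x h \<partial>lborel) = (\<integral>\<^sup>+x. ennreal ((\<phi> (h + x) - \<phi> x)\<^sup>2) \<partial>lebesgue)"
        using True by (simp add: I_def nn_integral_completion)
      also have "\<dots> = ennreal ((norm (abs_l2 (\<lambda>x. \<phi> (h + x)) - abs_l2 \<phi>))\<^sup>2)"
        unfolding nn_integral_square_abs_l2[OF d] abs_l2_diff[OF square_integrable_translate[OF \<phi>] \<phi>(2)] ..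
      also have "\<dots> \<le> ennreal ((r * G)\<^sup>2)"
      proof (intro ennreal_leI power_mono norm_ge_zero)
        have "norm (abs_l2 (\<lambda>x. \<phi> (h + x)) - abs_l2 \<phi>) \<le> norm h * G"
          unfolding G_def by (rule translation_estimate[OF assms(1)])
        also have "\<dots> \<le> r * G" using True G by (intro mult_right_mono) auto
        finally show "norm (abs_l2 (\<lambda>x. \<phi> (h + x)) - abs_l2 \<phi>) \<le> r * G" .
      qed
      finally show ?thesis using True by (simp add: indicator_def)
    qed (simp add: I_def)
  qed
  also have "\<dots> = ennreal ((r * G)\<^sup>2) * ennreal V" by (simp add: em nn_integral_cmult_indicator)
  finally have "ennreal (inverse V) * (\<integral>\<^sup>+x. (\<integral>\<^sup>+h. ?F x h \<partial>lborel) \<partial>lborel)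
      \<le> ennreal (inverse V) * (ennreal ((r * G)\<^sup>2) * ennreal V)"
    by (rule mult_left_mono) simp
  also have "\<dots> = ennreal (inverse V * ((r * G)\<^sup>2 * V))"
    using V by (simp add: ennreal_mult)
  also have "inverse V * ((r * G)\<^sup>2 * V) = (r * G)\<^sup>2" using V by simp
  finally have le: "(\<integral>\<^sup>+x. ennreal ((ball_average r \<phi> x - \<phi> x)\<^sup>2) \<partial>lebesgue) \<le> ennreal ((r * G)\<^sup>2)"
    using le1 by (simp add: nn_integral_completion)
  have m: "(\<lambda>x. ball_average r \<phi> x - \<phi> x) \<in> borel_measurable lebesgue"
    using borel_measurable_diff[OF ball_average_measurable[OF \<phi>(1)] \<phi>(1)] by (simp add: measurable_completion)
  have "integrable lebesgue (\<lambda>x. (ball_average r \<phi> x - \<phi> x)\<^sup>2)"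
    by (rule integrableI_nonneg) (use m le in \<open>auto simp: less_top[symmetric] top_unique\<close>)
  with m have d: "square_integrable (\<lambda>x. ball_average r \<phi> x - \<phi> x)" by (simp add: square_integrable_def)
  show b: "square_integrable (ball_average r \<phi>)"
    using square_integrable_add[OF d \<phi>(2)] by simp
  have "(norm (abs_l2 (ball_average r \<phi>) - abs_l2 \<phi>))\<^sup>2 \<le> (r * G)\<^sup>2"
    using le unfolding nn_integral_square_abs_l2[OF d] abs_l2_diff[OF b \<phi>(2)] by simp
  then show "norm (abs_l2 (ball_average r \<phi>) - abs_l2 \<phi>) \<le> r * G"
    by (rule power2_le_imp_le) (use G assms(2) in simp)
qed


text \<open>Along a weakly convergent subsequence the ball averages of a fixed radius converge pointwise, with a
  common bound and inside a common ball, hence in \<open>L\<^sup>2\<close>. The averages differ from the functions by at most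
  the radius times the bound on the gradients, uniformly along the sequence.\<close>

lemma rellich_test_functions:
  fixes \<Omega> :: "(real ^ 'n) set"
  assumes "open \<Omega>" "bounded \<Omega>" and \<phi>: "\<And>k. \<phi> k \<in> test_functions \<Omega>"
    and B: "\<And>k. norm (h1_of \<Omega> (\<phi> k)) \<le> B"
  obtains s where "strict_mono (s::nat \<Rightarrow> nat)" "Cauchy (\<lambda>k. abs_l2 (\<phi> (s k)))"
proof -
  have B0: "B \<ge> 0" using order_trans[OF norm_ge_zero B] .
  have u: "norm (abs_l2 (\<phi> k)) \<le> B" for k
    using norm_l2_of_le_h1_of[of \<Omega> "\<phi> k"] B[of k] test_function_L2(2)[OF assms(1) \<phi>] by (metis order_trans)
  have g: "(\<Sum>i\<in>UNIV. norm (abs_l2 (partial_d i (\<phi> k)))) \<le> real CARD('n) * B" for k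
  proof -
    have "norm (abs_l2 (partial_d i (\<phi> k))) \<le> B" for i
      using norm_weak_pd_le_h1_of[of \<Omega> i "\<phi> k"] B[of k] test_function_H1(2)[OF assms(1) \<phi>] by (metis order_trans)
    then show ?thesis using sum_mono[of UNIV "\<lambda>i. norm (abs_l2 (partial_d i (\<phi> k)))" "\<lambda>i. B"] by simp
  qed
  have "bounded (range (\<lambda>k. abs_l2 (\<phi> k)))" by (rule boundedI[of _ B]) (auto intro: u)
  then obtain s p where s: "strict_mono (s::nat\<Rightarrow>nat)"
    and weak: "\<And>h. (\<lambda>k. inner (abs_l2 (\<phi> (s k))) h) \<longlonglongrightarrow> inner p h"
    by (rule bounded_weakly_convergent_subseq) blast
  obtain R where R: "\<And>x. x \<in> \<Omega> \<Longrightarrow> norm x \<le> R" using assms(2) by (auto simp: bounded_iff)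
  have conv: "Cauchy (\<lambda>k. abs_l2 (ball_average r (\<phi> (s k))))" if "r > 0" for r
  proof -
    define V where "V = measure lborel (ball (0::real^'n) r)"
    have V: "V > 0" unfolding V_def using content_ball_pos[OF that, of 0] by simp
    note \<phi>m = test_function_props(3)[OF \<phi>] and \<phi>s = test_function_props(8)[OF \<phi>]
    have eq: "ball_average r (\<phi> k) x = inner (abs_l2 (\<phi> k)) (abs_l2 (indicator (ball x r))) / V" for k x
      unfolding V_def by (rule ball_average_inner[OF \<phi>m \<phi>s])
    have lim: "(\<lambda>k. ball_average r (\<phi> (s k)) x) \<longlonglongrightarrow> inner p (abs_l2 (indicator (ball x r))) / V" for x
      unfolding eq by (intro tendsto_intros weak) (use V in simp)
    define f where "f x = lim (\<lambda>k. ball_average r (\<phi> (s k)) x)" for x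
    have m: "ball_average r (\<phi> (s k)) \<in> borel_measurable lebesgue" for k
      using ball_average_measurable[OF \<phi>m] by (simp add: measurable_completion)
    have fm: "f \<in> borel_measurable lebesgue"
      unfolding f_def[abs_def] by (intro borel_measurable_lim_metric m)
    have nb: "norm (abs_l2 (indicator (ball x r) :: real ^ 'n \<Rightarrow> real)) = sqrt V" for x :: "real ^ 'n"
    proof -
      have I: "square_integrable (indicator (ball x r) :: real ^ 'n \<Rightarrow> real)"
        using square_integrable_indicator[of "ball x r" 1] by simp
      have "(LINT z|lebesgue. (indicator (ball x r) z :: real)\<^sup>2) = (LINT z|lebesgue. indicator (ball x r) z)"
        by (rule Bochner_Integration.integral_cong) (auto simp: indicator_def)
      also have "\<dots> = measure lborel (ball x r)" by simp
      also have "\<dots> = V" unfolding V_def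
        using content_ball_conv_unit_ball[of r x] content_ball_conv_unit_ball[of r "0 :: real ^ 'n"] that
        by simp
      finally have "(norm (abs_l2 (indicator (ball x r) :: real ^ 'n \<Rightarrow> real)))\<^sup>2 = V"
        by (simp add: norm_abs_l2 I)
      then show ?thesis by (metis norm_ge_zero real_sqrt_unique)
    qed
    define C where "C = B * sqrt V / V"
    have bd: "\<bar>ball_average r (\<phi> (s k)) x\<bar> \<le> C * indicator (cball 0 (R + r)) x" for k x
    proof (cases "x \<in> cball 0 (R + r)")
      case True
      have "\<bar>inner (abs_l2 (\<phi> (s k))) (abs_l2 (indicator (ball x r)))\<bar> \<le> B * sqrt V"
        by (rule order_trans[OF Cauchy_Schwarz_ineq2]) (simp add: nb mult_right_mono u V less_imp_le)
      then show ?thesis using True V by (simp add: eq C_def divide_right_mono)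
    next
      case False
      have z: "indicator (ball 0 r) h * \<phi> (s k) (h + x) = 0" for h
      proof (cases "norm h < r")
        case True
        then have "norm (h + x) > R" using False norm_diff_ineq[of x h] by (simp add: add.commute)
        then show ?thesis using R test_function_props(5)[OF \<phi>] by force
      qed (simp add: indicator_def)
      have "ball_average r (\<phi> (s k)) x = 0" unfolding ball_average_def z by simp
      then show ?thesis using False by simp
    qed
    have S: "square_integrable (\<lambda>x::real^'n. C * indicator (cball 0 (R + r)) x)"
      by (rule square_integrable_indicator) simp
    have lim': "(\<lambda>k. ball_average r (\<phi> (s k)) x) \<longlonglongrightarrow> f x" for x
      unfolding f_def using lim[of x] by (simp add: limI)
    show ?thesis
      by (rule LIMSEQ_imp_Cauchy, rule l2_dominated_convergence(3)[OF S m fm])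
         (intro always_eventually allI lim' bd)+
  qed
  have "Cauchy (\<lambda>k. abs_l2 (\<phi> (s k)))"
  proof (rule metric_CauchyI)
    fix e :: real assume e: "e > 0"
    define G where "G = real CARD('n) * B"
    have G: "G \<ge> 0" using B0 by (simp add: G_def)
    define r where "r = e / (4 * (G + 1))"
    have r: "r > 0" using e G by (simp add: r_def)
    have "r * G \<le> r * (G + 1)" using r by simp
    also have "\<dots> = e / 4" using G by (simp add: r_def field_simps)
    finally have rG: "r * G \<le> e / 4" .
    have av: "norm (abs_l2 (ball_average r (\<phi> k)) - abs_l2 (\<phi> k)) \<le> e / 4" for k
    proof -
      have "norm (abs_l2 (ball_average r (\<phi> k)) - abs_l2 (\<phi> k)) \<le> r * (\<Sum>i\<in>UNIV. norm (abs_l2 (partial_d i (\<phi> k))))"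
        by (rule ball_average_estimate(2)[OF \<phi> r])
      also have "\<dots> \<le> r * G" unfolding G_def using g r by (intro mult_left_mono) auto
      finally show ?thesis using rG by simp
    qed
    obtain M where M: "\<And>m n. m \<ge> M \<Longrightarrow> n \<ge> M \<Longrightarrow>
        dist (abs_l2 (ball_average r (\<phi> (s m)))) (abs_l2 (ball_average r (\<phi> (s n)))) < e / 4"
      using metric_CauchyD[OF conv[OF r], of "e / 4"] e by auto
    have "dist (abs_l2 (\<phi> (s m))) (abs_l2 (\<phi> (s n))) < e" if "m \<ge> M" "n \<ge> M" for m n
    proof -
      let ?a = "\<lambda>k. abs_l2 (\<phi> (s k))" and ?t = "\<lambda>k. abs_l2 (ball_average r (\<phi> (s k)))"
      have "dist (?a m) (?a n) \<le> dist (?a m) (?t m) + dist (?t m) (?t n) + dist (?t n) (?a n)"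
        using dist_triangle[of "?a m" "?a n" "?t m"] dist_triangle[of "?t m" "?a n" "?t n"] by linarith
      moreover have "dist (?a m) (?t m) \<le> e / 4" "dist (?t n) (?a n) \<le> e / 4"
        using av[of "s m"] av[of "s n"] by (simp_all add: dist_norm norm_minus_commute)
      ultimately show ?thesis using M[OF that] e by linarith
    qed
    then show "\<exists>M. \<forall>m\<ge>M. \<forall>n\<ge>M. dist (abs_l2 (\<phi> (s m))) (abs_l2 (\<phi> (s n))) < e" by blast
  qed
  with s show ?thesis by (rule that)
qed

text \<open>The sequence is replaced by test functions whose \<open>H\<^sup>1\<close> distances from it
  tend to zero.\<close>

theorem rellich:
  fixes \<Omega> :: "(real ^ 'n) set"
  assumes "open \<Omega>" "bounded \<Omega>" and u: "\<And>k. u k \<in> H10 \<Omega>"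
    and B: "\<And>k. norm (h1_of \<Omega> (u k)) \<le> B"
  obtains s where "strict_mono (s::nat \<Rightarrow> nat)" "Cauchy (\<lambda>k. l2_of \<Omega> (u (s k)))"
proof -
  have "\<exists>\<phi>\<in>test_functions \<Omega>. norm (h1_of \<Omega> \<phi> - h1_of \<Omega> (u k)) < inverse (real (Suc k))" for k
    by (rule H10_approx[OF assms(1) u]) simp
  then obtain \<phi> where \<phi>: "\<And>k. \<phi> k \<in> test_functions \<Omega>"
    and d: "\<And>k. norm (h1_of \<Omega> (\<phi> k) - h1_of \<Omega> (u k)) < inverse (real (Suc k))" by metis
  have b: "norm (h1_of \<Omega> (\<phi> k)) \<le> B + 1" for k
  proof -
    have "inverse (real (Suc k)) \<le> 1" by (simp add: field_simps)
    then show ?thesis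
      using norm_triangle_sub[of "h1_of \<Omega> (\<phi> k)" "h1_of \<Omega> (u k)"] B[of k] d[of k] by linarith
  qed
  obtain s where s: "strict_mono (s::nat\<Rightarrow>nat)" "Cauchy (\<lambda>k. abs_l2 (\<phi> (s k)))"
    by (rule rellich_test_functions[OF assms(1,2) \<phi> b])
  have "(\<lambda>k. norm (l2_of \<Omega> (u k) - abs_l2 (\<phi> k))) \<longlonglongrightarrow> 0"
  proof (rule tendsto_sandwich[OF _ _ tendsto_const LIMSEQ_inverse_real_of_nat])
    have "norm (l2_of \<Omega> (u k) - abs_l2 (\<phi> k)) \<le> inverse (real (Suc k))" for k
    proof -
      have "norm (l2_of \<Omega> (\<phi> k) - l2_of \<Omega> (u k)) = norm (fst (h1_of \<Omega> (\<phi> k) - h1_of \<Omega> (u k)))"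
        by (simp add: h1_of_def)
      also have "\<dots> \<le> norm (h1_of \<Omega> (\<phi> k) - h1_of \<Omega> (u k))"
        using norm_fst_le[of "fst (h1_of \<Omega> (\<phi> k) - h1_of \<Omega> (u k))" "snd (h1_of \<Omega> (\<phi> k) - h1_of \<Omega> (u k))"]
        by (simp only: prod.collapse)
      finally show ?thesis
        using d[of k] test_function_L2(2)[OF assms(1) \<phi>[of k]] by (simp add: norm_minus_commute)
    qed
    then show "\<forall>\<^sub>F k in sequentially. norm (l2_of \<Omega> (u k) - abs_l2 (\<phi> k)) \<le> inverse (real (Suc k))" by simp
  qed simp
  from LIMSEQ_subseq_LIMSEQ[OF tendsto_norm_zero_cancel[OF this] s(1)]
  have 0: "(\<lambda>k. l2_of \<Omega> (u (s k)) - abs_l2 (\<phi> (s k))) \<longlonglongrightarrow> 0" by (simp add: o_def)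
  obtain l where "(\<lambda>k. abs_l2 (\<phi> (s k))) \<longlonglongrightarrow> l"
    using s(2) Cauchy_convergent_iff convergent_def by blast
  from tendsto_add[OF 0 this] have "(\<lambda>k. l2_of \<Omega> (u (s k))) \<longlonglongrightarrow> l" by simp
  then show ?thesis by (intro that[OF s(1)] LIMSEQ_imp_Cauchy)
qed

section \<open>Weak convergence of functions\<close>

lemma L2_scale:
  assumes "open \<Omega>" "u \<in> L2 \<Omega>"
  shows "(\<lambda>x. r * u x) \<in> L2 \<Omega>" "l2_of \<Omega> (\<lambda>x. r * u x) = r *\<^sub>R l2_of \<Omega> u"
  using assms square_integrable_scaleR[of "\<lambda>x. indicator \<Omega> x * u x" r]
  by (simp_all add: L2_iff_square_integrable l2_of_def scaleR_l2.abs_eq mult.left_commute)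

lemma L2_zero: "open \<Omega> \<Longrightarrow> (\<lambda>x. 0) \<in> L2 \<Omega>" "l2_of \<Omega> (\<lambda>x. 0) = 0"
  by (simp_all add: L2_iff_square_integrable l2_of_def zero_l2.abs_eq)

lemma L2_weakly_tendsto_iff:
  assumes "open \<Omega>" "\<And>k. u k \<in> L2 \<Omega>" "w \<in> L2 \<Omega>"
  shows "L2_weakly_tendsto \<Omega> u w \<longleftrightarrow> (\<forall>h. (\<lambda>k. inner (l2_of \<Omega> (u k)) h) \<longlonglongrightarrow> inner (l2_of \<Omega> w) h)"
proof -
  have rep: "inner (l2_of \<Omega> v) h = L2_inner \<Omega> v (rep_l2 h)" if "v \<in> L2 \<Omega>" for v h
    using inner_l2_of_right[OF assms(1) that, of h] by (simp add: inner_commute L2_inner_def mult.commute)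
  show ?thesis
    unfolding L2_weakly_tendsto_def rep[OF assms(2)] rep[OF assms(3)]
  proof (intro iffI allI ballI)
    fix h assume "\<forall>h\<in>L2 \<Omega>. (\<lambda>k. L2_inner \<Omega> (u k) h) \<longlonglongrightarrow> L2_inner \<Omega> w h"
    then show "(\<lambda>k. L2_inner \<Omega> (u k) (rep_l2 h)) \<longlonglongrightarrow> L2_inner \<Omega> w (rep_l2 h)"
      using rep_l2_in_L2[OF assms(1)] by blast
  next
    fix h assume *: "\<forall>h. (\<lambda>k. L2_inner \<Omega> (u k) (rep_l2 h)) \<longlonglongrightarrow> L2_inner \<Omega> w (rep_l2 h)"
      and h: "h \<in> L2 \<Omega>"
    have "L2_inner \<Omega> v (rep_l2 (l2_of \<Omega> h)) = L2_inner \<Omega> v h" if "v \<in> L2 \<Omega>" for v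
      using rep[OF that] inner_l2_of[OF assms(1) that h] by simp
    then show "(\<lambda>k. L2_inner \<Omega> (u k) h) \<longlonglongrightarrow> L2_inner \<Omega> w h"
      using spec[OF *, of "l2_of \<Omega> h"] assms(2,3) by simp
  qed
qed

lemma L2_bounded_weakly_convergent_subseq:
  assumes "open \<Omega>" "\<And>k. u k \<in> L2 \<Omega>" "\<And>k. norm (l2_of \<Omega> (u k)) \<le> B"
  obtains s w where "strict_mono (s::nat \<Rightarrow> nat)" "w \<in> L2 \<Omega>" "L2_weakly_tendsto \<Omega> (u \<circ> s) w"
proof -
  have "bounded (range (\<lambda>k. l2_of \<Omega> (u k)))" by (rule boundedI[of _ B]) (use assms(3) in auto)
  then obtain s p where s: "strict_mono (s::nat\<Rightarrow>nat)"
    and weak: "\<And>h. (\<lambda>k. inner (l2_of \<Omega> (u (s k))) h) \<longlonglongrightarrow> inner p h"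
    by (rule bounded_weakly_convergent_subseq) blast
  have R: "rep_l2 p \<in> L2 \<Omega>" by (rule rep_l2_in_L2[OF assms(1)])
  have "L2_weakly_tendsto \<Omega> (u \<circ> s) (rep_l2 p)"
    unfolding L2_weakly_tendsto_def
  proof
    fix h assume h: "h \<in> L2 \<Omega>"
    show "(\<lambda>k. L2_inner \<Omega> ((u \<circ> s) k) h) \<longlonglongrightarrow> L2_inner \<Omega> (rep_l2 p) h"
      using weak[of "l2_of \<Omega> h"] unfolding inner_l2_of[OF assms(1,2) h] inner_l2_of_right[OF assms(1) h]
      by (simp add: inner_l2_of[OF assms(1,2) h] flip: inner_l2_of_right[OF assms(1) h])
  qed
  with s R show ?thesis by (rule that)
qed

lemma L2_weakly_tendsto_subseq:
  "L2_weakly_tendsto \<Omega> u w \<Longrightarrow> strict_mono s \<Longrightarrow> L2_weakly_tendsto \<Omega> (u \<circ> s) w"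
  unfolding L2_weakly_tendsto_def using LIMSEQ_subseq_LIMSEQ by (fastforce simp: o_def)

text \<open>Mazur's theorem for sets of representatives: \<open>U\<close> corresponds to a closed convex set of classes, and
  closedness also makes \<open>U\<close> invariant under changes on null sets.\<close>

lemma L2_weakly_closed:
  assumes "open \<Omega>" "U \<subseteq> L2 \<Omega>" "L2_closed \<Omega> U" "convex_functions U"
    and u: "\<And>k. u k \<in> U" and w: "w \<in> L2 \<Omega>" "L2_weakly_tendsto \<Omega> u w"
  shows "w \<in> U"
proof -
  have uL: "u k \<in> L2 \<Omega>" for k using assms(2) u by blast
  have closed_at: "w' \<in> U" if "\<And>k. v k \<in> U" "w' \<in> L2 \<Omega>" "(\<lambda>k. l2_of \<Omega> (v k)) \<longlonglongrightarrow> l2_of \<Omega> w'" for v w'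
  proof -
    have "v k \<in> L2 \<Omega>" for k using that(1) assms(2) by blast
    then have "L2_tendsto \<Omega> v w'" using L2_tendsto_iff[OF assms(1) _ that(2)] that(3) by blast
    then show ?thesis using assms(3) that(1,2) unfolding L2_closed_def by blast
  qed
  have "closed (l2_of \<Omega> ` U)"
    unfolding closed_sequential_limits
  proof (intro allI impI)
    fix z l assume "(\<forall>n. z n \<in> l2_of \<Omega> ` U) \<and> z \<longlonglongrightarrow> l"
    then have z: "\<forall>n. \<exists>v. v \<in> U \<and> z n = l2_of \<Omega> v" "z \<longlonglongrightarrow> l" by auto
    from choice[OF z(1)] obtain v where v: "\<And>n. v n \<in> U \<and> z n = l2_of \<Omega> (v n)" by blast
    then have zv: "z = (\<lambda>n. l2_of \<Omega> (v n))" by auto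
    have vL: "v n \<in> L2 \<Omega>" for n using v assms(2) by blast
    have l: "l2_of \<Omega> (rep_l2 l) = l"
      by (rule l2_of_limit[OF assms(1) vL]) (use z(2) zv in simp)
    have "rep_l2 l \<in> U"
      by (rule closed_at[of v]) (use v z(2) zv l rep_l2_in_L2[OF assms(1)] in auto)
    with l show "l \<in> l2_of \<Omega> ` U" by force
  qed
  moreover have "convex (l2_of \<Omega> ` U)"
    unfolding convex_alt
  proof (intro ballI allI impI)
    fix p q and t :: real assume pq: "p \<in> l2_of \<Omega> ` U" "q \<in> l2_of \<Omega> ` U" and t: "0 \<le> t \<and> t \<le> 1"
    obtain x y where xy: "x \<in> U" "y \<in> U" "p = l2_of \<Omega> x" "q = l2_of \<Omega> y" using pq by blast
    have L: "x \<in> L2 \<Omega>" "y \<in> L2 \<Omega>" using xy assms(2) by auto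
    have "(1 - t) *\<^sub>R p + t *\<^sub>R q = l2_of \<Omega> (\<lambda>z. (1 - t) * x z + t * y z)"
      using L2_add(2)[OF assms(1) L2_scale(1)[OF assms(1) L(1), of "1 - t"] L2_scale(1)[OF assms(1) L(2), of t]]
      by (simp add: L2_scale(2)[OF assms(1)] L xy(3,4))
    moreover have "(\<lambda>z. (1 - t) * x z + t * y z) \<in> U"
      using assms(4) xy(1,2) t unfolding convex_functions_def by simp
    ultimately show "(1 - t) *\<^sub>R p + t *\<^sub>R q \<in> l2_of \<Omega> ` U" by auto
  qed
  moreover have "l2_of \<Omega> (u k) \<in> l2_of \<Omega> ` U" for k using u by blast
  moreover have "(\<lambda>k. inner (l2_of \<Omega> (u k)) h) \<longlonglongrightarrow> inner (l2_of \<Omega> w) h" for h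
    using w(2) L2_weakly_tendsto_iff[where u = u, OF assms(1) uL w(1)] by blast
  ultimately have "l2_of \<Omega> w \<in> l2_of \<Omega> ` U" by (rule weak_limit_in_closed_convex)
  then obtain u' where "u' \<in> U" "l2_of \<Omega> w = l2_of \<Omega> u'" by blast
  then show ?thesis using closed_at[of "\<lambda>k. u'" w] w(1) by simp
qed

lemma L2_weak_limit_norm_le:
  assumes "open \<Omega>" "\<And>k. u k \<in> L2 \<Omega>" "w \<in> L2 \<Omega>" "L2_weakly_tendsto \<Omega> u w"
    "\<And>k. norm (l2_of \<Omega> (u k)) \<le> R"
  shows "norm (l2_of \<Omega> w) \<le> R"
proof -
  have "l2_of \<Omega> w \<in> cball 0 R"
  proof (rule weak_limit_in_closed_convex[where u = "\<lambda>k. l2_of \<Omega> (u k)"])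
    show "(\<lambda>k. inner (l2_of \<Omega> (u k)) h) \<longlonglongrightarrow> inner (l2_of \<Omega> w) h" for h
      using assms(4) L2_weakly_tendsto_iff[where u = u, OF assms(1-3)] by blast
  qed (use assms(5) in auto)
  then show ?thesis by simp
qed

lemma inner_weak_strong_tendsto:
  fixes x y :: "nat \<Rightarrow> 'h::real_inner"
  assumes "\<And>h. (\<lambda>k. inner (x k) h) \<longlonglongrightarrow> inner p h" "y \<longlonglongrightarrow> q" "\<And>k. norm (x k) \<le> B"
  shows "(\<lambda>k. inner (x k) (y k)) \<longlonglongrightarrow> inner p q"
proof -
  have "(\<lambda>k. inner (x k) (y k - q)) \<longlonglongrightarrow> 0"
  proof (rule Lim_null_comparison)
    show "\<forall>\<^sub>F k in sequentially. norm (inner (x k) (y k - q)) \<le> B * norm (y k - q)"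
      by (intro always_eventually allI)
         (auto intro!: order_trans[OF Cauchy_Schwarz_ineq2] mult_right_mono assms(3))
    have "(\<lambda>k. B * norm (y k - q)) \<longlonglongrightarrow> B * norm (q - q)" by (intro tendsto_intros assms(2))
    then show "(\<lambda>k. B * norm (y k - q)) \<longlonglongrightarrow> 0" by simp
  qed
  from tendsto_add[OF this assms(1)[of q]] show ?thesis by (simp add: inner_diff_right)
qed

text \<open>Expanding the square around the weak limit: the norm is weakly lower semicontinuous, and
  convergence of the norms forces strong convergence.\<close>

lemma weak_limit_norm_sq_le:
  fixes x :: "nat \<Rightarrow> 'h::real_inner"
  assumes weak: "\<And>h. (\<lambda>k. inner (x k) h) \<longlonglongrightarrow> inner p h"
    and "\<And>k. (norm (x k - d))\<^sup>2 \<le> t k" "t \<longlonglongrightarrow> T"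
  shows "(norm (p - d))\<^sup>2 \<le> T" "T \<le> (norm (p - d))\<^sup>2 \<Longrightarrow> x \<longlonglongrightarrow> p"
proof -
  have exp: "(norm (x k - p))\<^sup>2 = (norm (x k - d))\<^sup>2 - (norm (p - d))\<^sup>2 - 2 * (inner (x k) (p - d) - inner p (p - d))" for k
    by (simp add: power2_norm_eq_inner algebra_simps inner_commute)
  let ?e = "\<lambda>k. t k - (norm (p - d))\<^sup>2 - 2 * (inner (x k) (p - d) - inner p (p - d))"
  have le: "(norm (x k - p))\<^sup>2 \<le> ?e k" for k using exp[of k] assms(2)[of k] by linarith
  have lim: "?e \<longlonglongrightarrow> T - (norm (p - d))\<^sup>2 - 2 * (inner p (p - d) - inner p (p - d))"
    by (intro tendsto_intros assms(3) weak)
  have "0 \<le> ?e k" for k by (rule order_trans[OF zero_le_power2 le])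
  then have "0 \<le> T - (norm (p - d))\<^sup>2 - 2 * (inner p (p - d) - inner p (p - d))"
    by (intro LIMSEQ_le_const[OF lim]) auto
  then show 1: "(norm (p - d))\<^sup>2 \<le> T" by simp
  assume "T \<le> (norm (p - d))\<^sup>2"
  with 1 lim have lim0: "?e \<longlonglongrightarrow> 0" by simp
  have "(\<lambda>k. (norm (x k - p))\<^sup>2) \<longlonglongrightarrow> 0"
    by (rule tendsto_sandwich[OF _ _ tendsto_const lim0]) (use le in \<open>auto intro!: always_eventually\<close>)
  from tendsto_real_sqrt[OF this] have "(\<lambda>k. norm (x k - p)) \<longlonglongrightarrow> 0" by simp
  then show "x \<longlonglongrightarrow> p" by (rule LIM_zero_cancel[OF tendsto_norm_zero_cancel])
qed

section \<open>Complementarity in the limit\<close>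

lemma L2_mult_integrable:
  assumes "u \<in> L2 \<Omega>" "v \<in> L2 \<Omega>"
  shows "integrable (lebesgue_on \<Omega>) (\<lambda>x. u x * v x)"
proof (rule Bochner_Integration.integrable_bound)
  show "integrable (lebesgue_on \<Omega>) (\<lambda>x. (u x)\<^sup>2 + (v x)\<^sup>2)"
    using assms by (simp add: L2_def)
  show "(\<lambda>x. u x * v x) \<in> borel_measurable (lebesgue_on \<Omega>)"
    using assms unfolding L2_def by (intro borel_measurable_times) auto
  have "\<bar>u x * v x\<bar> \<le> (u x)\<^sup>2 + (v x)\<^sup>2" for x
  proof -
    have "0 \<le> \<bar>u x\<bar> * \<bar>v x\<bar>" by simp
    then show ?thesis
      using sum_squares_bound[of "\<bar>u x\<bar>" "\<bar>v x\<bar>"] unfolding abs_mult power2_abs by linarith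
  qed
  then show "AE x in lebesgue_on \<Omega>. norm (u x * v x) \<le> norm ((u x)\<^sup>2 + (v x)\<^sup>2)" by simp
qed

lemma L_infinity_mult_integrable:
  assumes "m \<in> L_infinity \<Omega>" "u \<in> L2 \<Omega>" "v \<in> L2 \<Omega>"
  shows "integrable (lebesgue_on \<Omega>) (\<lambda>x. m x * u x * v x)"
proof -
  obtain C where C: "AE x in lebesgue_on \<Omega>. \<bar>m x\<bar> \<le> C" using assms(1) by (auto simp: L_infinity_def)
  show ?thesis
  proof (rule Bochner_Integration.integrable_bound)
    show "integrable (lebesgue_on \<Omega>) (\<lambda>x. C * (u x * v x))"
      by (intro integrable_mult_right L2_mult_integrable assms)
    show "(\<lambda>x. m x * u x * v x) \<in> borel_measurable (lebesgue_on \<Omega>)"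
      using assms unfolding L2_def L_infinity_def by (intro borel_measurable_times) auto
    show "AE x in lebesgue_on \<Omega>. norm (m x * u x * v x) \<le> norm (C * (u x * v x))"
      using C by eventually_elim (auto simp: abs_mult mult.assoc intro!: mult_right_mono)
  qed
qed

lemma L2_bounded_function:
  assumes "open (\<Omega> :: (real ^ 'n) set)" "bounded \<Omega>" "u \<in> borel_measurable (lebesgue_on \<Omega>)"
    "\<And>x. \<bar>u x\<bar> \<le> C"
  shows "u \<in> L2 \<Omega>"
proof -
  interpret finite_measure "lebesgue_on \<Omega>" by (rule finite_measure_lebesgue_on[OF lmeasurable_open[OF assms(2,1)]])
  have "(u x)\<^sup>2 \<le> C\<^sup>2" for x
    using power_mono[OF assms(4)[of x], of 2] by simp
  then have "integrable (lebesgue_on \<Omega>) (\<lambda>x. (u x)\<^sup>2)"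
    by (intro integrable_const_bound[of _ "C\<^sup>2"]) (use assms(3) in auto)
  with assms(3) show ?thesis by (simp add: L2_def)
qed

text \<open>Tested with the indicator function of the set where the limit is negative.\<close>

lemma weak_limit_nonneg:
  assumes "open (\<Omega> :: (real ^ 'n) set)" "bounded \<Omega>" "\<And>k. AE x in lebesgue_on \<Omega>. 0 \<le> u k x"
    and w: "w \<in> L2 \<Omega>" "L2_weakly_tendsto \<Omega> u w"
  shows "AE x in lebesgue_on \<Omega>. 0 \<le> w x"
proof -
  define A where "A = {x. w x < 0}"
  have wm: "w \<in> borel_measurable (lebesgue_on \<Omega>)" using w(1) by (simp add: L2_def)
  have "(\<lambda>x. if w x < 0 then 1 else 0 :: real) \<in> borel_measurable (lebesgue_on \<Omega>)"
    using wm by measurable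
  also have "(\<lambda>x. if w x < 0 then 1 else 0 :: real) = indicator A"
    by (auto simp: A_def indicator_def)
  finally have A: "(indicator A :: _ \<Rightarrow> real) \<in> L2 \<Omega>"
    by (rule L2_bounded_function[OF assms(1,2), of _ 1]) (simp add: indicator_def)
  have "0 \<le> L2_inner \<Omega> (u k) (indicator A)" for k
    unfolding L2_inner_def using assms(3)[of k] by (intro integral_nonneg_AE) (auto elim!: eventually_mono)
  moreover have "(\<lambda>k. L2_inner \<Omega> (u k) (indicator A)) \<longlonglongrightarrow> L2_inner \<Omega> w (indicator A)"
    using w(2) A by (simp add: L2_weakly_tendsto_def)
  ultimately have ge: "0 \<le> L2_inner \<Omega> w (indicator A)" by (intro LIMSEQ_le_const) auto
  have int: "integrable (lebesgue_on \<Omega>) (\<lambda>x. - (w x * indicator A x))"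
    using L2_mult_integrable[OF w(1) A] by simp
  have nn: "AE x in lebesgue_on \<Omega>. 0 \<le> - (w x * indicator A x)" by (simp add: A_def indicator_def)
  have "(LINT x|lebesgue_on \<Omega>. - (w x * indicator A x)) = 0"
    using ge integral_nonneg_AE[OF nn] by (simp add: L2_inner_def)
  then have "AE x in lebesgue_on \<Omega>. - (w x * indicator A x) = 0"
    using integral_nonneg_eq_0_iff_AE[OF int nn] by simp
  then show ?thesis by eventually_elim (auto simp: A_def indicator_def split: if_splits)
qed

text \<open>A product of a strongly and a weakly convergent sequence converges when integrated over any
  measurable set; the set where the bound fails for the limit must therefore be null.\<close>

lemma limit_product_le:
  assumes "open (\<Omega> :: (real ^ 'n) set)" "bounded \<Omega>"
    and y: "\<And>k. y k \<in> L2 \<Omega>" "y' \<in> L2 \<Omega>" "(\<lambda>k. l2_of \<Omega> (y k)) \<longlonglongrightarrow> l2_of \<Omega> y'"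
    and \<xi>: "\<And>k. \<xi> k \<in> L2 \<Omega>" "\<xi>' \<in> L2 \<Omega>" "L2_weakly_tendsto \<Omega> \<xi> \<xi>'" "\<And>k. norm (l2_of \<Omega> (\<xi> k)) \<le> R"
    and le: "\<And>k. AE x in lebesgue_on \<Omega>. y k x * \<xi> k x \<le> \<kappa> k" and \<kappa>: "\<kappa> \<longlonglongrightarrow> \<kappa>'"
  shows "AE x in lebesgue_on \<Omega>. y' x * \<xi>' x \<le> \<kappa>'"
proof -
  interpret finite_measure "lebesgue_on \<Omega>" by (rule finite_measure_lebesgue_on[OF lmeasurable_open[OF assms(2,1)]])
  define A where "A = {x. y' x * \<xi>' x > \<kappa>'}"
  define I where "I x = (indicator A x :: real)" for x
  have [measurable]: "y' \<in> borel_measurable (lebesgue_on \<Omega>)" "\<xi>' \<in> borel_measurable (lebesgue_on \<Omega>)"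
    using y(2) \<xi>(2) by (simp_all add: L2_def)
  have "(\<lambda>x. if y' x * \<xi>' x > \<kappa>' then 1 else 0 :: real) \<in> borel_measurable (lebesgue_on \<Omega>)"
    by measurable
  also have "(\<lambda>x. if y' x * \<xi>' x > \<kappa>' then 1 else 0 :: real) = I"
    by (auto simp: A_def I_def indicator_def)
  finally have Im: "I \<in> borel_measurable (lebesgue_on \<Omega>)" .
  have I: "I \<in> L2 \<Omega>"
    by (rule L2_bounded_function[OF assms(1,2) Im, of 1]) (simp add: I_def indicator_def)
  have cut: "(\<lambda>x. I x * u x) \<in> L2 \<Omega>" "norm (l2_of \<Omega> (\<lambda>x. I x * u x)) \<le> norm (l2_of \<Omega> u)" if u: "u \<in> L2 \<Omega>" for u
  proof -
    have m: "(\<lambda>x. I x * u x) \<in> borel_measurable (lebesgue_on \<Omega>)"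
      using Im u unfolding L2_def by (intro borel_measurable_times) auto
    have i: "integrable (lebesgue_on \<Omega>) (\<lambda>x. (I x * u x)\<^sup>2)"
      by (rule Bochner_Integration.integrable_bound[of _ "\<lambda>x. (u x)\<^sup>2"])
         (use u m in \<open>auto simp: L2_def I_def indicator_def\<close>)
    with m show L: "(\<lambda>x. I x * u x) \<in> L2 \<Omega>" by (simp add: L2_def)
    have "L2_inner \<Omega> (\<lambda>x. I x * u x) (\<lambda>x. I x * u x) \<le> L2_inner \<Omega> u u"
      unfolding L2_inner_def
      by (intro integral_mono L2_mult_integrable L u) (simp add: I_def indicator_def)
    then show "norm (l2_of \<Omega> (\<lambda>x. I x * u x)) \<le> norm (l2_of \<Omega> u)"
      unfolding norm_l2_of[OF assms(1) L] norm_l2_of[OF assms(1) u] L2_norm_def by (rule real_sqrt_le_mono)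
  qed
  have strong: "(\<lambda>k. l2_of \<Omega> (\<lambda>x. I x * y k x)) \<longlonglongrightarrow> l2_of \<Omega> (\<lambda>x. I x * y' x)"
  proof (rule LIM_zero_cancel, rule Lim_null_comparison)
    have "norm (l2_of \<Omega> (\<lambda>x. I x * y k x) - l2_of \<Omega> (\<lambda>x. I x * y' x)) \<le> norm (l2_of \<Omega> (y k) - l2_of \<Omega> y')" for k
    proof -
      have "l2_of \<Omega> (\<lambda>x. I x * y k x) - l2_of \<Omega> (\<lambda>x. I x * y' x) = l2_of \<Omega> (\<lambda>x. I x * (y k x - y' x))"
        using L2_diff(2)[OF assms(1) cut(1)[OF y(1)] cut(1)[OF y(2)], of k] by (simp add: right_diff_distrib)
      then show ?thesis
        using cut(2)[OF L2_diff(1)[OF assms(1) y(1) y(2)], of k] L2_diff(2)[OF assms(1) y(1) y(2), of k] by simp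
    qed
    then show "\<forall>\<^sub>F k in sequentially. norm (l2_of \<Omega> (\<lambda>x. I x * y k x) - l2_of \<Omega> (\<lambda>x. I x * y' x))
        \<le> norm (l2_of \<Omega> (y k) - l2_of \<Omega> y')" by simp
    show "(\<lambda>k. norm (l2_of \<Omega> (y k) - l2_of \<Omega> y')) \<longlonglongrightarrow> 0"
      using tendsto_norm_zero[OF LIM_zero[OF y(3)]] .
  qed
  have weak: "(\<lambda>k. inner (l2_of \<Omega> (\<xi> k)) h) \<longlonglongrightarrow> inner (l2_of \<Omega> \<xi>') h" for h
    using \<xi>(3) L2_weakly_tendsto_iff[where u = \<xi>, OF assms(1) \<xi>(1,2)] by blast
  have "(\<lambda>k. inner (l2_of \<Omega> (\<xi> k)) (l2_of \<Omega> (\<lambda>x. I x * y k x))) \<longlonglongrightarrow> inner (l2_of \<Omega> \<xi>') (l2_of \<Omega> (\<lambda>x. I x * y' x))"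
    by (rule inner_weak_strong_tendsto[OF weak strong \<xi>(4)])
  then have lim: "(\<lambda>k. LINT x|lebesgue_on \<Omega>. \<xi> k x * (I x * y k x)) \<longlonglongrightarrow> (LINT x|lebesgue_on \<Omega>. \<xi>' x * (I x * y' x))"
    unfolding inner_l2_of[OF assms(1) \<xi>(1) cut(1)[OF y(1)]] inner_l2_of[OF assms(1) \<xi>(2) cut(1)[OF y(2)]]
    by (simp add: L2_inner_def)
  have Iint: "integrable (lebesgue_on \<Omega>) I"
    by (rule integrable_const_bound[of _ 1]) (use Im in \<open>auto simp: I_def indicator_def\<close>)
  have "(LINT x|lebesgue_on \<Omega>. \<xi> k x * (I x * y k x)) \<le> (LINT x|lebesgue_on \<Omega>. \<kappa> k * I x)" for k
    by (rule integral_mono_AE[OF L2_mult_integrable[OF \<xi>(1) cut(1)[OF y(1)]] integrable_mult_right[OF Iint]])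
       (use le[of k] in \<open>auto elim!: eventually_mono simp: I_def indicator_def mult.commute\<close>)
  then have "(LINT x|lebesgue_on \<Omega>. \<xi> k x * (I x * y k x)) \<le> \<kappa> k * (LINT x|lebesgue_on \<Omega>. I x)" for k
    by simp
  then have "(LINT x|lebesgue_on \<Omega>. \<xi>' x * (I x * y' x)) \<le> \<kappa>' * (LINT x|lebesgue_on \<Omega>. I x)"
    by (intro LIMSEQ_le[OF lim tendsto_mult[OF \<kappa> tendsto_const]]) auto
  then have le0: "(LINT x|lebesgue_on \<Omega>. \<xi>' x * (I x * y' x) - \<kappa>' * I x) \<le> 0"
    using L2_mult_integrable[OF \<xi>(2) cut(1)[OF y(2)]] Iint by simp
  have int: "integrable (lebesgue_on \<Omega>) (\<lambda>x. \<xi>' x * (I x * y' x) - \<kappa>' * I x)"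
    using L2_mult_integrable[OF \<xi>(2) cut(1)[OF y(2)]] Iint by simp
  have nn: "AE x in lebesgue_on \<Omega>. 0 \<le> \<xi>' x * (I x * y' x) - \<kappa>' * I x"
    by (rule always_eventually) (simp add: I_def A_def indicator_def mult.commute)
  have "(LINT x|lebesgue_on \<Omega>. \<xi>' x * (I x * y' x) - \<kappa>' * I x) = 0"
    using le0 integral_nonneg_AE[OF nn] by linarith
  then have "AE x in lebesgue_on \<Omega>. \<xi>' x * (I x * y' x) - \<kappa>' * I x = 0"
    using integral_nonneg_eq_0_iff_AE[OF int nn] by simp
  then show ?thesis by eventually_elim (auto simp: I_def A_def indicator_def mult.commute split: if_splits)
qed

text \<open>Clearing denominators turns the relaxed complementarity condition into a bound on the product, the
  form that passes to limits and that for \<open>\<alpha> = 0\<close> becomes complementarity itself.\<close>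

lemma relaxed_complementarity_iff:
  fixes y \<xi> \<alpha> :: real
  assumes "0 \<le> y" "0 \<le> \<xi>" "0 < \<alpha>"
  shows "y / (y + \<alpha>) + \<xi> / (\<xi> + \<alpha>) \<le> 1 \<longleftrightarrow> y * \<xi> \<le> \<alpha>\<^sup>2"
proof -
  have p: "0 < y + \<alpha>" "0 < \<xi> + \<alpha>" using assms by auto
  have "y / (y + \<alpha>) + \<xi> / (\<xi> + \<alpha>) = (y * (\<xi> + \<alpha>) + \<xi> * (y + \<alpha>)) / ((y + \<alpha>) * (\<xi> + \<alpha>))"
    using p by (simp add: add_frac_eq)
  also have "\<dots> \<le> 1 \<longleftrightarrow> y * (\<xi> + \<alpha>) + \<xi> * (y + \<alpha>) \<le> (y + \<alpha>) * (\<xi> + \<alpha>)"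
    using p by (subst divide_le_eq_1_pos) auto
  also have "\<dots> \<longleftrightarrow> y * \<xi> \<le> \<alpha>\<^sup>2" by (simp add: algebra_simps power2_eq_square)
  finally show ?thesis .
qed

section \<open>The semilinear state equation\<close>

text \<open>The constant \<open>L\<close> stands for a bound on the derivative of \<open>g\<close>.\<close>

locale semilinear_control_problem =
  fixes \<Omega> :: "(real ^ 'n) set"
    and a :: "'n \<Rightarrow> 'n \<Rightarrow> real ^ 'n \<Rightarrow> real"
    and b :: "'n \<Rightarrow> real ^ 'n \<Rightarrow> real"
    and c f z\<^sub>d v\<^sub>d :: "real ^ 'n \<Rightarrow> real"
    and g :: "real \<Rightarrow> real"
    and U :: "(real ^ 'n \<Rightarrow> real) set"
    and M \<delta> L \<nu> :: real
  assumes dom: "open \<Omega>" and dom_bounded: "bounded \<Omega>"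
    and coeff: "\<And>i j. a i j \<in> L_infinity \<Omega>" "\<And>i. b i \<in> L_infinity \<Omega>" "c \<in> L_infinity \<Omega>"
    and form_bound: "\<And>y z. y \<in> H10 \<Omega> \<Longrightarrow> z \<in> H10 \<Omega> \<Longrightarrow>
         bilinear_form \<Omega> a b c y z \<le> M * H1_norm \<Omega> y * H1_norm \<Omega> z"
    and delta: "\<delta> > 0"
    and coercive: "\<And>y. y \<in> H10 \<Omega> \<Longrightarrow> bilinear_form \<Omega> a b c y y \<ge> \<delta> * (H1_norm \<Omega> y)\<^sup>2"
    and g_mono: "mono g"
    and g_lipschitz: "\<And>s t. \<bar>g s - g t\<bar> \<le> L * \<bar>s - t\<bar>"
    and data: "f \<in> L2 \<Omega>" "z\<^sub>d \<in> L2 \<Omega>" "v\<^sub>d \<in> L2 \<Omega>" "\<nu> > 0"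
    and controls: "U \<subseteq> L2 \<Omega>" "L2_closed \<Omega> U" "convex_functions U"
begin

abbreviation form where "form \<equiv> bilinear_form \<Omega> a b c"
abbreviation cls where "cls \<equiv> l2_of \<Omega>"
abbreviation state where "state \<equiv> state_equation \<Omega> a b c g f"

lemma weak_pd_diff_AE:
  assumes "y \<in> H1 \<Omega>" "y' \<in> H1 \<Omega>"
  shows "AE x in lebesgue_on \<Omega>. weak_pd \<Omega> i (\<lambda>x. y x - y' x) x = weak_pd \<Omega> i y x - weak_pd \<Omega> i y' x"
proof -
  note w = weak_pd_L2[OF assms(1), of i] weak_pd_L2[OF assms(2), of i]
  have "cls (weak_pd \<Omega> i (\<lambda>x. y x - y' x)) = cls (\<lambda>x. weak_pd \<Omega> i y x - weak_pd \<Omega> i y' x)"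
    using H1_diff(3)[OF dom assms] L2_diff(2)[OF dom w] by simp
  then show ?thesis
    using l2_of_eq_iff[OF dom weak_pd_L2[OF H1_diff(1)[OF dom assms]] L2_diff(1)[OF dom w]] by blast
qed

text \<open>Linearity in the first argument; the chosen weak derivatives are linear only up to null sets.\<close>

lemma form_diff:
  assumes "y \<in> H1 \<Omega>" "y' \<in> H1 \<Omega>" "z \<in> H1 \<Omega>"
  shows "form (\<lambda>x. y x - y' x) z = form y z - form y' z"
proof -
  have pd: "(LINT x|lebesgue_on \<Omega>. m x * weak_pd \<Omega> i (\<lambda>x. y x - y' x) x * u x)
      = (LINT x|lebesgue_on \<Omega>. m x * weak_pd \<Omega> i y x * u x) - (LINT x|lebesgue_on \<Omega>. m x * weak_pd \<Omega> i y' x * u x)"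
    if m: "m \<in> L_infinity \<Omega>" and u: "u \<in> L2 \<Omega>" for m u i
  proof -
    note int = L_infinity_mult_integrable[OF m _ u]
    have i: "integrable (lebesgue_on \<Omega>) (\<lambda>x. m x * weak_pd \<Omega> i y x * u x)"
      "integrable (lebesgue_on \<Omega>) (\<lambda>x. m x * weak_pd \<Omega> i y' x * u x)"
      "integrable (lebesgue_on \<Omega>) (\<lambda>x. m x * weak_pd \<Omega> i (\<lambda>x. y x - y' x) x * u x)"
      by (intro int weak_pd_L2 assms H1_diff(1)[OF dom])+
    have "(LINT x|lebesgue_on \<Omega>. m x * weak_pd \<Omega> i (\<lambda>x. y x - y' x) x * u x)
        = (LINT x|lebesgue_on \<Omega>. m x * weak_pd \<Omega> i y x * u x - m x * weak_pd \<Omega> i y' x * u x)"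
    proof (rule integral_cong_AE)
      show "AE x in lebesgue_on \<Omega>. m x * weak_pd \<Omega> i (\<lambda>x. y x - y' x) x * u x
          = m x * weak_pd \<Omega> i y x * u x - m x * weak_pd \<Omega> i y' x * u x"
        using weak_pd_diff_AE[OF assms(1,2), of i] by eventually_elim (simp add: left_diff_distrib right_diff_distrib)
    qed (use i in auto)
    then show ?thesis using i by simp
  qed
  have low: "(LINT x|lebesgue_on \<Omega>. c x * (y x - y' x) * z x)
      = (LINT x|lebesgue_on \<Omega>. c x * y x * z x) - (LINT x|lebesgue_on \<Omega>. c x * y' x * z x)"
  proof -
    have i: "integrable (lebesgue_on \<Omega>) (\<lambda>x. c x * y x * z x)" "integrable (lebesgue_on \<Omega>) (\<lambda>x. c x * y' x * z x)"
      by (intro L_infinity_mult_integrable coeff H1_L2 assms)+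
    have "(LINT x|lebesgue_on \<Omega>. c x * (y x - y' x) * z x) = (LINT x|lebesgue_on \<Omega>. c x * y x * z x - c x * y' x * z x)"
      by (rule Bochner_Integration.integral_cong) (simp_all add: algebra_simps)
    then show ?thesis using i by simp
  qed
  have z: "z \<in> L2 \<Omega>" by (rule H1_L2[OF assms(3)])
  show ?thesis
    unfolding bilinear_form_def pd[OF coeff(1) weak_pd_L2[OF assms(3)]] pd[OF coeff(2) z] low
    by (simp add: sum_subtractf)
qed

lemma lipschitz_nonneg: "L \<ge> 0"
  using g_lipschitz[of 1 0] abs_ge_zero[of "g 1 - g 0"] by simp

lemma g_L2:
  assumes "y \<in> L2 \<Omega>"
  shows "(\<lambda>x. g (y x)) \<in> L2 \<Omega>"
proof -
  interpret finite_measure "lebesgue_on \<Omega>"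
    by (rule finite_measure_lebesgue_on[OF lmeasurable_open[OF dom_bounded dom]])
  have "L-lipschitz_on UNIV g"
    using g_lipschitz lipschitz_nonneg by (auto simp: lipschitz_on_def dist_real_def)
  then have "g \<in> borel_measurable borel"
    by (intro borel_measurable_continuous_onI lipschitz_on_continuous_on)
  then have m: "(\<lambda>x. g (y x)) \<in> borel_measurable (lebesgue_on \<Omega>)"
    using assms by (auto simp: L2_def)
  have "integrable (lebesgue_on \<Omega>) (\<lambda>x. (g (y x))\<^sup>2)"
  proof (rule Bochner_Integration.integrable_bound)
    show "integrable (lebesgue_on \<Omega>) (\<lambda>x. 2 * (g 0)\<^sup>2 + 2 * L\<^sup>2 * (y x)\<^sup>2)"
      using assms by (simp add: L2_def)
    have "(g t)\<^sup>2 \<le> 2 * (g 0)\<^sup>2 + 2 * L\<^sup>2 * t\<^sup>2" for t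
    proof -
      have "\<bar>g t - g 0\<bar>\<^sup>2 \<le> (L * \<bar>t\<bar>)\<^sup>2" by (intro power_mono) (use g_lipschitz[of t 0] in auto)
      then have "(g t - g 0)\<^sup>2 \<le> L\<^sup>2 * t\<^sup>2" by (simp add: power_mult_distrib)
      moreover have "(g t)\<^sup>2 \<le> 2 * (g 0)\<^sup>2 + 2 * (g t - g 0)\<^sup>2"
        using zero_le_power2[of "g t - 2 * g 0"] by (simp add: power2_eq_square algebra_simps)
      ultimately show ?thesis by linarith
    qed
    then show "AE x in lebesgue_on \<Omega>. norm ((g (y x))\<^sup>2) \<le> norm (2 * (g 0)\<^sup>2 + 2 * L\<^sup>2 * (y x)\<^sup>2)" by simp
  qed (use m in measurable)
  with m show ?thesis by (simp add: L2_def)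
qed

lemma g_superposition_lipschitz:
  assumes "y \<in> L2 \<Omega>" "y' \<in> L2 \<Omega>"
  shows "norm (cls (\<lambda>x. g (y x)) - cls (\<lambda>x. g (y' x))) \<le> L * norm (cls y - cls y')"
proof -
  note d = L2_diff(1)[OF dom assms] and gd = L2_diff(1)[OF dom g_L2[OF assms(1)] g_L2[OF assms(2)]]
  have "L2_inner \<Omega> (\<lambda>x. g (y x) - g (y' x)) (\<lambda>x. g (y x) - g (y' x))
      \<le> (LINT x|lebesgue_on \<Omega>. L\<^sup>2 * ((y x - y' x) * (y x - y' x)))"
    unfolding L2_inner_def
  proof (rule integral_mono)
    show "integrable (lebesgue_on \<Omega>) (\<lambda>x. (g (y x) - g (y' x)) * (g (y x) - g (y' x)))"
      by (rule L2_mult_integrable[OF gd gd])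
    show "integrable (lebesgue_on \<Omega>) (\<lambda>x. L\<^sup>2 * ((y x - y' x) * (y x - y' x)))"
      by (rule integrable_mult_right[OF L2_mult_integrable[OF d d]])
    fix x
    have "\<bar>g (y x) - g (y' x)\<bar>\<^sup>2 \<le> (L * \<bar>y x - y' x\<bar>)\<^sup>2" by (intro power_mono g_lipschitz) simp
    then have "(g (y x) - g (y' x))\<^sup>2 \<le> L\<^sup>2 * (y x - y' x)\<^sup>2" by (simp add: power_mult_distrib)
    then show "(g (y x) - g (y' x)) * (g (y x) - g (y' x)) \<le> L\<^sup>2 * ((y x - y' x) * (y x - y' x))"
      by (simp add: power2_eq_square)
  qed
  also have "\<dots> = L\<^sup>2 * L2_inner \<Omega> (\<lambda>x. y x - y' x) (\<lambda>x. y x - y' x)" by (simp add: L2_inner_def)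
  finally have "(norm (cls (\<lambda>x. g (y x)) - cls (\<lambda>x. g (y' x))))\<^sup>2 \<le> (L * norm (cls y - cls y'))\<^sup>2"
    by (simp add: power2_norm_eq_inner power_mult_distrib inner_l2_of[OF dom gd gd] inner_l2_of[OF dom d d]
        flip: L2_diff(2)[OF dom assms] L2_diff(2)[OF dom g_L2[OF assms(1)] g_L2[OF assms(2)]])
  then show ?thesis by (rule power2_le_imp_le) (simp add: lipschitz_nonneg)
qed

lemma g_superposition_monotone:
  assumes "y \<in> L2 \<Omega>" "y' \<in> L2 \<Omega>"
  shows "0 \<le> inner (cls (\<lambda>x. g (y x)) - cls (\<lambda>x. g (y' x))) (cls y - cls y')"
proof -
  note d = L2_diff(1)[OF dom assms] and gd = L2_diff(1)[OF dom g_L2[OF assms(1)] g_L2[OF assms(2)]]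
  have "0 \<le> (g s - g t) * (s - t)" for s t
    using g_mono by (cases "s \<le> t") (auto simp: mono_def intro: mult_nonneg_nonneg mult_nonpos_nonpos)
  then have "0 \<le> L2_inner \<Omega> (\<lambda>x. g (y x) - g (y' x)) (\<lambda>x. y x - y' x)"
    unfolding L2_inner_def by (intro integral_nonneg_AE always_eventually) simp
  then show ?thesis
    by (simp add: inner_l2_of[OF dom gd d]
        flip: L2_diff(2)[OF dom assms] L2_diff(2)[OF dom g_L2[OF assms(1)] g_L2[OF assms(2)]])
qed

lemma state_iff:
  assumes "v \<in> L2 \<Omega>" "\<xi> \<in> L2 \<Omega>"
  shows "state y v \<xi> \<longleftrightarrow> y \<in> H10 \<Omega> \<and>
    (\<forall>z\<in>H10 \<Omega>. form y z + inner (cls (\<lambda>x. g (y x))) (cls z) = inner (cls f + cls v + cls \<xi>) (cls z))"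
proof -
  have rhs: "L2_inner \<Omega> (\<lambda>x. f x + v x + \<xi> x) z = inner (cls f + cls v + cls \<xi>) (cls z)" if "z \<in> H10 \<Omega>" for z
  proof -
    note fv = L2_add[OF dom data(1) assms(1)]
    note fvx = L2_add[OF dom fv(1) assms(2)]
    show ?thesis using inner_l2_of[OF dom fvx(1) H1_L2[OF H10_H1[OF that]]] by (simp add: fvx(2) fv(2))
  qed
  have lhs: "L2_inner \<Omega> (\<lambda>x. g (y x)) z = inner (cls (\<lambda>x. g (y x))) (cls z)" if "y \<in> H10 \<Omega>" "z \<in> H10 \<Omega>" for z
    using inner_l2_of[OF dom g_L2[OF H1_L2[OF H10_H1[OF that(1)]]] H1_L2[OF H10_H1[OF that(2)]]] by simp
  show ?thesis
    unfolding state_equation_def operator_A_def using rhs lhs by auto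
qed

lemma H10_cls_L2: "y \<in> H10 \<Omega> \<Longrightarrow> y \<in> L2 \<Omega>"
  by (intro H1_L2 H10_H1)

lemma coercive': "y \<in> H10 \<Omega> \<Longrightarrow> \<delta> * (norm (h1_of \<Omega> y))\<^sup>2 \<le> form y y"
  using coercive[of y] H1_norm_eq[OF dom H10_H1, of y] by simp

text \<open>Testing the equation with its solution; monotonicity of \<open>g\<close> leaves only its value at \<open>0\<close>.\<close>

lemma state_bound:
  assumes "v \<in> L2 \<Omega>" "\<xi> \<in> L2 \<Omega>" "state y v \<xi>"
  shows "norm (h1_of \<Omega> y) \<le> (norm (cls f) + norm (cls v) + norm (cls \<xi>) + norm (cls (\<lambda>x. g 0))) / \<delta>"
proof -
  let ?N = "norm (h1_of \<Omega> y)"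
  let ?C = "norm (cls f) + norm (cls v) + norm (cls \<xi>) + norm (cls (\<lambda>x. g 0))"
  have y: "y \<in> H10 \<Omega>" using assms(3) by (simp add: state_equation_def)
  have "form y y = inner (cls f + cls v + cls \<xi> - cls (\<lambda>x. g (y x))) (cls y)"
    using assms(3) y unfolding state_iff[OF assms(1,2)] by (auto simp: inner_diff_left algebra_simps)
  also have "\<dots> \<le> inner (cls f + cls v + cls \<xi> - cls (\<lambda>x. g 0)) (cls y)"
    using g_superposition_monotone[OF H10_cls_L2[OF y] L2_zero(1)[OF dom]]
    by (simp add: L2_zero(2) inner_diff_left)
  also have "\<dots> \<le> norm (cls f + cls v + cls \<xi> - cls (\<lambda>x. g 0)) * norm (cls y)" by (rule norm_cauchy_schwarz)
  also have "\<dots> \<le> ?C * ?N"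
  proof (intro mult_mono norm_l2_of_le_h1_of)
    show "norm (cls f + cls v + cls \<xi> - cls (\<lambda>x. g 0)) \<le> ?C"
      by (intro order_trans[OF norm_triangle_ineq4] add_right_mono order_trans[OF norm_triangle_ineq]) simp
  qed auto
  finally have le: "\<delta> * ?N\<^sup>2 \<le> ?C * ?N" using coercive'[OF y] by linarith
  have "\<delta> * ?N \<le> ?C"
  proof (cases "?N = 0")
    case False
    then have "?N > 0" by simp
    with le show ?thesis by (simp add: power2_eq_square flip: mult.assoc)
  qed simp
  then show ?thesis using delta by (simp add: pos_le_divide_eq mult.commute)
qed

text \<open>The difference of the equations is tested with the difference of the states; by monotonicity the
  nonlinear term can be dropped.\<close>

lemma state_difference:
  assumes "v \<in> L2 \<Omega>" "\<xi> \<in> L2 \<Omega>" "state y v \<xi>" and "v' \<in> L2 \<Omega>" "\<xi>' \<in> L2 \<Omega>" "state y' v' \<xi>'"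
  shows "\<delta> * (norm (h1_of \<Omega> y - h1_of \<Omega> y'))\<^sup>2
    \<le> (norm (cls v) + norm (cls v') + norm (cls \<xi>) + norm (cls \<xi>')) * norm (cls y - cls y')"
proof -
  have y: "y \<in> H10 \<Omega>" "y' \<in> H10 \<Omega>" using assms(3,6) by (auto simp: state_equation_def)
  note y1 = H10_H1[OF y(1)] H10_H1[OF y(2)] and y2 = H10_cls_L2[OF y(1)] H10_cls_L2[OF y(2)]
  define w where "w = (\<lambda>x. y x - y' x)"
  have w: "w \<in> H10 \<Omega>" unfolding w_def by (rule H10_diff[OF dom y])
  have cw: "cls w = cls y - cls y'" unfolding w_def by (rule L2_diff(2)[OF dom y2])
  have "\<delta> * (norm (h1_of \<Omega> y - h1_of \<Omega> y'))\<^sup>2 \<le> form w w"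
    using coercive'[OF w] H1_diff(2)[OF dom y1] by (simp add: w_def)
  also have "\<dots> = form y w - form y' w"
    unfolding w_def by (rule form_diff[OF y1 H1_diff(1)[OF dom y1]])
  also have "\<dots> = inner (cls v - cls v' + (cls \<xi> - cls \<xi>')) (cls w)
      - inner (cls (\<lambda>x. g (y x)) - cls (\<lambda>x. g (y' x))) (cls w)"
  proof -
    have "form y w = inner (cls f + cls v + cls \<xi>) (cls w) - inner (cls (\<lambda>x. g (y x))) (cls w)"
      using assms(3) w unfolding state_iff[OF assms(1,2)] by force
    moreover have "form y' w = inner (cls f + cls v' + cls \<xi>') (cls w) - inner (cls (\<lambda>x. g (y' x))) (cls w)"
      using assms(6) w unfolding state_iff[OF assms(4,5)] by force
    ultimately show ?thesis by (simp add: inner_diff_left inner_add_left)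
  qed
  also have "\<dots> \<le> inner (cls v - cls v' + (cls \<xi> - cls \<xi>')) (cls w)"
    using g_superposition_monotone[OF y2] by (simp add: cw)
  also have "\<dots> \<le> norm (cls v - cls v' + (cls \<xi> - cls \<xi>')) * norm (cls w)" by (rule norm_cauchy_schwarz)
  also have "\<dots> \<le> (norm (cls v) + norm (cls v') + norm (cls \<xi>) + norm (cls \<xi>')) * norm (cls w)"
    using norm_triangle_ineq[of "cls v - cls v'" "cls \<xi> - cls \<xi>'"] norm_triangle_ineq4[of "cls v" "cls v'"]
      norm_triangle_ineq4[of "cls \<xi>" "cls \<xi>'"]
    by (intro mult_right_mono) (linarith, simp)
  finally show ?thesis by (simp add: cw)
qed

lemma state_limit:
  assumes vL: "\<And>k. v k \<in> L2 \<Omega>" and v': "v' \<in> L2 \<Omega>" "L2_weakly_tendsto \<Omega> v v'"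
    and xL: "\<And>k. \<xi> k \<in> L2 \<Omega>" and \<xi>': "\<xi>' \<in> L2 \<Omega>" "L2_weakly_tendsto \<Omega> \<xi> \<xi>'"
    and st: "\<And>k. state (y k) (v k) (\<xi> k)"
    and y': "y' \<in> H10 \<Omega>" "(\<lambda>k. h1_of \<Omega> (y k)) \<longlonglongrightarrow> h1_of \<Omega> y'"
  shows "state y' v' \<xi>'"
  unfolding state_iff[OF v'(1) \<xi>'(1)]
proof (intro conjI ballI y'(1))
  fix z assume z: "z \<in> H10 \<Omega>"
  have y: "y k \<in> H10 \<Omega>" for k using st by (simp add: state_equation_def)
  have cy: "(\<lambda>k. cls (y k)) \<longlonglongrightarrow> cls y'" using tendsto_fst[OF y'(2)] by (simp add: h1_of_def)
  have "(\<lambda>k. form (y k) z) \<longlonglongrightarrow> form y' z"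
  proof (rule LIM_zero_cancel, rule Lim_null_comparison)
    have "norm (form (y k) z - form y' z) \<le> M * norm (h1_of \<Omega> (y k) - h1_of \<Omega> y') * norm (h1_of \<Omega> z)" for k
    proof -
      have b: "form p z - form q z \<le> M * norm (h1_of \<Omega> p - h1_of \<Omega> q) * norm (h1_of \<Omega> z)"
        if "p \<in> H10 \<Omega>" "q \<in> H10 \<Omega>" for p q
        using form_bound[OF H10_diff[OF dom that] z] form_diff[OF H10_H1[OF that(1)] H10_H1[OF that(2)] H10_H1[OF z]]
          H1_norm_eq[OF dom H1_diff(1)[OF dom H10_H1[OF that(1)] H10_H1[OF that(2)]]] H1_norm_eq[OF dom H10_H1[OF z]]
          H1_diff(2)[OF dom H10_H1[OF that(1)] H10_H1[OF that(2)]] by simp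
      show ?thesis
        using b[OF y[of k] y'(1)] b[OF y'(1) y[of k]] norm_minus_commute[of "h1_of \<Omega> y'" "h1_of \<Omega> (y k)"]
        by (simp add: abs_le_iff)
    qed
    then show "\<forall>\<^sub>F k in sequentially. norm (form (y k) z - form y' z)
        \<le> M * norm (h1_of \<Omega> (y k) - h1_of \<Omega> y') * norm (h1_of \<Omega> z)" by simp
    have "(\<lambda>k. M * norm (h1_of \<Omega> (y k) - h1_of \<Omega> y') * norm (h1_of \<Omega> z))
        \<longlonglongrightarrow> M * norm (h1_of \<Omega> y' - h1_of \<Omega> y') * norm (h1_of \<Omega> z)"
      by (intro tendsto_intros y'(2))
    then show "(\<lambda>k. M * norm (h1_of \<Omega> (y k) - h1_of \<Omega> y') * norm (h1_of \<Omega> z)) \<longlonglongrightarrow> 0" by simp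
  qed
  moreover have "(\<lambda>k. cls (\<lambda>x. g (y k x))) \<longlonglongrightarrow> cls (\<lambda>x. g (y' x))"
  proof (rule LIM_zero_cancel, rule Lim_null_comparison)
    show "\<forall>\<^sub>F k in sequentially. norm (cls (\<lambda>x. g (y k x)) - cls (\<lambda>x. g (y' x))) \<le> L * norm (cls (y k) - cls y')"
      by (intro always_eventually allI g_superposition_lipschitz H10_cls_L2 y y'(1))
    have "(\<lambda>k. L * norm (cls (y k) - cls y')) \<longlonglongrightarrow> L * norm (cls y' - cls y')" by (intro tendsto_intros cy)
    then show "(\<lambda>k. L * norm (cls (y k) - cls y')) \<longlonglongrightarrow> 0" by simp
  qed
  ultimately have "(\<lambda>k. form (y k) z + inner (cls (\<lambda>x. g (y k x))) (cls z))
      \<longlonglongrightarrow> form y' z + inner (cls (\<lambda>x. g (y' x))) (cls z)"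
    by (intro tendsto_intros)
  moreover have "(\<lambda>k. inner (cls (v k)) (cls z)) \<longlonglongrightarrow> inner (cls v') (cls z)"
    "(\<lambda>k. inner (cls (\<xi> k)) (cls z)) \<longlonglongrightarrow> inner (cls \<xi>') (cls z)"
    using v'(2) \<xi>'(2) L2_weakly_tendsto_iff[where u = v, OF dom vL v'(1)]
      L2_weakly_tendsto_iff[where u = \<xi>, OF dom xL \<xi>'(1)] by blast+
  then have "(\<lambda>k. inner (cls f + cls (v k) + cls (\<xi> k)) (cls z)) \<longlonglongrightarrow> inner (cls f + cls v' + cls \<xi>') (cls z)"
    unfolding inner_add_left by (intro tendsto_add tendsto_const)
  moreover have "form (y k) z + inner (cls (\<lambda>x. g (y k x))) (cls z) = inner (cls f + cls (v k) + cls (\<xi> k)) (cls z)" for k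
    using st[of k] z unfolding state_iff[OF vL xL] by blast
  ultimately show "form y' z + inner (cls (\<lambda>x. g (y' x))) (cls z) = inner (cls f + cls v' + cls \<xi>') (cls z)"
    using LIMSEQ_unique by simp
qed

text \<open>Coercivity bounds the states in \<open>H\<^sup>1\<close>, so Rellich's theorem gives an \<open>L\<^sup>2\<close> Cauchy subsequence. By the
  estimate of differences, the same subsequence is Cauchy even in \<open>H\<^sup>1\<close>, although controls and multipliers
  converge only weakly.\<close>

lemma states_compact:
  assumes vL: "\<And>k. v k \<in> L2 \<Omega>" "\<And>k. norm (cls (v k)) \<le> P"
    and xL: "\<And>k. \<xi> k \<in> L2 \<Omega>" "\<And>k. norm (cls (\<xi> k)) \<le> Q"
    and st: "\<And>k. state (y k) (v k) (\<xi> k)"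
  obtains s y' v' \<xi>' where "strict_mono (s::nat \<Rightarrow> nat)" "v' \<in> L2 \<Omega>" "\<xi>' \<in> L2 \<Omega>"
    "(\<lambda>k. h1_of \<Omega> (y (s k))) \<longlonglongrightarrow> h1_of \<Omega> y'"
    "L2_weakly_tendsto \<Omega> (v \<circ> s) v'" "L2_weakly_tendsto \<Omega> (\<xi> \<circ> s) \<xi>'" "state y' v' \<xi>'"
proof -
  have y: "y k \<in> H10 \<Omega>" for k using st by (simp add: state_equation_def)
  have "norm (h1_of \<Omega> (y k)) \<le> (norm (cls f) + P + Q + norm (cls (\<lambda>x. g 0))) / \<delta>" for k
    by (rule order_trans[OF state_bound[OF vL(1) xL(1) st]])
       (use vL(2)[of k] xL(2)[of k] delta in \<open>intro divide_right_mono add_mono; simp\<close>)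
  then obtain s1 where s1: "strict_mono (s1::nat\<Rightarrow>nat)" "Cauchy (\<lambda>k. cls (y (s1 k)))"
    using rellich[where u = y, OF dom dom_bounded y] by blast
  obtain s2 v' where s2: "strict_mono (s2::nat\<Rightarrow>nat)" "v' \<in> L2 \<Omega>" "L2_weakly_tendsto \<Omega> ((v \<circ> s1) \<circ> s2) v'"
    using L2_bounded_weakly_convergent_subseq[where u = "v \<circ> s1", OF dom] vL by (metis comp_apply)
  obtain s3 \<xi>' where s3: "strict_mono (s3::nat\<Rightarrow>nat)" "\<xi>' \<in> L2 \<Omega>" "L2_weakly_tendsto \<Omega> ((\<xi> \<circ> s1 \<circ> s2) \<circ> s3) \<xi>'"
    using L2_bounded_weakly_convergent_subseq[where u = "\<xi> \<circ> s1 \<circ> s2", OF dom] xL by (metis comp_apply)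
  define s where "s = s1 \<circ> s2 \<circ> s3"
  have s: "strict_mono s" unfolding s_def by (intro strict_mono_o s1 s2 s3)
  have vw: "L2_weakly_tendsto \<Omega> (v \<circ> s) v'"
    using L2_weakly_tendsto_subseq[OF s2(3) s3(1)] by (simp add: s_def comp_assoc)
  have xw: "L2_weakly_tendsto \<Omega> (\<xi> \<circ> s) \<xi>'" using s3(3) by (simp add: s_def comp_assoc)
  have C: "Cauchy (\<lambda>k. cls (y (s k)))"
    using Cauchy_subseq_Cauchy[OF s1(2) strict_mono_o[OF s2(1) s3(1)]] by (simp add: s_def o_def)
  have P0: "P \<ge> 0" "Q \<ge> 0" using order_trans[OF norm_ge_zero vL(2)] order_trans[OF norm_ge_zero xL(2)] by auto
  have "Cauchy (\<lambda>k. h1_of \<Omega> (y (s k)))"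
  proof (rule metric_CauchyI)
    fix e :: real assume e: "e > 0"
    define K where "K = 2 * P + 2 * Q + 1"
    have K: "K > 0" using P0 by (simp add: K_def)
    obtain N where N: "\<And>m n. m \<ge> N \<Longrightarrow> n \<ge> N \<Longrightarrow> dist (cls (y (s m))) (cls (y (s n))) < \<delta> * e\<^sup>2 / K"
      using metric_CauchyD[OF C, of "\<delta> * e\<^sup>2 / K"] delta e K by auto
    have "dist (h1_of \<Omega> (y (s m))) (h1_of \<Omega> (y (s n))) < e" if mn: "m \<ge> N" "n \<ge> N" for m n
    proof -
      let ?d = "norm (cls (y (s m)) - cls (y (s n)))"
      have "\<delta> * (norm (h1_of \<Omega> (y (s m)) - h1_of \<Omega> (y (s n))))\<^sup>2
          \<le> (norm (cls (v (s m))) + norm (cls (v (s n))) + norm (cls (\<xi> (s m))) + norm (cls (\<xi> (s n)))) * ?d"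
        by (intro state_difference vL(1) xL(1) st)
      also have "\<dots> \<le> K * ?d"
        using vL(2)[of "s m"] vL(2)[of "s n"] xL(2)[of "s m"] xL(2)[of "s n"]
        by (intro mult_right_mono) (auto simp: K_def)
      also have "\<dots> < K * (\<delta> * e\<^sup>2 / K)"
        using N[OF mn] K by (intro mult_strict_left_mono) (auto simp: dist_norm)
      also have "\<dots> = \<delta> * e\<^sup>2" using K by simp
      finally have "(norm (h1_of \<Omega> (y (s m)) - h1_of \<Omega> (y (s n))))\<^sup>2 < e\<^sup>2" using delta by simp
      then show ?thesis using e by (simp add: dist_norm power_less_imp_less_base)
    qed
    then show "\<exists>M. \<forall>m\<ge>M. \<forall>n\<ge>M. dist (h1_of \<Omega> (y (s m))) (h1_of \<Omega> (y (s n))) < e" by blast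
  qed
  then obtain l where l: "(\<lambda>k. h1_of \<Omega> (y (s k))) \<longlonglongrightarrow> l"
    using Cauchy_convergent_iff convergent_def by blast
  obtain y' where y': "y' \<in> H10 \<Omega>" "h1_of \<Omega> y' = l" by (rule H10_closed[OF dom y l])
  have "state y' v' \<xi>'"
    by (rule state_limit[where v = "v \<circ> s" and \<xi> = "\<xi> \<circ> s" and y = "y \<circ> s"])
       (use vL xL st y' l vw xw s2(2) s3(2) in \<open>simp_all add: o_def\<close>)
  with s s2(2) s3(2) vw xw l y' show ?thesis using that by blast
qed

section \<open>Minimizing sequences and relaxed solutions\<close>

abbreviation J where "J \<equiv> cost \<Omega> z\<^sub>d v\<^sub>d \<nu>"
abbreviation relaxed_feasible where
  "relaxed_feasible R \<alpha> \<equiv> feasible \<Omega> a b c g f (relaxed_constraint_set \<Omega> U R \<alpha>)"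

lemma cost_eq:
  assumes "y \<in> L2 \<Omega>" "v \<in> L2 \<Omega>"
  shows "J y v = 1 / 2 * (norm (cls y - cls z\<^sub>d))\<^sup>2 + \<nu> / 2 * (norm (cls v - cls v\<^sub>d))\<^sup>2"
proof -
  have "(LINT x|lebesgue_on \<Omega>. (p x - q x)\<^sup>2) = (norm (cls p - cls q))\<^sup>2" if "p \<in> L2 \<Omega>" "q \<in> L2 \<Omega>" for p q
  proof -
    note d = L2_diff[OF dom that]
    have "(norm (cls p - cls q))\<^sup>2 = L2_inner \<Omega> (\<lambda>x. p x - q x) (\<lambda>x. p x - q x)"
      unfolding d(2)[symmetric] power2_norm_eq_inner by (rule inner_l2_of[OF dom d(1) d(1)])
    then show ?thesis by (simp add: L2_inner_def power2_eq_square)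
  qed
  then show ?thesis unfolding cost_def using assms data by simp
qed

lemma cost_nonneg: "0 \<le> J y v"
  unfolding cost_def using data(4) by (intro add_nonneg_nonneg mult_nonneg_nonneg integral_nonneg_AE) auto

lemma cost_bounds_control:
  assumes "y \<in> L2 \<Omega>" "v \<in> L2 \<Omega>" "J y v \<le> K"
  shows "norm (cls v) \<le> norm (cls v\<^sub>d) + sqrt (2 * K / \<nu>)"
proof -
  have "\<nu> / 2 * (norm (cls v - cls v\<^sub>d))\<^sup>2 \<le> K"
    using assms(3) zero_le_power2[of "norm (cls y - cls z\<^sub>d)"] unfolding cost_eq[OF assms(1,2)] by linarith
  then have "(norm (cls v - cls v\<^sub>d))\<^sup>2 \<le> 2 * K / \<nu>" using data(4) by (simp add: field_simps)
  then have "norm (cls v - cls v\<^sub>d) \<le> sqrt (2 * K / \<nu>)" by (rule real_le_rsqrt)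
  then show ?thesis using norm_triangle_sub[of "cls v" "cls v\<^sub>d"] by linarith
qed

text \<open>Since the states converge strongly, upper bounds for the cost are upper bounds for the norms of the
  controls, up to a convergent sequence.\<close>

lemma cost_limit:
  assumes y: "\<And>k. y k \<in> L2 \<Omega>" "y' \<in> L2 \<Omega>" "(\<lambda>k. cls (y k)) \<longlonglongrightarrow> cls y'"
    and v: "\<And>k. v k \<in> L2 \<Omega>" "v' \<in> L2 \<Omega>" "L2_weakly_tendsto \<Omega> v v'"
    and le: "\<And>k. J (y k) (v k) \<le> t k" "t \<longlonglongrightarrow> T"
  shows "J y' v' \<le> T" "T \<le> J y' v' \<Longrightarrow> (\<lambda>k. cls (v k)) \<longlonglongrightarrow> cls v'"
proof -
  define r where "r k = 2 / \<nu> * (t k - 1 / 2 * (norm (cls (y k) - cls z\<^sub>d))\<^sup>2)" for k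
  define r' where "r' = 2 / \<nu> * (T - 1 / 2 * (norm (cls y' - cls z\<^sub>d))\<^sup>2)"
  have weak: "(\<lambda>k. inner (cls (v k)) h) \<longlonglongrightarrow> inner (cls v') h" for h
    using v(3) L2_weakly_tendsto_iff[where u = v, OF dom v(1,2)] by blast
  have rle: "(norm (cls (v k) - cls v\<^sub>d))\<^sup>2 \<le> r k" for k
    using le(1)[of k] data(4) unfolding cost_eq[OF y(1) v(1)] r_def by (simp add: field_simps)
  have rlim: "r \<longlonglongrightarrow> r'" unfolding r_def[abs_def] r'_def by (intro tendsto_intros le(2) y(3))
  note w = weak_limit_norm_sq_le[OF weak rle rlim]
  show "J y' v' \<le> T"
    using w(1) data(4) unfolding cost_eq[OF y(2) v(2)] r'_def by (simp add: field_simps)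
  assume "T \<le> J y' v'"
  then have "r' \<le> (norm (cls v' - cls v\<^sub>d))\<^sup>2"
    using data(4) unfolding cost_eq[OF y(2) v(2)] r'_def by (simp add: field_simps)
  then show "(\<lambda>k. cls (v k)) \<longlonglongrightarrow> cls v'" by (rule w(2))
qed

text \<open>The relaxed constraints with complementarity in product form; \<open>\<kappa> = 0\<close> gives the complementarity condition
  itself.\<close>

definition admissible where
  "admissible R \<kappa> y v \<xi> \<longleftrightarrow> v \<in> U \<and> \<xi> \<in> L2 \<Omega> \<and> state y v \<xi> \<and>
    (AE x in lebesgue_on \<Omega>. 0 \<le> y x) \<and> (AE x in lebesgue_on \<Omega>. 0 \<le> \<xi> x) \<and>
    (AE x in lebesgue_on \<Omega>. y x * \<xi> x \<le> \<kappa>) \<and> norm (cls \<xi>) \<le> R"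

lemma admissible_spaces:
  assumes "admissible R \<kappa> y v \<xi>"
  shows "y \<in> H10 \<Omega>" "y \<in> L2 \<Omega>" "v \<in> L2 \<Omega>" "\<xi> \<in> L2 \<Omega>"
  using assms controls(1) by (auto simp: admissible_def state_equation_def intro: H10_cls_L2)

lemma relaxed_feasible_iff:
  assumes "\<alpha> > 0"
  shows "(y, v, \<xi>) \<in> relaxed_feasible R \<alpha> \<longleftrightarrow> admissible R (\<alpha>\<^sup>2) y v \<xi>"
proof -
  define N where "N \<longleftrightarrow> (AE x in lebesgue_on \<Omega>. 0 \<le> y x)"
  define N' where "N' \<longleftrightarrow> (AE x in lebesgue_on \<Omega>. 0 \<le> \<xi> x)"
  define Q where "Q \<longleftrightarrow> (AE x in lebesgue_on \<Omega>. y x / (y x + \<alpha>) + \<xi> x / (\<xi> x + \<alpha>) \<le> 1)"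
  define Q' where "Q' \<longleftrightarrow> (AE x in lebesgue_on \<Omega>. y x * \<xi> x \<le> \<alpha>\<^sup>2)"
  have "Q \<longleftrightarrow> Q'" if "N" "N'"
  proof -
    have "AE x in lebesgue_on \<Omega>. y x / (y x + \<alpha>) + \<xi> x / (\<xi> x + \<alpha>) \<le> 1 \<longleftrightarrow> y x * \<xi> x \<le> \<alpha>\<^sup>2"
      using that unfolding N_def N'_def
      by eventually_elim (rule relaxed_complementarity_iff[OF _ _ assms])
    then show ?thesis unfolding Q_def Q'_def by (rule eventually_cong)
  qed
  moreover have "L2_norm \<Omega> \<xi> = norm (cls \<xi>)" if "\<xi> \<in> L2 \<Omega>"
    using norm_l2_of[OF dom that] by simp
  ultimately show ?thesis
    using controls(1)
    unfolding feasible_def admissible_def relaxed_constraint_set_def N_def[symmetric] N'_def[symmetric] Q'_def[symmetric]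
    by (auto simp: state_equation_def N_def[symmetric] N'_def[symmetric] Q_def[symmetric] simp del: AE_conj_iff)
qed

text \<open>The compactness argument behind both claims: it serves minimizing sequences for a fixed
  relaxation parameter and solutions for vanishing parameters.\<close>

lemma relaxed_feasible_limit:
  assumes F: "\<And>k. (y k, v k, \<xi> k) \<in> relaxed_feasible R (\<alpha> k)" "\<And>k. \<alpha> k > 0" "\<alpha> \<longlonglongrightarrow> \<alpha>'"
    and K: "\<And>k. J (y k) (v k) \<le> K"
  obtains s y' v' \<xi>' where "strict_mono (s::nat \<Rightarrow> nat)"
    "(\<lambda>k. h1_of \<Omega> (y (s k))) \<longlonglongrightarrow> h1_of \<Omega> y'"
    "L2_weakly_tendsto \<Omega> (v \<circ> s) v'" "L2_weakly_tendsto \<Omega> (\<xi> \<circ> s) \<xi>'"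
    "admissible R (\<alpha>'\<^sup>2) y' v' \<xi>'"
proof -
  have Fk: "v k \<in> U" "\<xi> k \<in> L2 \<Omega>" "state (y k) (v k) (\<xi> k)" "AE x in lebesgue_on \<Omega>. 0 \<le> y k x"
    "AE x in lebesgue_on \<Omega>. 0 \<le> \<xi> k x" "AE x in lebesgue_on \<Omega>. y k x * \<xi> k x \<le> (\<alpha> k)\<^sup>2"
    "norm (cls (\<xi> k)) \<le> R" for k
    using F(1)[of k] unfolding relaxed_feasible_iff[OF F(2)] admissible_def by auto
  have vL: "v k \<in> L2 \<Omega>" for k using Fk(1) controls(1) by blast
  have yL: "y k \<in> L2 \<Omega>" for k using Fk(3) H10_cls_L2 by (simp add: state_equation_def)
  obtain s y' v' \<xi>' where s: "strict_mono (s::nat\<Rightarrow>nat)" "v' \<in> L2 \<Omega>" "\<xi>' \<in> L2 \<Omega>"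
    "(\<lambda>k. h1_of \<Omega> (y (s k))) \<longlonglongrightarrow> h1_of \<Omega> y'"
    "L2_weakly_tendsto \<Omega> (v \<circ> s) v'" "L2_weakly_tendsto \<Omega> (\<xi> \<circ> s) \<xi>'" "state y' v' \<xi>'"
    by (rule states_compact[where v = v and \<xi> = \<xi> and y = y, OF vL cost_bounds_control[OF yL vL K] Fk(2,7,3)])
  have y'L: "y' \<in> L2 \<Omega>" using s(7) H10_cls_L2 by (simp add: state_equation_def)
  have cy: "(\<lambda>k. cls (y (s k))) \<longlonglongrightarrow> cls y'" using tendsto_fst[OF s(4)] by (simp add: h1_of_def)
  have yw: "L2_weakly_tendsto \<Omega> (y \<circ> s) y'"
  proof (rule L2_weakly_tendsto_iff[THEN iffD2, rule_format])
    show "(\<lambda>k. inner (cls ((y \<circ> s) k)) h) \<longlonglongrightarrow> inner (cls y') h" for h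
      using cy by (auto intro!: tendsto_intros simp: o_def)
  qed (use dom yL y'L in auto)
  have "v' \<in> U" by (rule L2_weakly_closed[OF dom controls _ s(2,5)]) (simp add: Fk(1))
  moreover have "AE x in lebesgue_on \<Omega>. 0 \<le> y' x"
    by (rule weak_limit_nonneg[OF dom dom_bounded _ y'L yw]) (simp add: Fk(4))
  moreover have "AE x in lebesgue_on \<Omega>. 0 \<le> \<xi>' x"
    by (rule weak_limit_nonneg[OF dom dom_bounded _ s(3,6)]) (simp add: Fk(5))
  moreover have "AE x in lebesgue_on \<Omega>. y' x * \<xi>' x \<le> \<alpha>'\<^sup>2"
  proof (rule limit_product_le[where y = "y \<circ> s" and \<xi> = "\<xi> \<circ> s" and \<kappa> = "\<lambda>k. (\<alpha> (s k))\<^sup>2", OF dom dom_bounded])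
    show "(\<lambda>k. (\<alpha> (s k))\<^sup>2) \<longlonglongrightarrow> \<alpha>'\<^sup>2"
      using LIMSEQ_subseq_LIMSEQ[OF F(3) s(1)] by (intro tendsto_intros) (simp add: o_def)
  qed (use yL y'L cy Fk s in \<open>simp_all add: o_def\<close>)
  moreover have "norm (cls \<xi>') \<le> R"
    by (rule L2_weak_limit_norm_le[where u = "\<xi> \<circ> s", OF dom _ s(3,6)]) (simp_all add: Fk)
  ultimately have "admissible R (\<alpha>'\<^sup>2) y' v' \<xi>'" using s(3,7) by (simp add: admissible_def)
  then show ?thesis by (rule that[OF s(1,4,5,6)])
qed

text \<open>The direct method: a minimizing sequence has bounded cost, and the limit of a subsequence is
  feasible with cost at most the infimum.\<close>

lemma relaxed_solution_exists:
  assumes "\<alpha> > 0" "relaxed_feasible R \<alpha> \<noteq> {}"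
  shows "\<exists>y v \<xi>. optimal_solution J (relaxed_feasible R \<alpha>) (y, v, \<xi>)"
proof -
  let ?F = "relaxed_feasible R \<alpha>"
  define S where "S = (\<lambda>(y, v, \<xi>). J y v) ` ?F"
  define m where "m = Inf S"
  have bdd: "bdd_below S" unfolding S_def by (rule bdd_belowI2[of _ 0]) (auto simp: cost_nonneg)
  have m_le: "m \<le> J y v" if "(y, v, \<xi>) \<in> ?F" for y v \<xi>
    unfolding m_def by (rule cInf_lower[OF _ bdd]) (use that in \<open>force simp: S_def\<close>)
  have "\<exists>q\<in>?F. (\<lambda>(y, v, \<xi>). J y v) q < m + inverse (real (Suc k))" for k
    using cInf_lessD[of S "m + inverse (real (Suc k))"] assms(2) unfolding m_def S_def by auto
  then have "\<exists>q. q \<in> ?F \<and> J (fst q) (fst (snd q)) < m + inverse (real (Suc k))" for k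
    by (metis (no_types, lifting) case_prod_beta)
  then obtain q where q: "q k \<in> ?F" "J (fst (q k)) (fst (snd (q k))) < m + inverse (real (Suc k))" for k
    by metis
  define y v \<xi> where "y k = fst (q k)" and "v k = fst (snd (q k))" and "\<xi> k = snd (snd (q k))" for k
  have F: "(y k, v k, \<xi> k) \<in> ?F" for k using q(1) by (simp add: y_def v_def \<xi>_def)
  have lt: "J (y k) (v k) \<le> m + inverse (real (Suc k))" for k
    using q(2)[of k] by (simp add: y_def v_def)
  have K: "J (y k) (v k) \<le> m + 1" for k
  proof -
    have "inverse (real (Suc k)) \<le> 1" by (simp add: field_simps)
    then show ?thesis using lt[of k] by linarith
  qed
  obtain s y' v' \<xi>' where lim: "strict_mono (s::nat\<Rightarrow>nat)"
    "(\<lambda>k. h1_of \<Omega> (y (s k))) \<longlonglongrightarrow> h1_of \<Omega> y'" "L2_weakly_tendsto \<Omega> (v \<circ> s) v'" "L2_weakly_tendsto \<Omega> (\<xi> \<circ> s) \<xi>'"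
    "admissible R (\<alpha>\<^sup>2) y' v' \<xi>'"
    by (rule relaxed_feasible_limit[where y = y and v = v and \<xi> = \<xi>, OF F assms(1) tendsto_const K])
  have F': "(y', v', \<xi>') \<in> ?F" using lim(5) relaxed_feasible_iff[OF assms(1)] by blast
  have "J y' v' \<le> m"
  proof (rule cost_limit(1)[where y = "y \<circ> s" and v = "v \<circ> s" and t = "\<lambda>k. m + inverse (real (Suc (s k)))"])
    show "(\<lambda>k. cls ((y \<circ> s) k)) \<longlonglongrightarrow> cls y'" using tendsto_fst[OF lim(2)] by (simp add: h1_of_def)
    show "(\<lambda>k. m + inverse (real (Suc (s k)))) \<longlonglongrightarrow> m"
      using tendsto_add[OF tendsto_const LIMSEQ_subseq_LIMSEQ[OF LIMSEQ_inverse_real_of_nat lim(1)], of m]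
      by (simp add: o_def)
    show "(y \<circ> s) k \<in> L2 \<Omega>" "(v \<circ> s) k \<in> L2 \<Omega>" for k
      using F[of "s k"] admissible_spaces unfolding relaxed_feasible_iff[OF assms(1)] by auto
  qed (use lim admissible_spaces[OF lim(5)] lt in auto)
  then have "optimal_solution J ?F (y', v', \<xi>')"
    unfolding optimal_solution_def is_arg_min_def using F' m_le by (force simp: not_less)
  then show ?thesis by blast
qed

text \<open>For nonnegative functions a vanishing inner product means a product that vanishes almost everywhere.\<close>

lemma feasible_imp_relaxed_feasible:
  assumes "(y, v, \<xi>) \<in> feasible \<Omega> a b c g f (constraint_set \<Omega> U)" "L2_norm \<Omega> \<xi> \<le> R" "\<alpha> > 0"
  shows "(y, v, \<xi>) \<in> relaxed_feasible R \<alpha>"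
proof -
  have F: "v \<in> U" "\<xi> \<in> L2 \<Omega>" "state y v \<xi>" "AE x in lebesgue_on \<Omega>. 0 \<le> y x" "AE x in lebesgue_on \<Omega>. 0 \<le> \<xi> x"
    and yL: "y \<in> L2 \<Omega>" and 0: "L2_inner \<Omega> y \<xi> = 0"
    using assms(1) by (auto simp: feasible_def constraint_set_def intro: H10_cls_L2)
  have nn: "AE x in lebesgue_on \<Omega>. 0 \<le> y x * \<xi> x" using F(4,5) by eventually_elim simp
  have "AE x in lebesgue_on \<Omega>. y x * \<xi> x = 0"
    using 0 integral_nonneg_eq_0_iff_AE[OF L2_mult_integrable[OF yL F(2)] nn] by (simp add: L2_inner_def)
  then have "AE x in lebesgue_on \<Omega>. y x * \<xi> x \<le> \<alpha>\<^sup>2" by eventually_elim auto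
  with F assms(2) show ?thesis
    unfolding relaxed_feasible_iff[OF assms(3)] admissible_def using norm_l2_of[OF dom F(2)] by simp
qed

text \<open>The given solution is feasible for every relaxed problem, so the relaxed costs stay below the optimal
  cost. The limit is feasible for the original problem, so its cost is not smaller. Hence the costs converge to
  the optimal cost, and with them the norms of the controls, which makes the controls converge strongly.\<close>

lemma relaxed_solutions_converge:
  assumes opt: "optimal_solution J (feasible \<Omega> a b c g f (constraint_set \<Omega> U)) (ybar, vbar, \<xi>bar)"
    and R: "L2_norm \<Omega> \<xi>bar \<le> R"
    and \<alpha>: "\<And>k. \<alpha> k > 0" "\<alpha> \<longlonglongrightarrow> 0"
    and sol: "\<And>k. optimal_solution J (relaxed_feasible R (\<alpha> k)) (y k, v k, \<xi> k)"
  shows "\<exists>s y' v' \<xi>'. strict_mono (s::nat\<Rightarrow>nat) \<and> y' \<in> H10 \<Omega> \<and> v' \<in> L2 \<Omega> \<and> \<xi>' \<in> L2 \<Omega> \<and>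
    H1_tendsto \<Omega> (y \<circ> s) y' \<and> L2_tendsto \<Omega> (v \<circ> s) v' \<and> L2_weakly_tendsto \<Omega> (\<xi> \<circ> s) \<xi>' \<and>
    optimal_solution J (feasible \<Omega> a b c g f (constraint_set \<Omega> U)) (y', v', \<xi>')"
proof -
  let ?P = "feasible \<Omega> a b c g f (constraint_set \<Omega> U)"
  have ref: "(ybar, vbar, \<xi>bar) \<in> ?P" and ref_min: "\<And>p w \<zeta>. (p, w, \<zeta>) \<in> ?P \<Longrightarrow> J ybar vbar \<le> J p w"
    using opt unfolding optimal_solution_def is_arg_min_def by (auto simp: not_less)
  have F: "(y k, v k, \<xi> k) \<in> relaxed_feasible R (\<alpha> k)" for k
    using sol by (simp add: optimal_solution_def is_arg_min_def)
  have K: "J (y k) (v k) \<le> J ybar vbar" for k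
    using sol[of k] feasible_imp_relaxed_feasible[OF ref R \<alpha>(1)[of k]]
    unfolding optimal_solution_def is_arg_min_def by (force simp: not_less)
  obtain s y' v' \<xi>' where lim: "strict_mono (s::nat\<Rightarrow>nat)"
    "(\<lambda>k. h1_of \<Omega> (y (s k))) \<longlonglongrightarrow> h1_of \<Omega> y'" "L2_weakly_tendsto \<Omega> (v \<circ> s) v'" "L2_weakly_tendsto \<Omega> (\<xi> \<circ> s) \<xi>'"
    "admissible R (0\<^sup>2) y' v' \<xi>'"
    by (rule relaxed_feasible_limit[where y = y and v = v and \<xi> = \<xi>, OF F \<alpha> K])
  note y'v' = admissible_spaces[OF lim(5)]
  have lim': "v' \<in> U" "state y' v' \<xi>'" "AE x in lebesgue_on \<Omega>. 0 \<le> y' x"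
    "AE x in lebesgue_on \<Omega>. 0 \<le> \<xi>' x" "AE x in lebesgue_on \<Omega>. y' x * \<xi>' x \<le> 0"
    using lim(5) by (auto simp: admissible_def)
  have yk: "y k \<in> H10 \<Omega>" "y k \<in> L2 \<Omega>" "v k \<in> L2 \<Omega>" for k
    using F[of k] admissible_spaces unfolding relaxed_feasible_iff[OF \<alpha>(1)] by auto
  have "L2_inner \<Omega> y' \<xi>' = (LINT x|lebesgue_on \<Omega>. 0)"
    unfolding L2_inner_def
  proof (rule integral_cong_AE)
    show "AE x in lebesgue_on \<Omega>. y' x * \<xi>' x = 0"
      using lim'(3,4,5) by eventually_elim (rule order_antisym; simp)
  qed (use L2_mult_integrable[OF y'v'(2,4)] in auto)
  then have P: "(y', v', \<xi>') \<in> ?P"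
    using lim' y'v' by (simp add: feasible_def constraint_set_def)
  have cy: "(\<lambda>k. cls ((y \<circ> s) k)) \<longlonglongrightarrow> cls y'" using tendsto_fst[OF lim(2)] by (simp add: h1_of_def)
  note cl = cost_limit[where y = "y \<circ> s" and v = "v \<circ> s" and t = "\<lambda>k. J ybar vbar", OF _ y'v'(2) cy _ y'v'(3) lim(3) _ tendsto_const]
  have le: "J y' v' \<le> J ybar vbar"
    by (rule cl(1)) (simp_all add: yk K)
  have "(\<lambda>k. cls ((v \<circ> s) k)) \<longlonglongrightarrow> cls v'"
    by (rule cl(2)) (simp_all add: yk K ref_min[OF P])
  then have "L2_tendsto \<Omega> (v \<circ> s) v'"
    by (subst L2_tendsto_iff[OF dom _ y'v'(3)]) (simp_all add: yk)
  moreover have "H1_tendsto \<Omega> (y \<circ> s) y'"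
    by (subst H1_tendsto_iff[OF dom _ H10_H1[OF y'v'(1)]]) (use lim(2) H10_H1[OF yk(1)] in \<open>simp_all add: o_def\<close>)
  moreover have "optimal_solution J ?P (y', v', \<xi>')"
    unfolding optimal_solution_def is_arg_min_def
    using P le ref_min by (force simp: not_less intro: order_trans)
  ultimately show ?thesis using lim(1,4) y'v' by blast
qed

end

theorem theorem3p1:
  fixes \<Omega> :: "(real ^ 'n) set"
    and a :: "'n \<Rightarrow> 'n \<Rightarrow> real ^ 'n \<Rightarrow> real"
    and b :: "'n \<Rightarrow> real ^ 'n \<Rightarrow> real"
    and c f z\<^sub>d v\<^sub>d ybar vbar \<xi>bar :: "real ^ 'n \<Rightarrow> real"
    and g :: "real \<Rightarrow> real"
    and U\<^sub>a\<^sub>d :: "(real ^ 'n \<Rightarrow> real) set"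
    and M \<delta> \<beta> \<gamma> \<nu> R :: real
  defines "J \<equiv> cost \<Omega> z\<^sub>d v\<^sub>d \<nu>"
    and "\<F> \<equiv> feasible \<Omega> a b c g f (constraint_set \<Omega> U\<^sub>a\<^sub>d)"
    and "\<F>\<^sub>r \<equiv> (\<lambda>\<alpha>. feasible \<Omega> a b c g f (relaxed_constraint_set \<Omega> U\<^sub>a\<^sub>d R \<alpha>))"
  assumes domain: "open \<Omega>" "bounded \<Omega>" "smooth_boundary \<Omega>"
    and a_coeff: "\<And>i j. a i j \<in> L_infinity \<Omega>" "\<And>i j. \<exists>L. L-lipschitz_on (closure \<Omega>) (a i j)"
    and b_coeff: "\<And>i. b i \<in> L_infinity \<Omega>"
    and c_coeff: "c \<in> L_infinity \<Omega>" "AE x in lebesgue_on \<Omega>. 0 \<le> c x"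
    and continuity: "M > 0"
      "\<And>y z. y \<in> H10 \<Omega> \<Longrightarrow> z \<in> H10 \<Omega> \<Longrightarrow>
         bilinear_form \<Omega> a b c y z \<le> M * H1_norm \<Omega> y * H1_norm \<Omega> z"
    and coercivity: "\<delta> > 0"
      "\<And>y. y \<in> H10 \<Omega> \<Longrightarrow> bilinear_form \<Omega> a b c y y \<ge> \<delta> * (H1_norm \<Omega> y)\<^sup>2"
    and g_mono: "mono g"
    and g_C1: "\<And>t. g differentiable (at t)" "continuous_on UNIV (deriv g)"
    and g_deriv: "bounded (range (deriv g))" "locally_lipschitz (deriv g)"
    and g_growth: "\<beta> \<ge> 0" "\<And>t. \<bar>g t\<bar> \<le> \<gamma> + \<beta> * \<bar>t\<bar>"
    and data: "f \<in> L2 \<Omega>" "z\<^sub>d \<in> L2 \<Omega>" "v\<^sub>d \<in> L2 \<Omega>" "\<nu> > 0"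
    and controls: "U\<^sub>a\<^sub>d \<subseteq> L2 \<Omega>" "U\<^sub>a\<^sub>d \<noteq> {}" "L2_closed \<Omega> U\<^sub>a\<^sub>d" "convex_functions U\<^sub>a\<^sub>d"
    and feasible_nonempty: "\<F> \<noteq> {}"
    and reference_solution: "optimal_solution J \<F> (ybar, vbar, \<xi>bar)"
    and R: "R > 0" "R \<ge> L2_norm \<Omega> \<xi>bar"
  shows "(\<forall>\<alpha> > 0. \<exists>y v \<xi>. optimal_solution J (\<F>\<^sub>r \<alpha>) (y, v, \<xi>)) \<and>
    (\<forall>\<alpha> y v \<xi>.
       (\<forall>k :: nat. \<alpha> k > 0 \<and> optimal_solution J (\<F>\<^sub>r (\<alpha> k)) (y k, v k, \<xi> k)) \<and> \<alpha> \<longlonglongrightarrow> 0 \<longrightarrow>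
       (\<exists>s ytilde vtilde \<xi>tilde. strict_mono s \<and>
          ytilde \<in> H10 \<Omega> \<and> vtilde \<in> L2 \<Omega> \<and> \<xi>tilde \<in> L2 \<Omega> \<and>
          H1_tendsto \<Omega> (y \<circ> s) ytilde \<and>
          L2_tendsto \<Omega> (v \<circ> s) vtilde \<and>
          L2_weakly_tendsto \<Omega> (\<xi> \<circ> s) \<xi>tilde \<and>
          optimal_solution J \<F> (ytilde, vtilde, \<xi>tilde)))"
proof -
  obtain L where L: "\<And>t. \<bar>deriv g t\<bar> \<le> L"
    using g_deriv(1) by (auto simp: bounded_iff)
  have lipschitz: "\<bar>g s - g t\<bar> \<le> L * \<bar>s - t\<bar>" for s t
  proof -
    have "(g has_field_derivative deriv g x) (at x within UNIV)" for x
      using g_C1(1)[of x] by (simp add: DERIV_deriv_iff_real_differentiable)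
    from field_differentiable_bound[OF convex_UNIV this, of L s t] show ?thesis using L by simp
  qed
  interpret P: semilinear_control_problem \<Omega> a b c f z\<^sub>d v\<^sub>d g U\<^sub>a\<^sub>d M \<delta> L \<nu>
    by unfold_locales
       (fact domain a_coeff(1) b_coeff c_coeff(1) continuity(2) coercivity g_mono lipschitz data controls)+
  have ref: "(ybar, vbar, \<xi>bar) \<in> \<F>"
    using reference_solution by (simp add: optimal_solution_def is_arg_min_def)
  show ?thesis
  proof (intro conjI allI impI)
    fix \<alpha> :: real assume "\<alpha> > 0"
    then show "\<exists>y v \<xi>. optimal_solution J (\<F>\<^sub>r \<alpha>) (y, v, \<xi>)"
      using P.feasible_imp_relaxed_feasible[OF ref[unfolded \<F>_def] R(2)]
      unfolding J_def \<F>\<^sub>r_def by (intro P.relaxed_solution_exists) auto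
  next
    fix \<alpha> y v \<xi>
    assume *: "(\<forall>k :: nat. \<alpha> k > 0 \<and> optimal_solution J (\<F>\<^sub>r (\<alpha> k)) (y k, v k, \<xi> k)) \<and> \<alpha> \<longlonglongrightarrow> 0"
    show "\<exists>s ytilde vtilde \<xi>tilde. strict_mono s \<and>
          ytilde \<in> H10 \<Omega> \<and> vtilde \<in> L2 \<Omega> \<and> \<xi>tilde \<in> L2 \<Omega> \<and>
          H1_tendsto \<Omega> (y \<circ> s) ytilde \<and>
          L2_tendsto \<Omega> (v \<circ> s) vtilde \<and>
          L2_weakly_tendsto \<Omega> (\<xi> \<circ> s) \<xi>tilde \<and>
          optimal_solution J \<F> (ytilde, vtilde, \<xi>tilde)"
      unfolding J_def \<F>_def
      by (rule P.relaxed_solutions_converge[where \<alpha> = \<alpha>, OF reference_solution[unfolded J_def \<F>_def] R(2)])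
         (use * in \<open>auto simp: J_def \<F>\<^sub>r_def\<close>)
  qed
qed

end
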